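(* Let $u,v,w$ be words of the same length $N$ with $|u|_0=|v|_0=|w|_0$ and $\mathrm{d}(w)=\mathrm{d}(u)+\mathrm{d}(v)$. Then the number of oriented TFPLs of size $N$ with boundary $(u,v;w)$ equals the Littlewood--Richardson coefficient $c_{\lambda(u),\lambda(v)}^{\lambda(w)}$.
   Context: Let $N\ge 1$. $G^N$ is the induced subgraph of the square lattice $\mathbb{Z}^2$ formed by $N$ consecutive, horizontally centred rows having $3,5,\dots,2N+1$ vertices from top to bottom. It is bipartite; vertices of the same colour as the leftmost vertex of each row are called odd, the others even. Let $B_1,\dots,B_N$ be the even vertices of the bottom row, $L_1,\dots,L_N$ the leftmost vertices of the rows, and $R_1,\dots,R_N$ the rightmost vertices of the rows, each family numbered from left to right (so $L_1$ is the leftmost vertex of the bottom row and $R_1$ the rightmost vertex of the top row). A TFPL of size $N$ is a subgraph $f$ of $G^N$ (a set of edges) such that each $L_i$ and each $R_i$ has degree $0$ or $1$, each $B_i$ has degree $1$, every other vertex has degree $2$, and no path of $f$ joins two vertices $L_i,L_j$ or two vertices $R_i,R_j$. An oriented TFPL is a TFPL together with an orientation of each of its edges such that every vertex of degree $2$ has one incoming and one outgoing edge, the edges at the $L_i$ are oriented away from $L_i$, and the edges at the $R_i$ are oriented into $R_i$. For words $u,v,w\in\{0,1\}^N$, an oriented TFPL has boundary $(u,v;w)$ if for all $i$: $u_i=1$ iff $L_i$ has degree $1$; $v_i=0$ iff $R_i$ has degree $1$; $w_i=1$ if $B_i$ has in-degree $1$ and $w_i=0$ if $B_i$ has out-degree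 $1$. $|u|_0$ is the number of $0$s in $u$; $\mathrm{d}(u)$ is the number of pairs $i<j$ with $u_i=1,u_j=0$. $\lambda(u)$ is the integer partition whose parts are the nonzero numbers among $\{|u_1\cdots u_{j-1}|_1 : u_j=0\}$ (for each $0$ of $u$, the number of $1$s preceding it), so $|\lambda(u)|=\mathrm{d}(u)$. The Littlewood--Richardson coefficients $c^{\lambda}_{\mu,\nu}$ are defined by $s_\mu s_\nu=\sum_\lambda c^\lambda_{\mu,\nu}s_\lambda$ in the ring of symmetric functions, $s_\lambda$ denoting Schur functions. *)

theory Defs
  imports Main "HOL-Library.Poly_Mapping"
begin

text \<open>Vertices are integer points (x, r): r is the row index, 1 \<le> r \<le> N counted from
  the top, and row r consists of the 2r+1 points with -r \<le> x \<le> r (horizontally centred).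
  Edges join vertices at Euclidean distance 1 (induced subgraph of the square lattice).
  An undirected edge is the two-element set of its endpoints.\<close>

type_synonym vert = "int \<times> int"

definition gverts :: "nat \<Rightarrow> vert set" where
  "gverts N = {(x, r). 1 \<le> r \<and> r \<le> int N \<and> -r \<le> x \<and> x \<le> r}"

definition adj :: "vert \<Rightarrow> vert \<Rightarrow> bool" where
  "adj a b \<longleftrightarrow> \<bar>fst a - fst b\<bar> + \<bar>snd a - snd b\<bar> = 1"

definition gedges :: "nat \<Rightarrow> vert set set" where
  "gedges N = {{a, b} | a b. a \<in> gverts N \<and> b \<in> gverts N \<and> adj a b}"

text \<open>Boundary vertices (indices i = 1..N).  The leftmost vertex of row r is (-r, r); the
  vertices of the same colour as it are those with x + r even ("odd" vertices), so the
  even vertices of the bottom row are (x, N) with x + N odd, i.e. x = -N+1, -N+3, ..., N-1.\<close>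

definition Bv :: "nat \<Rightarrow> nat \<Rightarrow> vert" where
  "Bv N i = (- int N + 2 * int i - 1, int N)"

definition Lv :: "nat \<Rightarrow> nat \<Rightarrow> vert" where
  "Lv N i = (- (int N + 1 - int i), int N + 1 - int i)"

definition Rv :: "nat \<Rightarrow> nat \<Rightarrow> vert" where
  "Rv N i = (int i, int i)"

definition deg :: "vert set set \<Rightarrow> vert \<Rightarrow> nat" where
  "deg f p = card {e \<in> f. p \<in> e}"

definition joined :: "vert set set \<Rightarrow> vert \<Rightarrow> vert \<Rightarrow> bool" where
  "joined f p q \<longleftrightarrow> (p, q) \<in> {(a, b). {a, b} \<in> f}\<^sup>*"

definition is_tfpl :: "nat \<Rightarrow> vert set set \<Rightarrow> bool" where
  "is_tfpl N f \<longleftrightarrow>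
     f \<subseteq> gedges N \<and>
     (\<forall>i\<in>{1..N}. deg f (Lv N i) \<le> 1 \<and> deg f (Rv N i) \<le> 1 \<and> deg f (Bv N i) = 1) \<and>
     (\<forall>p\<in>gverts N. p \<notin> Lv N ` {1..N} \<union> Rv N ` {1..N} \<union> Bv N ` {1..N} \<longrightarrow> deg f p = 2) \<and>
     (\<forall>i\<in>{1..N}. \<forall>j\<in>{1..N}. i \<noteq> j \<longrightarrow>
        \<not> joined f (Lv N i) (Lv N j) \<and> \<not> joined f (Rv N i) (Rv N j))"

text \<open>An oriented TFPL is represented by its set D of directed edges (a, b) (oriented from a
  to b): the underlying undirected edge set is a TFPL and every edge carries exactly one
  orientation.  This is in bijection with pairs (TFPL, orientation of its edges).\<close>

definition undir :: "(vert \<times> vert) set \<Rightarrow> vert set set" where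
  "undir D = {{a, b} | a b. (a, b) \<in> D}"

definition indeg :: "(vert \<times> vert) set \<Rightarrow> vert \<Rightarrow> nat" where
  "indeg D p = card {a. (a, p) \<in> D}"

definition outdeg :: "(vert \<times> vert) set \<Rightarrow> vert \<Rightarrow> nat" where
  "outdeg D p = card {b. (p, b) \<in> D}"

definition is_oriented_tfpl :: "nat \<Rightarrow> (vert \<times> vert) set \<Rightarrow> bool" where
  "is_oriented_tfpl N D \<longleftrightarrow>
     is_tfpl N (undir D) \<and>
     (\<forall>a b. (a, b) \<in> D \<longrightarrow> (b, a) \<notin> D) \<and>
     (\<forall>p\<in>gverts N. deg (undir D) p = 2 \<longrightarrow> indeg D p = 1 \<and> outdeg D p = 1) \<and>
     (\<forall>i\<in>{1..N}. indeg D (Lv N i) = 0 \<and> outdeg D (Rv N i) = 0)"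

text \<open>Words in {0,1}^N are lists of naturals with entries in {0,1}; u_i is u ! (i - 1).\<close>

definition has_boundary ::
  "nat \<Rightarrow> (vert \<times> vert) set \<Rightarrow> nat list \<Rightarrow> nat list \<Rightarrow> nat list \<Rightarrow> bool" where
  "has_boundary N D u v w \<longleftrightarrow>
     (\<forall>i\<in>{1..N}.
        (u ! (i - 1) = 1 \<longleftrightarrow> deg (undir D) (Lv N i) = 1) \<and>
        (v ! (i - 1) = 0 \<longleftrightarrow> deg (undir D) (Rv N i) = 1) \<and>
        (indeg D (Bv N i) = 1 \<longrightarrow> w ! (i - 1) = 1) \<and>
        (outdeg D (Bv N i) = 1 \<longrightarrow> w ! (i - 1) = 0))"

definition zeros :: "nat list \<Rightarrow> nat" where
  "zeros u = count_list u 0"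

definition inv_d :: "nat list \<Rightarrow> nat" where
  "inv_d u = card {(i, j). i < j \<and> j < length u \<and> u ! i = 1 \<and> u ! j = 0}"

definition lam :: "nat list \<Rightarrow> nat list" where
  "lam u = rev (sort (filter (\<lambda>k. k \<noteq> 0)
             [count_list (take j u) 1. j \<leftarrow> [0..<length u], u ! j = 0]))"

definition is_partition :: "nat list \<Rightarrow> bool" where
  "is_partition la \<longleftrightarrow> sorted (rev la) \<and> 0 \<notin> set la"

definition cells :: "nat list \<Rightarrow> (nat \<times> nat) set" where
  "cells la = {(i, j). i < length la \<and> j < la ! i}"

definition ssyt :: "nat \<Rightarrow> nat list \<Rightarrow> (nat \<times> nat \<Rightarrow> nat) set" where
  "ssyt n la = {T. (\<forall>c. c \<notin> cells la \<longrightarrow> T c = 0) \<and>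
       (\<forall>c\<in>cells la. T c < n) \<and>
       (\<forall>i j. (i, Suc j) \<in> cells la \<longrightarrow> T (i, j) \<le> T (i, Suc j)) \<and>
       (\<forall>i j. (Suc i, j) \<in> cells la \<longrightarrow> T (i, j) < T (Suc i, j))}"

type_synonym mpoly = "(nat \<Rightarrow>\<^sub>0 nat) \<Rightarrow>\<^sub>0 int"

definition tab_monomial :: "nat list \<Rightarrow> (nat \<times> nat \<Rightarrow> nat) \<Rightarrow> (nat \<Rightarrow>\<^sub>0 nat)" where
  "tab_monomial la T = (\<Sum>c\<in>cells la. Poly_Mapping.single (T c) 1)"

definition schur :: "nat \<Rightarrow> nat list \<Rightarrow> mpoly" where
  "schur n la = (\<Sum>T\<in>ssyt n la. Poly_Mapping.single (tab_monomial la T) 1)"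

definition partitions_of :: "nat \<Rightarrow> nat list set" where
  "partitions_of k = {la. is_partition la \<and> sum_list la = k}"

text \<open>c^la_{mu,nu} is the coefficient of s_la in s_mu s_nu.  The product is homogeneous of
  degree k = |mu| + |nu|; in n = k variables the Schur polynomials of the partitions of k are
  the images of the Schur functions under the isomorphism Lambda^k \<cong> Lambda_n^k, so the
  expansion may be computed there.  Coefficients of partitions not of size k are 0.\<close>
definition lr_coeff :: "nat list \<Rightarrow> nat list \<Rightarrow> nat list \<Rightarrow> int" where
  "lr_coeff mu nu la =
     (let k = sum_list mu + sum_list nu in
      (THE c. (\<forall>ka. ka \<notin> partitions_of k \<longrightarrow> c ka = 0) \<and>
              schur k mu * schur k nu = (\<Sum>ka\<in>partitions_of k. of_int (c ka) * schur k ka)) la)"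

end

theory Submission
  imports Defs
begin

text \<open>
  An edge is coloured according to whether it leads from an odd to an even vertex, the other way,
  or is absent. Sweep the configuration from the top row to the bottom row by a cut, give the
  coloured edges suitable charges in the plane and consider the antisymmetric area form of the
  charges along the cut. Charge is conserved at every vertex, the area grows at every vertex by a
  fixed amount plus a nonnegative excess, and the total excess is 2(d(w) - d(u) - d(v)). If it is
  zero, every vertex is in one of five states: the edges from an odd vertex to the even vertex below
  it are unused, and what remains is a Knutson--Tao puzzle with labels 0, 1, 10 drawn on the dual lattice.

  Puzzles with an additional rhombus, weighted by differences of spectral parameters, satisfy an
  exchange relation: two adjacent parameters can be swapped at the cost of applying 1 + z tau on all
  three sides, where tau sorts a descent of a word. Dragging one line with parameter x through a
  puzzle whose other parameters vanish produces on each side the branching rule of Schur polynomials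
  for the variable x. Induction on the number of variables then shows that puzzles expand a product
  of Schur polynomials, and these are linearly independent.
\<close>

section \<open>Puzzle pieces and the Yang--Baxter equation\<close>

text \<open>The count needs puzzles with all parameters 0, where the exchange relation is trivial.
  It becomes useful because one line with parameter x can be inserted for free: appended with end
  labels 1 on the right and bottom sides, it leaves the weight unchanged
  (\<open>puz_snoc_N1\<close>). Dragged to the front and restricted to bottom words starting with 0,
  it splits off together with one 0 of each word (\<open>puz_Cons_N0\<close>). So each variable uses
  up one 0. Two obstacles shape the rest. The sum may be enlarged to all bottom words only if these
  are forced to end in 1, which takes many 1s compared with inversions; and \<open>lr_coeff\<close>
  is computed in exactly as many variables as the degree, which takes that many 0s. Both are
  arranged by appending 1s and adding or removing leading 0s, which changes neither the partitions
  nor the number of puzzles. The area form serves twice, with the same charges up to sign: for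
  puzzles it restricts the bottom words, for oriented TFPLs it forces the vertex states. It works
  because replacing a block of charges by one with the same total changes the area by an amount that
  is local to the block.\<close>

text \<open>The puzzle labels 0, 1 and 10.\<close>

datatype lab = N0 | N1 | N10

text \<open>Labels of the left, right and bottom side of an upward triangle. A downward triangle obeys the same
  rule, its sides being listed in the order of the parallel sides of an upward one.\<close>

fun tri :: "lab \<Rightarrow> lab \<Rightarrow> lab \<Rightarrow> bool" where
  "tri N0 N0 N0 = True"
| "tri N1 N1 N1 = True"
| "tri N1 N0 N10 = True"
| "tri N10 N1 N0 = True"
| "tri N0 N10 N1 = True"
| "tri _ _ _ = False"

text \<open>The order 1 > 10 > 0 serves for all three edge directions.\<close>

fun lab_gt :: "lab \<Rightarrow> lab \<Rightarrow> bool" where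
  "lab_gt N1 N10 = True"
| "lab_gt N1 N0 = True"
| "lab_gt N10 N0 = True"
| "lab_gt _ _ = False"

definition sum_lab :: "(lab \<Rightarrow> 'a::comm_monoid_add) \<Rightarrow> 'a" where
  "sum_lab f = f N0 + f N1 + f N10"

text \<open>The upper left and upper right sides are a and b, the lower left and lower right ones p and q. The
  summand z is the weight of the equivariant rhombus, which fills the only pair (0, 1) of binary labels that no
  triangle accepts.\<close>

definition rhomb :: "'a::comm_ring_1 \<Rightarrow> lab \<Rightarrow> lab \<Rightarrow> lab \<Rightarrow> lab \<Rightarrow> 'a" where
  "rhomb z a b p q =
     (if \<exists>c. tri a b c \<and> tri q p c then 1 else 0) + (if a = N0 \<and> b = N1 \<and> p = N1 \<and> q = N0 then z else 0)"

lemma ex_lab: "(\<exists>c. Q c) \<longleftrightarrow> Q N0 \<or> Q N1 \<or> Q N10"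
  by (metis lab.exhaust)

text \<open>\<open>F\<close> is the rest of the picture as a function of the labels that leave the
  rhombus. Identities proved for arbitrary \<open>F\<close> can be applied in the middle of a
  puzzle.\<close>

definition cross :: "'a::comm_ring_1 \<Rightarrow> lab \<Rightarrow> lab \<Rightarrow> (lab \<Rightarrow> lab \<Rightarrow> 'a) \<Rightarrow> 'a" where
  "cross z a b F = sum_lab (\<lambda>p. sum_lab (\<lambda>q. rhomb z a b p q * F p q))"

lemma cross_simps:
  "cross z N0 N0 F = F N0 N0 + F N1 N10"
  "cross z N0 N1 F = z * F N1 N0"
  "cross z N0 N10 F = F N1 N1 + F N10 N0"
  "cross z N1 N0 F = F N0 N1"
  "cross z N1 N1 F = F N1 N1 + F N10 N0"
  "cross z N1 N10 F = 0"
  "cross z N10 N0 F = 0"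
  "cross z N10 N1 F = F N0 N0 + F N1 N10"
  "cross z N10 N10 F = 0"
  by (simp_all add: cross_def sum_lab_def rhomb_def ex_lab)

lemma cross_add: "cross z a b (\<lambda>p q. F p q + G p q) = cross z a b F + cross z a b G"
  by (cases a; cases b; simp add: cross_simps algebra_simps)

lemma cross_mult: "cross z a b (\<lambda>p q. k * F p q) = k * cross z a b F"
  by (cases a; cases b; simp add: cross_simps algebra_simps)

lemma cross_zero: "cross z a b (\<lambda>p q. 0) = 0"
  by (cases a; cases b; simp add: cross_simps)

text \<open>This is 1 + z tau on one pair of letters; it acts as the R-matrix of two parallel lines
  whose parameters differ by \<open>z\<close>.\<close>

definition swap2 :: "'a::comm_ring_1 \<Rightarrow> lab \<Rightarrow> lab \<Rightarrow> (lab \<Rightarrow> lab \<Rightarrow> 'a) \<Rightarrow> 'a" where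
  "swap2 z a b F = F a b + (if lab_gt a b then z * F b a else 0)"

text \<open>Two lines entering on the left cross one entering on the right. Swapping
  \<open>z1\<close> and \<open>z2\<close> moves the factor 1 + z tau from the far side of the
  crossings to the near side. With \<open>F\<close> abstract this is a finite check, one identity
  for each boundary triple.\<close>

lemma yang_baxter_left:
  "cross z2 a2 b (\<lambda>m q2. cross z1 a1 m (\<lambda>p q1. swap2 (z2 - z1) q1 q2 (\<lambda>s t. F s t p))) =
   swap2 (z2 - z1) a1 a2 (\<lambda>s t. cross z1 t b (\<lambda>m q2. cross z2 s m (\<lambda>p q1. F q1 q2 p)))"
  by (cases a1; cases a2; cases b; simp add: cross_simps swap2_def algebra_simps)

text \<open>The mirror image, with the two parallel lines entering on the right. A weight is the
  left parameter minus the right one, hence the reversed difference \<open>z1 - z2\<close>.\<close>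

lemma yang_baxter_right:
  "cross z1 a b1 (\<lambda>p1 m. cross z2 m b2 (\<lambda>p2 q. swap2 (z1 - z2) p1 p2 (\<lambda>s t. F s t q))) =
   swap2 (z1 - z2) b1 b2 (\<lambda>s t. cross z2 a s (\<lambda>p1 m. cross z1 m t (\<lambda>p2 q. F p1 p2 q)))"
  by (cases a; cases b1; cases b2; simp add: cross_simps swap2_def algebra_simps)

text \<open>The puzzle of size 2: the one crossing of two lines with each other, and their two
  triangles on the bottom side.\<close>

definition corner :: "'a::comm_ring_1 \<Rightarrow> lab \<Rightarrow> lab \<Rightarrow> lab \<Rightarrow> lab \<Rightarrow> lab \<Rightarrow> lab \<Rightarrow> 'a" where
  "corner z a1 a2 b1 b2 c1 c2 = cross z a2 b1 (\<lambda>p q. of_bool (tri a1 p c1 \<and> tri q b2 c2))"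

text \<open>Exchanging the two lines negates the weight of their own crossing. The bottom word has
  an ascent where the side words have descents because its operator stands on the other side of the
  equation; \<open>asc_des_adjoint\<close> transposes it later.\<close>

lemma corner_exchange:
  "corner z a1 a2 b1 b2 c1 c2 + (if lab_gt c2 c1 then z * corner z a1 a2 b1 b2 c2 c1 else 0) =
   swap2 z a1 a2 (\<lambda>s1 s2. swap2 z b1 b2 (\<lambda>t1 t2. corner (- z) s1 s2 t1 t2 c1 c2))"
  by (cases a1; cases a2; cases b1; cases b2; cases c1; cases c2; simp add: corner_def cross_simps swap2_def algebra_simps)

text \<open>One strip as a transfer operator. Its line enters at the top with label
  \<open>b\<close>, so the crossings with the upper letters of \<open>u\<close> come first;
  \<open>F\<close> receives the labels on the right side of the strip and the label leaving at the
  bottom.\<close>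

fun strip :: "'a::comm_ring_1 \<Rightarrow> 'a list \<Rightarrow> lab list \<Rightarrow> lab \<Rightarrow> (lab list \<Rightarrow> lab \<Rightarrow> 'a) \<Rightarrow> 'a" where
  "strip y0 [] u b F = F [] b"
| "strip y0 (y # ys) [] b F = 0"
| "strip y0 (y # ys) (a # u) b F =
     strip y0 ys u b (\<lambda>qs m. cross (y - y0) a m (\<lambda>p q. F (q # qs) p))"

text \<open>The word u is read upwards, v downwards and w from left to right. The recursion removes the strip
  along the left side, which the line of the first letter of v crosses from top to bottom.\<close>

primrec puz :: "'a::comm_ring_1 list \<Rightarrow> lab list \<Rightarrow> lab list \<Rightarrow> lab list \<Rightarrow> 'a" where
  "puz [] u v w = of_bool (u = [] \<and> v = [] \<and> w = [])"
| "puz (y # ys) u v w = (case (u, v, w) of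
      (a # u, b # v, c # w) \<Rightarrow> strip y ys u b (\<lambda>qs p. of_bool (tri a p c) * puz ys qs v w)
    | _ \<Rightarrow> 0)"

text \<open>1 + z tau at the letters \<open>i\<close> and \<open>i + 1\<close>, acting on functions
  of words; it is the identity where the word is too short.\<close>

fun des :: "nat \<Rightarrow> 'a::comm_ring_1 \<Rightarrow> (lab list \<Rightarrow> 'a) \<Rightarrow> lab list \<Rightarrow> 'a" where
  "des 0 z F (a # b # u) = swap2 z a b (\<lambda>s t. F (s # t # u))"
| "des (Suc i) z F (a # u) = des i z (\<lambda>u. F (a # u)) u"
| "des _ z F u = F u"

fun asc :: "nat \<Rightarrow> 'a::comm_ring_1 \<Rightarrow> (lab list \<Rightarrow> 'a) \<Rightarrow> lab list \<Rightarrow> 'a" where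
  "asc 0 z F (a # b # u) = F (a # b # u) + (if lab_gt b a then z * F (b # a # u) else 0)"
| "asc (Suc i) z F (a # u) = asc i z (\<lambda>u. F (a # u)) u"
| "asc _ z F u = F u"

lemma strip_add:
  "strip y0 ys u b (\<lambda>qs p. F qs p + G qs p) = strip y0 ys u b F + strip y0 ys u b G"
  by (induction y0 ys u b F arbitrary: G rule: strip.induct) (simp_all add: cross_add)

lemma strip_mult: "strip y0 ys u b (\<lambda>qs p. k * F qs p) = k * strip y0 ys u b F"
  by (induction y0 ys u b F rule: strip.induct) (simp_all add: cross_mult)

lemma strip_zero: "strip y0 ys u b (\<lambda>qs p. 0) = 0"
  using strip_mult[of y0 ys u b 0 "\<lambda>_ _. 0"] by simp

lemma strip_cong:
  assumes "\<And>qs p. length qs = length ys \<Longrightarrow> F qs p = G qs p"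
  shows "strip y0 ys u b F = strip y0 ys u b G"
  using assms
proof (induction y0 ys u b F arbitrary: G rule: strip.induct)
  case (3 y0 y ys a u b F)
  then have "cross (y - y0) a m (\<lambda>p q. F (q # qs) p) = cross (y - y0) a m (\<lambda>p q. G (q # qs) p)"
    if "length qs = length ys" for qs m
    using that by simp
  then show ?case using 3 by simp
qed simp_all

lemma strip_swap2:
  "strip y0 ys u b (\<lambda>qs p. swap2 z s t (\<lambda>s t. F s t qs p)) = swap2 z s t (\<lambda>s t. strip y0 ys u b (F s t))"
  by (simp add: swap2_def strip_add strip_mult strip_zero)

lemma strip_cross:
  "strip y0 ys u b (\<lambda>qs p. cross z s t (\<lambda>s t. F s t qs p)) = cross z s t (\<lambda>s t. strip y0 ys u b (F s t))"
  by (cases s; cases t; simp add: cross_simps strip_add strip_mult strip_zero)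

lemma strip_des:
  "strip y0 ys u b (\<lambda>qs p. des i z (\<lambda>v. F v qs p) v) = des i z (\<lambda>v. strip y0 ys u b (F v)) v"
  by (induction i z "\<lambda>v. strip y0 ys u b (F v)" v arbitrary: F rule: des.induct) (simp_all add: strip_swap2)

lemma strip_asc:
  "strip y0 ys u b (\<lambda>qs p. asc i z (\<lambda>v. F v qs p) v) = asc i z (\<lambda>v. strip y0 ys u b (F v)) v"
  by (induction i z "\<lambda>v. strip y0 ys u b (F v)" v arbitrary: F rule: asc.induct)
    (simp_all add: strip_add strip_mult strip_zero)

lemma cross_swap2:
  "cross k a m (\<lambda>p q. swap2 z s t (\<lambda>s t. F s t p q)) = swap2 z s t (\<lambda>s t. cross k a m (F s t))"
  by (simp add: swap2_def cross_add cross_mult cross_zero)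

lemma cross_des:
  "cross k a m (\<lambda>p q. des i z (\<lambda>v. F v p q) v) = des i z (\<lambda>v. cross k a m (F v)) v"
  by (induction i z "\<lambda>v. cross k a m (F v)" v arbitrary: F rule: des.induct) (simp_all add: cross_swap2)

lemma des_mult: "des i z (\<lambda>v. k * F v) v = k * des i z F v"
  by (induction i z F v rule: des.induct) (simp_all add: swap2_def algebra_simps)

lemma asc_mult: "asc i z (\<lambda>v. k * F v) v = k * asc i z F v"
  by (induction i z F v rule: asc.induct) (simp_all add: algebra_simps)

text \<open>A strip whose own line keeps its place: the operator moves from the labels on its right
  to those on its left, by \<open>yang_baxter_left\<close> at the two letters concerned.\<close>

lemma strip_exchange_inner:
  assumes "length u = length as + length bs + 2"
  shows "strip y0 (as @ y1 # y2 # bs) u b (\<lambda>qs p. des (length as) (y2 - y1) (\<lambda>qs. F qs p) qs) =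
         des (length as) (y2 - y1) (\<lambda>u. strip y0 (as @ y2 # y1 # bs) u b F) u"
  using assms
proof (induction as arbitrary: u F)
  case Nil
  then obtain a1 a2 u' where u: "u = a1 # a2 # u'"
    by (cases u; cases "tl u"; auto)
  have "strip y0 (y1 # y2 # bs) u b (\<lambda>qs p. des 0 (y2 - y1) (\<lambda>qs. F qs p) qs) =
    strip y0 bs u' b (\<lambda>qs m. swap2 (y2 - y1) a1 a2 (\<lambda>s t. cross (y1 - y0) t m (\<lambda>m q2.
       cross (y2 - y0) s m (\<lambda>p q1. F (q1 # q2 # qs) p))))"
    using yang_baxter_left[of "y2 - y0" a2 _ "y1 - y0" a1 "\<lambda>q1 q2 p. F (q1 # q2 # _) p"]
    by (simp add: u)
  then show ?case by (simp add: u strip_swap2)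
next
  case (Cons y as)
  then obtain a u' where u: "u = a # u'" "length u' = length as + length bs + 2"
    by (cases u) auto
  show ?case
    using Cons.IH[OF u(2), of "\<lambda>qs m. cross (y - y0) a m (\<lambda>p q. F (q # qs) p)"]
    by (simp add: u(1) cross_des)
qed

text \<open>The strips of the two exchanged lines, above their corner: the operator moves from the
  lower ends of the lines to the upper ends, one use of \<open>yang_baxter_right\<close> per letter
  of \<open>u\<close>.\<close>

lemma strip_exchange_outer:
  assumes "length u = length ys"
  shows "strip y1 ys u b1 (\<lambda>qs m. strip y2 ys qs b2 (\<lambda>os n. swap2 (y2 - y1) m n (\<lambda>s t. F os s t))) =
    swap2 (y2 - y1) b1 b2 (\<lambda>s t. strip y2 ys u s (\<lambda>qs m. strip y1 ys qs t (\<lambda>os n. F os m n)))"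
  using assms
proof (induction ys arbitrary: u F)
  case Nil
  then show ?case by simp
next
  case (Cons y ys)
  then obtain a u' where u: "u = a # u'" "length u' = length ys"
    by (cases u) auto
  show ?case
    using Cons.IH[OF u(2), of "\<lambda>os m n. cross (y - y2) a m (\<lambda>p1 m. cross (y - y1) m n (\<lambda>p2 q. F (q # os) p1 p2))"]
      yang_baxter_right[of "y - y1" a _ "y - y2" _ "\<lambda>s t q. F (q # _) s t"]
    by (simp add: u(1) strip_cross[symmetric])
qed

lemma puz_two:
  assumes "length u = length ys"
  shows "puz (y1 # y2 # ys) (a1 # a2 # u) (b1 # b2 # v) (c1 # c2 # w) =
    strip y1 ys u b1 (\<lambda>qs m. strip y2 ys qs b2 (\<lambda>os n. corner (y2 - y1) a1 a2 m n c1 c2 * puz ys os v w))"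
proof -
  have "corner (y2 - y1) a1 a2 m n c1 c2 * k =
      cross (y2 - y1) a2 m (\<lambda>p q. of_bool (tri a1 p c1) * (of_bool (tri q n c2) * k))" for m n and k :: 'a
    unfolding corner_def using cross_mult[of "y2 - y1" a2 m k "\<lambda>p q. of_bool (tri a1 p c1 \<and> tri q n c2)"]
    by (simp add: mult_ac of_bool_conj)
  then show ?thesis
    by (simp add: strip_cross strip_mult)
qed

lemma swap2_mult: "swap2 z a b (\<lambda>s t. F s t * k) = swap2 z a b F * k"
  by (simp add: swap2_def algebra_simps)

text \<open>Strips to the left of the two lines only transmit the operators. In the base case
  \<open>corner_exchange\<close> creates them; the one for the right word moves up through the two
  strips, while the one for the left word acts on letters that occur only in the corner.\<close>

theorem puz_exchange:
  assumes "length u = length as + length bs + 2" "length v = length u" "length w = length u"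
  shows "asc (length as) (y2 - y1) (puz (as @ y1 # y2 # bs) u v) w =
    des (length as) (y2 - y1) (\<lambda>u. des (length as) (y2 - y1) (\<lambda>v. puz (as @ y2 # y1 # bs) u v w) v) u"
  using assms
proof (induction as arbitrary: u v w)
  case Nil
  obtain a1 a2 u' where u: "u = a1 # a2 # u'" "length u' = length bs" using Nil
    by (cases u; cases "tl u"; auto)
  obtain b1 b2 v' where v: "v = b1 # b2 # v'" using Nil by (cases v; cases "tl v"; auto)
  obtain c1 c2 w' where w: "w = c1 # c2 # w'" using Nil by (cases w; cases "tl w"; auto)
  let ?z = "y2 - y1"
  have "asc 0 ?z (puz (y1 # y2 # bs) u v) w =
    strip y1 bs u' b1 (\<lambda>qs m. strip y2 bs qs b2 (\<lambda>os n.
      (corner ?z a1 a2 m n c1 c2 + (if lab_gt c2 c1 then ?z * corner ?z a1 a2 m n c2 c1 else 0)) * puz bs os v' w'))"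
    unfolding u v w asc.simps puz_two[OF u(2)]
    by (simp add: strip_add distrib_right strip_mult mult.assoc strip_zero)
  also have "\<dots> = strip y1 bs u' b1 (\<lambda>qs m. strip y2 bs qs b2 (\<lambda>os n.
      swap2 ?z m n (\<lambda>t1 t2. swap2 ?z a1 a2 (\<lambda>s1 s2. corner (- ?z) s1 s2 t1 t2 c1 c2 * puz bs os v' w'))))"
    unfolding corner_exchange swap2_mult[symmetric]
    by (rule arg_cong[where f = "strip y1 bs u' b1"], intro ext, rule arg_cong[where f = "strip y2 bs _ b2"], intro ext)
      (auto simp: swap2_def algebra_simps)
  also have "\<dots> = swap2 ?z b1 b2 (\<lambda>s t. strip y2 bs u' s (\<lambda>qs m. strip y1 bs qs t (\<lambda>os n.
       swap2 ?z a1 a2 (\<lambda>s1 s2. corner (- ?z) s1 s2 m n c1 c2 * puz bs os v' w'))))"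
    by (rule strip_exchange_outer[OF u(2)])
  also have "\<dots> = swap2 ?z a1 a2 (\<lambda>s1 s2. swap2 ?z b1 b2 (\<lambda>s t. strip y2 bs u' s (\<lambda>qs m. strip y1 bs qs t (\<lambda>os n.
       corner (y1 - y2) s1 s2 m n c1 c2 * puz bs os v' w'))))"
    by (simp add: strip_swap2) (auto simp: swap2_def algebra_simps)
  also have "\<dots> = des 0 ?z (\<lambda>u. des 0 ?z (\<lambda>v. puz (y2 # y1 # bs) u v w) v) u"
    unfolding u v w des.simps puz_two[OF u(2)] by simp
  finally show ?case by (simp only: append_Nil list.size)
next
  case (Cons y as)
  obtain a u' where u: "u = a # u'" "length u' = length as + length bs + 2" using Cons.prems by (cases u) auto
  obtain b v' where v: "v = b # v'" "length v' = length u'" using Cons.prems u by (cases v) auto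
  obtain c w' where w: "w = c # w'" "length w' = length u'" using Cons.prems u by (cases w) auto
  let ?z = "y2 - y1" and ?i = "length as" and ?ys = "as @ y1 # y2 # bs" and ?ys' = "as @ y2 # y1 # bs"
  have "asc (length (y # as)) ?z (puz ((y # as) @ y1 # y2 # bs) u v) w =
     strip y ?ys u' b (\<lambda>qs p. of_bool (tri a p c) * asc ?i ?z (puz ?ys qs v') w')"
    by (simp add: u(1) v(1) w(1) strip_asc[symmetric] asc_mult)
  also have "\<dots> = strip y ?ys u' b (\<lambda>qs p. of_bool (tri a p c) *
      des ?i ?z (\<lambda>qs. des ?i ?z (\<lambda>v. puz ?ys' qs v w') v') qs)"
    using Cons.IH u v w by (intro strip_cong) simp
  also have "\<dots> = des ?i ?z (\<lambda>u. strip y ?ys' u b (\<lambda>qs p. of_bool (tri a p c) * des ?i ?z (\<lambda>v. puz ?ys' qs v w') v')) u'"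
    using strip_exchange_inner[OF u(2), of y y1 y2 b "\<lambda>qs p. of_bool (tri a p c) * des ?i ?z (\<lambda>v. puz ?ys' qs v w') v'"]
    by (simp add: des_mult)
  also have "\<dots> = des (length (y # as)) ?z (\<lambda>u. des (length (y # as)) ?z (\<lambda>v. puz ((y # as) @ y2 # y1 # bs) u v w) v) u"
    by (simp add: u(1) v(1) w(1) strip_des[symmetric] des_mult)
  finally show ?case .
qed

section \<open>Dragging a line through a puzzle\<close>

abbreviation bin :: "lab list \<Rightarrow> bool" where
  "bin u \<equiv> set u \<subseteq> {N0, N1}"

lemma strip_snoc:
  assumes "length u = length ys"
  shows "strip y0 (ys @ [y]) (u @ [a]) b F =
    cross (y - y0) a b (\<lambda>p q. strip y0 ys u p (\<lambda>qs m. F (qs @ [q]) m))"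
  using assms
proof (induction ys arbitrary: u F)
  case Nil
  then show ?case by simp
next
  case (Cons y' ys)
  then obtain a' u' where u: "u = a' # u'" "length u' = length ys"
    by (cases u) auto
  show ?case using Cons.IH[OF u(2)] by (simp add: u(1))
qed

text \<open>The last bottom letter forces the new line to leave every crossing with label 1. Against
  a binary label only an incoming 1 does so, and both labels then pass straight through; the
  weighted rhombus releases a 0 and cannot contribute, so \<open>x\<close> disappears.\<close>

lemma puz_snoc_N1:
  assumes "length u = length ys" "length v = length ys" "length w = length ys" "bin v"
  shows "puz (ys @ [x]) (u @ [q]) (v @ [N1]) (w @ [N1]) = of_bool (q = N1) * puz ys u v w"
  using assms
proof (induction ys arbitrary: u v w q)
  case Nil
  then show ?case by (cases q) auto
next
  case (Cons y ys)
  obtain a u' where u: "u = a # u'" "length u' = length ys" using Cons.prems by (cases u) auto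
  obtain b v' where v: "v = b # v'" "length v' = length ys" "bin v'" "b = N0 \<or> b = N1"
    using Cons.prems by (cases v) auto
  obtain c w' where w: "w = c # w'" "length w' = length ys" using Cons.prems by (cases w) auto
  have "puz ((y # ys) @ [x]) (u @ [q]) (v @ [N1]) (w @ [N1]) =
     cross (x - y) q b (\<lambda>p q. strip y ys u' p (\<lambda>qs m. of_bool (tri a m c) * puz (ys @ [x]) (qs @ [q]) (v' @ [N1]) (w' @ [N1])))"
    by (simp add: u(1) v(1) w(1) strip_snoc[OF u(2)])
  also have "\<dots> = cross (x - y) q b (\<lambda>p q. of_bool (q = N1) * strip y ys u' p (\<lambda>qs m. of_bool (tri a m c) * puz ys qs v' w'))"
  proof -
    have "strip y ys u' p (\<lambda>qs m. of_bool (tri a m c) * puz (ys @ [x]) (qs @ [q]) (v' @ [N1]) (w' @ [N1])) =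
      strip y ys u' p (\<lambda>qs m. of_bool (q = N1) * (of_bool (tri a m c) * puz ys qs v' w'))" for p q
      using Cons.IH v w by (intro strip_cong) simp
    then show ?thesis by (simp only: strip_mult)
  qed
  also have "\<dots> = of_bool (q = N1) * strip y ys u' b (\<lambda>qs m. of_bool (tri a m c) * puz ys qs v' w')"
    using v(4) by (cases q) (auto simp: cross_simps)
  finally show ?case by (simp add: u(1) v(1) w(1))
qed

text \<open>At a binary left letter, a line leaves with 0 only if it entered with 0, and then the
  letter passes unchanged. In \<open>puz_Cons_N0\<close> this makes the first strip trivial once the
  bottom word starts with 0.\<close>

lemma strip_to_N0:
  assumes "length u = length ys" "bin u" "\<And>qs p. p \<noteq> N0 \<Longrightarrow> F qs p = 0"
  shows "strip x ys u b F = of_bool (b = N0) * F u N0"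
  using assms
proof (induction ys arbitrary: u F)
  case Nil
  then show ?case by (cases b) auto
next
  case (Cons y ys)
  obtain a u' where u: "u = a # u'" "length u' = length ys" "bin u'" "a = N0 \<or> a = N1"
    using Cons.prems by (cases u) auto
  have "strip x ys u' b (\<lambda>qs m. cross (y - x) a m (\<lambda>p q. F (q # qs) p)) =
     of_bool (b = N0) * cross (y - x) a N0 (\<lambda>p q. F (q # u') p)"
  proof (rule Cons.IH[OF u(2,3)])
    fix m qs assume "m \<noteq> N0"
    then show "cross (y - x) a m (\<lambda>p q. F (q # qs) p) = 0"
      using u(4) Cons.prems(3) by (cases m) (auto simp: cross_simps)
  qed
  then show ?case
    using u(4) Cons.prems(3) by (auto simp: u(1) cross_simps)
qed

lemma puz_Cons_N0:
  assumes "length u = length ys" "bin (a # u)"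
  shows "puz (x # ys) (a # u) (b # v) (N0 # w) = of_bool (a = N0 \<and> b = N0) * puz ys u v w"
proof -
  have "strip x ys u b (\<lambda>qs p. of_bool (tri a p N0) * puz ys qs v w) =
     of_bool (b = N0) * (of_bool (tri a N0 N0) * puz ys u v w)"
  proof (rule strip_to_N0)
    fix qs p assume "p \<noteq> N0"
    then show "of_bool (tri a p N0) * puz ys qs v w = 0"
      using assms(2) by (cases p) auto
  qed (use assms in auto)
  then show ?thesis using assms(2) by (auto)
qed

section \<open>Transposition and commutation of the sorting operators\<close>

definition words :: "nat \<Rightarrow> lab list set" where
  "words n = {u. length u = n}"

lemma words_0: "words 0 = {[]}"
  by (auto simp: words_def)

lemma lab_UNIV: "UNIV = {N0, N1, N10}"
proof (intro equalityI subsetI)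
  fix a :: lab
  show "a \<in> {N0, N1, N10}" by (cases a) simp_all
qed (rule UNIV_I)

lemma finite_lab: "finite (UNIV :: lab set)"
  unfolding lab_UNIV by (intro finite.intros)

lemma finite_words: "finite (words n)"
  using finite_lists_length_eq[OF finite_lab, of n] unfolding words_def by (simp only: subset_UNIV simp_thms)

lemma sum_lab_UNIV: "(\<Sum>a\<in>UNIV. f a) = sum_lab f"
  unfolding lab_UNIV sum_lab_def by (simp add: add.assoc)

lemma sum_words_Suc: "(\<Sum>u\<in>words (Suc n). f u) = (\<Sum>u\<in>words n. sum_lab (\<lambda>a. f (a # u)))"
proof -
  have "words (Suc n) = (\<lambda>(u, a). a # u) ` (words n \<times> UNIV)"
    by (force simp: words_def length_Suc_conv image_iff)
  then have "(\<Sum>u\<in>words (Suc n). f u) = (\<Sum>(u, a)\<in>words n \<times> UNIV. f (a # u))"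
    by (simp add: sum.reindex inj_on_def case_prod_unfold)
  also have "\<dots> = (\<Sum>u\<in>words n. \<Sum>a\<in>UNIV. f (a # u))"
    by (rule sum.cartesian_product[symmetric])
  finally show ?thesis
    by (simp only: sum_lab_UNIV)
qed

text \<open>Swapping two adjacent letters is an involution of \<open>words n\<close> that exchanges
  ascents and descents.\<close>

lemma asc_des_adjoint:
  "(\<Sum>w\<in>words n. asc i z F w * G w) = (\<Sum>w\<in>words n. F w * des i z G w)"
proof (induction i arbitrary: n F G)
  case 0
  show ?case
  proof (cases "\<exists>k. n = Suc (Suc k)")
    case True
    then obtain k where n: "n = Suc (Suc k)" by blast
    show ?thesis unfolding n sum_words_Suc
      by (rule sum.cong) (auto simp: sum_lab_def swap2_def algebra_simps)
  next
    case False
    then have "asc 0 z F w = F w \<and> des 0 z G w = G w" if "w \<in> words n" for w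
      using that by (cases w; cases "tl w") (auto simp: words_def)
    then show ?thesis by simp
  qed
next
  case (Suc i)
  show ?case
  proof (cases n)
    case 0
    then show ?thesis by (simp add: words_0)
  next
    case (Suc m)
    show ?thesis unfolding Suc sum_words_Suc asc.simps des.simps sum_lab_def
      by (simp add: Suc.IH sum.distrib)
  qed
qed

text \<open>Evaluated at a word, the last pair is treated first. On a binary word a 0 can thus
  travel left past several 1s, while each 1 moves right by at most one place; this is the source of
  the interlacing conditions.\<close>

fun chain_des :: "nat \<Rightarrow> 'a::comm_ring_1 \<Rightarrow> (lab list \<Rightarrow> 'a) \<Rightarrow> lab list \<Rightarrow> 'a" where
  "chain_des 0 x G = G"
| "chain_des (Suc n) x G = des n x (chain_des n x G)"

text \<open>The factors come in the opposite order, as transposition requires.\<close>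

fun chain_asc :: "nat \<Rightarrow> 'a::comm_ring_1 \<Rightarrow> (lab list \<Rightarrow> 'a) \<Rightarrow> lab list \<Rightarrow> 'a" where
  "chain_asc 0 x G = G"
| "chain_asc (Suc n) x G = chain_asc n x (asc n x G)"

lemma chain_adjoint:
  "(\<Sum>w\<in>words n. chain_asc i x F w * G w) = (\<Sum>w\<in>words n. F w * chain_des i x G w)"
  by (induction i arbitrary: F) (simp_all add: asc_des_adjoint)

lemma des_cong:
  assumes "\<And>u. length u = n \<Longrightarrow> F u = G u" "length u = n"
  shows "des i z F u = des i z G u"
  using assms
  by (induction i z F u arbitrary: n G rule: des.induct) (auto simp: swap2_def length_Suc_conv)

lemma asc_cong:
  assumes "\<And>u. length u = n \<Longrightarrow> F u = G u" "length u = n"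
  shows "asc i z F u = asc i z G u"
  using assms
  by (induction i z F u arbitrary: n G rule: asc.induct) (auto simp: length_Suc_conv)

lemma chain_asc_cong:
  assumes "\<And>u. length u = n \<Longrightarrow> F u = G u" "length u = n"
  shows "chain_asc i z F u = chain_asc i z G u"
  using assms
proof (induction i arbitrary: F G)
  case (Suc i)
  have "asc i z F w = asc i z G w" if "length w = n" for w
    by (rule asc_cong[OF Suc.prems(1) that])
  then show ?case using Suc.IH[of "asc i z F" "asc i z G"] Suc.prems(2) by (simp only: chain_asc.simps)
qed (simp only: chain_asc.simps)

lemma asc_add: "asc j k (\<lambda>w. F w + G w) w = asc j k F w + asc j k G w"
proof (induction j k F w arbitrary: G rule: asc.induct)
  case (1 z F a b u)
  then show ?case by (simp add: algebra_simps)
next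
  case (2 i z F a u)
  show ?case using 2[of "\<lambda>u. G (a # u)"] by (simp only: asc.simps)
qed (simp_all only: asc.simps)

lemma des_add: "des j k (\<lambda>w. F w + G w) w = des j k F w + des j k G w"
proof (induction j k F w arbitrary: G rule: des.induct)
  case (1 z F a b u)
  then show ?case by (simp add: swap2_def algebra_simps)
next
  case (2 i z F a u)
  show ?case using 2[of "\<lambda>u. G (a # u)"] by (simp only: des.simps)
qed (simp_all only: des.simps)

lemma asc_swap2:
  "asc j k (\<lambda>w. swap2 z a b (\<lambda>s t. F s t w)) w = swap2 z a b (\<lambda>s t. asc j k (F s t) w)"
proof (cases "lab_gt a b")
  case True
  then show ?thesis
    unfolding swap2_def by (simp only: if_True asc_add asc_mult)
qed (simp add: swap2_def)

lemma des_swap2: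
  "des j k (\<lambda>w. swap2 z a b (\<lambda>s t. F s t w)) w = swap2 z a b (\<lambda>s t. des j k (F s t) w)"
proof (cases "lab_gt a b")
  case True
  then show ?thesis
    unfolding swap2_def by (simp only: if_True des_add des_mult)
qed (simp add: swap2_def)

text \<open>Operators on different words commute. This is what allows \<open>puz_exchange\<close> to
  be iterated, since each step leaves operators on the side words underneath those still to be
  applied to the bottom word.\<close>

lemma asc_des_commute:
  "asc j k (\<lambda>w. des i z (\<lambda>u. F u w) u) w = des i z (\<lambda>u. asc j k (F u) w) u"
  by (induction i z "\<lambda>u. asc j k (F u) w" u arbitrary: F rule: des.induct) (simp_all add: asc_swap2)

lemma des_des_commute:
  "des j k (\<lambda>w. des i z (\<lambda>u. F u w) u) w = des i z (\<lambda>u. des j k (F u) w) u"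
  by (induction i z "\<lambda>u. des j k (F u) w" u arbitrary: F rule: des.induct) (simp_all add: des_swap2)

lemma chain_asc_des_commute:
  "chain_asc j k (\<lambda>w. des i z (\<lambda>u. F u w) u) w = des i z (\<lambda>u. chain_asc j k (F u) w) u"
proof (induction j arbitrary: F)
  case (Suc j)
  have "asc j k (\<lambda>w. des i z (\<lambda>u. F u w) u) = (\<lambda>w. des i z (\<lambda>u. asc j k (F u) w) u)"
    by (rule ext) (rule asc_des_commute)
  then show ?case by (simp add: Suc)
qed simp

lemma chain_des_des_commute:
  "des j k (\<lambda>w. chain_des i z (\<lambda>u. F u w) u) w = chain_des i z (\<lambda>u. des j k (F u) w) u"
  by (induction i arbitrary: u) (simp_all add: des_des_commute)

text \<open>The line with parameter \<open>x\<close> moves to the front past \<open>n\<close> lines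
  with parameter 0, so each exchange has the same difference \<open>x\<close>.\<close>

lemma puz_chain:
  assumes "n \<le> N" "length u = Suc N" "length v = Suc N" "length w = Suc N"
  shows "chain_asc n x (puz (replicate n 0 @ x # replicate (N - n) 0) u v) w =
    chain_des n x (\<lambda>u. chain_des n x (\<lambda>v. puz (x # replicate N 0) u v w) v) u"
  using assms
proof (induction n arbitrary: u v w)
  case 0
  then show ?case by simp
next
  case (Suc n)
  let ?P = "\<lambda>n. puz (replicate n 0 @ x # replicate (N - n) 0)"
  have P: "?P (Suc n) = puz (replicate n 0 @ 0 # x # replicate (N - Suc n) 0)"
    by (simp add: replicate_append_same[symmetric])
  have P': "?P n = puz (replicate n 0 @ x # 0 # replicate (N - Suc n) 0)"
    using Suc.prems by (simp add: Suc_diff_Suc flip: replicate_Suc)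
  have step: "asc n x (?P (Suc n) u v) w = des n x (\<lambda>u. des n x (\<lambda>v. ?P n u v w) v) u"
    if "length w = Suc N" for w
    using puz_exchange[of u "replicate n 0" "replicate (N - Suc n) 0" v w x 0] Suc.prems that P P' by simp
  have "chain_asc (Suc n) x (?P (Suc n) u v) w = chain_asc n x (\<lambda>w. des n x (\<lambda>u. des n x (\<lambda>v. ?P n u v w) v) u) w"
    using chain_asc_cong[of "Suc N", OF step] Suc.prems by simp
  also have "\<dots> = des n x (\<lambda>u. des n x (\<lambda>v. chain_asc n x (?P n u v) w) v) u"
    by (simp add: chain_asc_des_commute)
  also have "\<dots> = des n x (\<lambda>u. des n x (\<lambda>v. chain_des n x (\<lambda>u. chain_des n x (\<lambda>v. puz (x # replicate N 0) u v w) v) u) v) u"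
    using Suc by (intro des_cong[of "Suc N"]) auto
  also have "(\<lambda>u. des n x (\<lambda>v. chain_des n x (\<lambda>u. chain_des n x (\<lambda>v. puz (x # replicate N 0) u v w) v) u) v) =
     (\<lambda>u. chain_des n x (\<lambda>u. des n x (\<lambda>v. chain_des n x (\<lambda>v. puz (x # replicate N 0) u v w) v) v) u)"
    by (rule ext) (rule chain_des_des_commute)
  finally show ?case by (simp only: chain_des.simps)
qed

section \<open>The area form of a puzzle\<close>

definition tot1 :: "(int \<times> int) list \<Rightarrow> int" where "tot1 xs = sum_list (map fst xs)"
definition tot2 :: "(int \<times> int) list \<Rightarrow> int" where "tot2 xs = sum_list (map snd xs)"

lemma tot_simps [simp]:
  "tot1 [] = 0" "tot1 (x # xs) = fst x + tot1 xs" "tot1 (xs @ ys) = tot1 xs + tot1 ys"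
  "tot2 [] = 0" "tot2 (x # xs) = snd x + tot2 xs" "tot2 (xs @ ys) = tot2 xs + tot2 ys"
  by (simp_all add: tot1_def tot2_def)

text \<open>The sum of the determinants of all pairs of charges, taken in the order of the
  list.\<close>

fun area :: "(int \<times> int) list \<Rightarrow> int" where
  "area [] = 0"
| "area (x # xs) = fst x * tot2 xs - snd x * tot1 xs + area xs"

lemma area_append:
  "area (xs @ ys) = area xs + area ys + tot1 xs * tot2 ys - tot2 xs * tot1 ys"
  by (induction xs) (simp_all add: algebra_simps)

text \<open>The terms between a block and its surroundings depend on the block only through its
  total charge.\<close>

lemma area_replace:
  assumes "tot1 a = tot1 b" "tot2 a = tot2 b"
  shows "area (xs @ a @ ys) = area (xs @ b @ ys) + (area a - area b)"
  by (simp add: area_append assms)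

text \<open>Charges of the labels on the three kinds of edges. They are conserved by every triangle, and the
  area form changes by the same amount at all five triangles; the equivariant rhombus loses two units.\<close>

fun slashQ :: "lab \<Rightarrow> int \<times> int" where
  "slashQ N0 = (-1, 1)" | "slashQ N1 = (0, 1)" | "slashQ N10 = (-1, 2)"

fun backQ :: "lab \<Rightarrow> int \<times> int" where
  "backQ N0 = (1, 0)" | "backQ N1 = (1, -1)" | "backQ N10 = (2, -1)"

fun horQ :: "lab \<Rightarrow> int \<times> int" where
  "horQ N0 = (0, 1)" | "horQ N1 = (1, 0)" | "horQ N10 = (1, 1)"

lemma cross_support:
  assumes "cross z a b F \<noteq> 0"
  obtains p q where "F p q \<noteq> 0"
    "tot1 [backQ p, slashQ q] = tot1 [slashQ a, backQ b]" "tot2 [backQ p, slashQ q] = tot2 [slashQ a, backQ b]"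
    "area [backQ p, slashQ q] \<le> area [slashQ a, backQ b] + 2"
    "z = 0 \<Longrightarrow> area [backQ p, slashQ q] = area [slashQ a, backQ b] + 2"
proof (rule ccontr)
  assume "\<not> thesis"
  with that have *: "F p q = 0" if
    "tot1 [backQ p, slashQ q] = tot1 [slashQ a, backQ b]" "tot2 [backQ p, slashQ q] = tot2 [slashQ a, backQ b]"
    "area [backQ p, slashQ q] \<le> area [slashQ a, backQ b] + 2"
    "z = 0 \<longrightarrow> area [backQ p, slashQ q] = area [slashQ a, backQ b] + 2" for p q
    using that by blast
  have "cross z a b F = 0"
    using * by (cases "z = 0"; cases a; cases b; simp add: cross_simps)
  with assms show False by contradiction
qed

lemma strip_support:
  assumes "length u = length ys" "strip y0 ys u b F \<noteq> 0"
  shows "\<exists>qs p. length qs = length ys \<and> F qs p \<noteq> 0 \<and>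
    tot1 (backQ p # map slashQ qs) = tot1 (map slashQ u @ [backQ b]) \<and>
    tot2 (backQ p # map slashQ qs) = tot2 (map slashQ u @ [backQ b]) \<and>
    area (backQ p # map slashQ qs) \<le> area (map slashQ u @ [backQ b]) + 2 * int (length ys) \<and>
    (set ys \<subseteq> {y0} \<longrightarrow>
      area (backQ p # map slashQ qs) = area (map slashQ u @ [backQ b]) + 2 * int (length ys))"
  using assms
proof (induction ys arbitrary: u F)
  case Nil
  then show ?case by auto
next
  case (Cons y ys)
  obtain a u' where u: "u = a # u'" "length u' = length ys" using Cons.prems by (cases u) auto
  obtain qs m where qs: "length qs = length ys" "cross (y - y0) a m (\<lambda>p q. F (q # qs) p) \<noteq> 0"
    and t: "tot1 (backQ m # map slashQ qs) = tot1 (map slashQ u' @ [backQ b])"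
     "tot2 (backQ m # map slashQ qs) = tot2 (map slashQ u' @ [backQ b])"
    and ar: "area (backQ m # map slashQ qs) \<le> area (map slashQ u' @ [backQ b]) + 2 * int (length ys)"
      "set ys \<subseteq> {y0} \<Longrightarrow>
      area (backQ m # map slashQ qs) = area (map slashQ u' @ [backQ b]) + 2 * int (length ys)"
    using Cons.IH[OF u(2)] Cons.prems(2) unfolding u(1) strip.simps by blast
  obtain p q where pq: "F (q # qs) p \<noteq> 0"
    "tot1 [backQ p, slashQ q] = tot1 [slashQ a, backQ m]" "tot2 [backQ p, slashQ q] = tot2 [slashQ a, backQ m]"
    "area [backQ p, slashQ q] \<le> area [slashQ a, backQ m] + 2"
    "y - y0 = 0 \<Longrightarrow> area [backQ p, slashQ q] = area [slashQ a, backQ m] + 2"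
    using cross_support[OF qs(2)] by metis
  have e1: "area (backQ p # map slashQ (q # qs)) =
     area (slashQ a # backQ m # map slashQ qs) + (area [backQ p, slashQ q] - area [slashQ a, backQ m])"
    using area_replace[OF pq(2,3), of "[]" "map slashQ qs"] by simp
  have e2: "area (slashQ a # backQ m # map slashQ qs) = area (map slashQ u @ [backQ b]) +
     (area (backQ m # map slashQ qs) - area (map slashQ u' @ [backQ b]))"
    using area_replace[OF t, of "[slashQ a]" "[]"] by (simp add: u(1))
  show ?case
  proof (intro exI[of _ "q # qs"] exI[of _ p] conjI impI)
    show "area (backQ p # map slashQ (q # qs)) \<le> area (map slashQ u @ [backQ b]) + 2 * int (length (y # ys))"
      using e1 e2 ar(1) pq(4) by simp
  next
    assume "set (y # ys) \<subseteq> {y0}"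
    then show "area (backQ p # map slashQ (q # qs)) = area (map slashQ u @ [backQ b]) + 2 * int (length (y # ys))"
      using e1 e2 ar(2) pq(5) by simp
  qed (use qs pq t u in auto)
qed

lemma tri_support:
  assumes "tri a p c"
  shows "tot1 [horQ c] = tot1 [slashQ a, backQ p]" "tot2 [horQ c] = tot2 [slashQ a, backQ p]"
    "area [slashQ a, backQ p] = -1"
  using assms by (cases a; cases p; cases c; simp)+

text \<open>A puzzle of size n has n(n-1)/2 rhombi, adding 2 each or less if equivariant, and n
  bottom triangles adding 1 each, which makes n^2. The inequality is needed for the dragged line,
  whose parameter differs from the others.\<close>

lemma puz_area:
  assumes "length u = length ys" "length v = length ys" "length w = length ys" "puz ys u v w \<noteq> 0"
  shows "tot1 (map horQ w) = tot1 (map slashQ u @ map backQ v) \<and>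
    tot2 (map horQ w) = tot2 (map slashQ u @ map backQ v) \<and>
    area (map horQ w) \<le> area (map slashQ u @ map backQ v) + int (length ys) ^ 2 \<and>
    (set ys \<subseteq> {y0} \<longrightarrow> area (map horQ w) = area (map slashQ u @ map backQ v) + int (length ys) ^ 2)"
  using assms
proof (induction ys arbitrary: u v w)
  case Nil
  then show ?case by auto
next
  case (Cons y ys)
  obtain a u' where u: "u = a # u'" "length u' = length ys" using Cons.prems by (cases u) auto
  obtain b v' where v: "v = b # v'" "length v' = length ys" using Cons.prems by (cases v) auto
  obtain c w' where w: "w = c # w'" "length w' = length ys" using Cons.prems by (cases w) auto
  have "strip y ys u' b (\<lambda>qs p. of_bool (tri a p c) * puz ys qs v' w') \<noteq> 0"
    using Cons.prems by (simp add: u v w)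
  from strip_support[OF u(2) this] obtain qs p where qs: "length qs = length ys"
      and nz: "of_bool (tri a p c) * puz ys qs v' w' \<noteq> 0"
    and t: "tot1 (backQ p # map slashQ qs) = tot1 (map slashQ u' @ [backQ b])"
     "tot2 (backQ p # map slashQ qs) = tot2 (map slashQ u' @ [backQ b])"
    and ar: "area (backQ p # map slashQ qs) \<le> area (map slashQ u' @ [backQ b]) + 2 * int (length ys)"
      "set ys \<subseteq> {y} \<Longrightarrow>
      area (backQ p # map slashQ qs) = area (map slashQ u' @ [backQ b]) + 2 * int (length ys)"
    by blast
  from nz have tri: "tri a p c" and nz: "puz ys qs v' w' \<noteq> 0"
    by (cases "tri a p c"; simp)+
  note IH = Cons.IH[OF qs v(2) w(2) nz]
  have e1: "area (slashQ a # backQ p # map slashQ qs @ map backQ v') = area (map slashQ u @ map backQ v) +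
     (area (backQ p # map slashQ qs) - area (map slashQ u' @ [backQ b]))"
    using area_replace[OF t, of "[slashQ a]" "map backQ v'"] by (simp add: u(1) v(1))
  have e2: "area (horQ c # map slashQ qs @ map backQ v') = area (slashQ a # backQ p # map slashQ qs @ map backQ v') + 1"
    using area_replace[OF tri_support(1,2)[OF tri], of "[]" "map slashQ qs @ map backQ v'"] tri_support(3)[OF tri]
    by simp
  have e3: "area (map horQ w) = area (horQ c # map slashQ qs @ map backQ v') +
      (area (map horQ w') - area (map slashQ qs @ map backQ v'))"
    using area_replace[of "map horQ w'" "map slashQ qs @ map backQ v'" "[horQ c]" "[]"] IH by (simp add: w(1))
  have sq: "int (length (y # ys)) ^ 2 = int (length ys) ^ 2 + 2 * int (length ys) + 1"
    by (simp add: power2_eq_square algebra_simps)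
  show ?case
  proof (intro conjI impI)
    show "area (map horQ w) \<le> area (map slashQ u @ map backQ v) + int (length (y # ys)) ^ 2"
      using e1 e2 e3 ar(1) IH unfolding sq by linarith
  next
    assume s: "set (y # ys) \<subseteq> {y0}"
    then show "area (map horQ w) = area (map slashQ u @ map backQ v) + int (length (y # ys)) ^ 2"
      using e1 e2 e3 ar(2) IH unfolding sq by auto
  qed (use IH t tri_support(1,2)[OF tri] u v w in auto)
qed

fun inversions :: "lab list \<Rightarrow> nat" where
  "inversions [] = 0"
| "inversions (a # u) = (if a = N1 then count_list u N0 else 0) + inversions u"

lemma count_bin: "bin u \<Longrightarrow> count_list u N0 + count_list u N1 = length u"
  by (induction u) auto

lemma tot_bin:
  assumes "bin u"
  shows "tot1 (map f u) = int (count_list u N0) * fst (f N0) + int (count_list u N1) * fst (f N1)"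
    "tot2 (map f u) = int (count_list u N0) * snd (f N0) + int (count_list u N1) * snd (f N1)"
  using assms by (induction u) (auto simp: algebra_simps)

text \<open>By the determinant condition a 1 before a 0 contributes 1, a 0 before a 1 contributes
  -1, and equal letters contribute nothing.\<close>

lemma area_bin:
  assumes "bin u" "fst (f N1) * snd (f N0) - snd (f N1) * fst (f N0) = 1"
  shows "area (map f u) = 2 * int (inversions u) - int (count_list u N0) * int (count_list u N1)"
  using assms(1)
proof (induction u)
  case (Cons a u)
  have e: "fst (f N1) * snd (f N0) = 1 + snd (f N1) * fst (f N0)" using assms(2) by simp
  have "fst (f N1) * tot2 (map f u) - snd (f N1) * tot1 (map f u) =
    int (count_list u N0) * (fst (f N1) * snd (f N0) - snd (f N1) * fst (f N0))"
    using tot_bin[of u f] Cons by (simp add: algebra_simps)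
  moreover have "fst (f N0) * tot2 (map f u) - snd (f N0) * tot1 (map f u) =
    - int (count_list u N1) * (fst (f N1) * snd (f N0) - snd (f N1) * fst (f N0))"
    using tot_bin[of u f] Cons by (simp add: algebra_simps)
  ultimately show ?case using Cons unfolding assms(2)
    by (auto simp: algebra_simps)
qed simp

lemma puz_support:
  assumes len: "length u = length ys" "length v = length ys" "length w = length ys"
    and bin: "bin u" "bin v" and k: "count_list u N0 = count_list v N0" and nz: "puz ys u v w \<noteq> 0"
  shows "bin w" "count_list w N0 = count_list u N0" "inversions w \<le> inversions u + inversions v"
    "set ys \<subseteq> {y0} \<Longrightarrow> inversions w = inversions u + inversions v"
proof -
  note A = puz_area[OF len nz, of y0]
  let ?k = "int (count_list u N0)" and ?m = "int (count_list u N1)"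
  have mu: "?k + ?m = int (length ys)" using count_bin[OF bin(1)] len by simp
  have mv: "int (count_list v N1) = ?m" using count_bin[OF bin(1)] count_bin[OF bin(2)] len k by simp
  have c3: "count_list w N0 + count_list w N1 + count_list w N10 = length w"
  proof (induction w)
    case (Cons a w) then show ?case by (cases a) auto
  qed simp
  have h1: "tot1 (map horQ w) = int (count_list w N1) + int (count_list w N10)"
  proof (induction w)
    case (Cons a w) then show ?case by (cases a) auto
  qed simp
  have h2: "tot2 (map horQ w) = int (count_list w N0) + int (count_list w N10)"
  proof (induction w)
    case (Cons a w) then show ?case by (cases a) auto
  qed simp
  have t1: "tot1 (map slashQ u @ map backQ v) = ?m" using tot_bin[OF bin(1), of slashQ] tot_bin[OF bin(2), of backQ] k mv
    by simp
  have t2: "tot2 (map slashQ u @ map backQ v) = ?k" using tot_bin[OF bin(1), of slashQ] tot_bin[OF bin(2), of backQ] k mv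
    by simp
  \<comment> \<open>A label 10 counts in both totals, while the two totals together leave one unit
    for each bottom edge.\<close>
  have "count_list w N10 = 0" using A c3 h1 h2 t1 t2 mu len by simp
  then have "N10 \<notin> set w" by (simp add: count_list_0_iff)
  then show bw: "bin w" using lab.exhaust by auto
  show kw: "count_list w N0 = count_list u N0" using A h2 t2 \<open>count_list w N10 = 0\<close> by simp
  have mw: "int (count_list w N1) = ?m" using A h1 t1 \<open>count_list w N10 = 0\<close> by simp
  have aw: "area (map horQ w) = 2 * int (inversions w) - ?k * ?m" using area_bin[OF bw, of horQ] kw mw by simp
  \<comment> \<open>The mixed term of the two sides is k m - N^2; its second part cancels the N^2 of
    \<open>puz_area\<close>.\<close>
  have auv: "area (map slashQ u @ map backQ v) = 2 * int (inversions u) + 2 * int (inversions v) - ?k * ?m - int (length ys) ^ 2"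
    unfolding area_append using area_bin[OF bin(1), of slashQ] area_bin[OF bin(2), of backQ]
      tot_bin[OF bin(1), of slashQ] tot_bin[OF bin(2), of backQ] k mv
    by (simp add: mu[symmetric] power2_eq_square algebra_simps)
  show "inversions w \<le> inversions u + inversions v" using A aw auv by simp
  show "inversions w = inversions u + inversions v" if "set ys \<subseteq> {y0}" using A aw auv that by simp
qed

section \<open>Puzzles and branching polynomials\<close>

text \<open>One step of dragging a line: it turns the appended 1 into a leading 0.\<close>

primrec branch :: "(nat \<Rightarrow> 'a::comm_ring_1) \<Rightarrow> nat \<Rightarrow> lab list \<Rightarrow> 'a" where
  "branch X 0 = (\<lambda>w. 1)"
| "branch X (Suc k) = (\<lambda>w. chain_des (length w) (X k)
     (\<lambda>u. case u of [] \<Rightarrow> 0 | a # u' \<Rightarrow> if a = N0 then branch X k u' else 0) (w @ [N1]))"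

lemma inv_append: "inversions (xs @ ys) = inversions xs + inversions ys + count_list xs N1 * count_list ys N0"
  by (induction xs) auto

text \<open>Closed under sorting a descent, which lowers the number of inversions. So the value of a
  chain of sorting operators at such a word depends only on the values of the function on this
  class.\<close>

definition wclass :: "nat \<Rightarrow> nat \<Rightarrow> nat \<Rightarrow> lab list set" where
  "wclass n k d = {u. length u = n \<and> bin u \<and> count_list u N0 = k \<and> inversions u \<le> d}"

lemma des_at: "des (length p) z F (p @ a # b # s) = swap2 z a b (\<lambda>a b. F (p @ a # b # s))"
  by (induction p arbitrary: F) simp_all

lemma des_beyond: "length u < i + 2 \<Longrightarrow> des i z F u = F u"
proof (induction i z F u rule: des.induct)
  case (2 i z F a u)
  then show ?case by simp
qed simp_all

lemma des_wclass:
  assumes eq: "\<And>u. u \<in> wclass n k d \<Longrightarrow> F u = G u" and u: "u \<in> wclass n k d"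
  shows "des i z F u = des i z G u"
proof (cases "length u < i + 2")
  case True
  then show ?thesis by (simp add: des_beyond eq[OF u])
next
  case False
  define p where "p = take i u"
  obtain a b s where d: "drop i u = a # b # s"
  proof -
    have "length (drop i u) \<ge> 2" using False by simp
    then show ?thesis using that by (cases "drop i u"; cases "tl (drop i u)") auto
  qed
  have u': "u = p @ a # b # s" "i = length p"
    using False d by (simp_all add: p_def flip: d)
  show ?thesis
  proof (cases "lab_gt a b")
    case True
    have ab: "a = N1" "b = N0" using u True unfolding u' wclass_def
      by (cases a; cases b; auto)+
    have "p @ b # a # s \<in> wclass n k d"
      using u unfolding u' ab wclass_def by (auto simp: inv_append algebra_simps)
    from eq[OF this] eq[OF u] show ?thesis
      unfolding u' des_at swap2_def by simp
  next
    case False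
    then show ?thesis using eq[OF u] unfolding u' des_at swap2_def by simp
  qed
qed

lemma chain_des_wclass:
  assumes eq: "\<And>u. u \<in> wclass n k d \<Longrightarrow> F u = G u" and u: "u \<in> wclass n k d"
  shows "chain_des i z F u = chain_des i z G u"
  using u
proof (induction i arbitrary: u)
  case 0
  then show ?case by (simp only: chain_des.simps eq)
next
  case (Suc i)
  show ?case unfolding chain_des.simps by (rule des_wclass[OF Suc.IH Suc.prems])
qed

lemma chain_des_mult: "chain_des i z (\<lambda>u. c * F u) u = c * chain_des i z F u"
proof (induction i arbitrary: u)
  case (Suc i)
  have "chain_des i z (\<lambda>u. c * F u) = (\<lambda>u. c * chain_des i z F u)" by (rule ext) (rule Suc.IH)
  then show ?case by (simp add: des_mult)
qed simp

lemma chain_des_add: "chain_des i z (\<lambda>u. F u + G u) u = chain_des i z F u + chain_des i z G u"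
proof (induction i arbitrary: u)
  case (Suc i)
  have "chain_des i z (\<lambda>u. F u + G u) = (\<lambda>u. chain_des i z F u + chain_des i z G u)" by (rule ext) (rule Suc.IH)
  then show ?case by (simp add: des_add)
qed simp

lemma chain_des_sum:
  assumes "finite A"
  shows "(\<Sum>w\<in>A. chain_des i z (\<lambda>u. F u w) u * c w) = chain_des i z (\<lambda>u. \<Sum>w\<in>A. F u w * c w) u"
  using assms
proof (induction A rule: finite_induct)
  case empty
  then show ?case using chain_des_mult[of i z 0 "\<lambda>_. 0" u] by simp
next
  case (insert w A)
  have "chain_des i z (\<lambda>u. F u w) u * c w = chain_des i z (\<lambda>u. F u w * c w) u"
    using chain_des_mult[of i z "c w" "\<lambda>u. F u w" u] by (simp add: mult.commute)
  then show ?case using insert by (simp add: chain_des_add)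
qed

lemma bin_no_N0: "bin u \<Longrightarrow> count_list u N0 = 0 \<Longrightarrow> u = replicate (length u) N1"
  by (induction u) (auto split: if_splits)

lemma puz_all_N1: "puz (replicate n 0) (replicate n N1) (replicate n N1) (replicate n N1) = (1 :: 'a::comm_ring_1)"
proof (induction n)
  case (Suc n)
  have snoc: "replicate (Suc n) a = replicate n a @ [a]" for a :: 'b
    by (simp add: replicate_append_same)
  have "bin (replicate n N1)" by auto
  then show ?case
    unfolding snoc
    using Suc puz_snoc_N1[of "replicate n N1" "replicate n (0::'a)" "replicate n N1" "replicate n N1" 0 N1] by simp
qed simp

text \<open>\<open>X k\<close> is the parameter of the extra line. After the drag, \<open>g\<close>
  keeps the bottom words starting with 0, and what splits off is a puzzle with \<open>k\<close>
  zeros, to which the induction applies. The bound on inversions is what turns a sum over words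
  ending in 1 into a sum over all words.\<close>

theorem puz_product:
  fixes X :: "nat \<Rightarrow> 'a::comm_ring_1"
  assumes "length u = N" "length v = N" "bin u" "bin v" "count_list u N0 = k" "count_list v N0 = k"
    and "inversions u + inversions v \<le> count_list u N1"
  shows "(\<Sum>w\<in>words N. puz (replicate N 0) u v w * branch X k w) = branch X k u * branch X k v"
  using assms
proof (induction k arbitrary: u v)
  case 0
  have uv: "u = replicate N N1" "v = replicate N N1" using 0 bin_no_N0 by metis+
  have "puz (replicate N 0) u v w = (if w = replicate N N1 then 1 else (0::'a))" if "w \<in> words N" for w
  proof (cases "puz (replicate N 0) u v w = (0::'a)")
    case True
    then show ?thesis using uv puz_all_N1[of N, where ?'a = 'a] by auto
  next
    case False
    have len: "length w = N" using that by (simp add: words_def)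
    have "bin w" "count_list w N0 = count_list u N0"
      using puz_support(1,2)[of u "replicate N 0" v w] 0 False len by auto
    then have "w = replicate N N1" using bin_no_N0 0 len by metis
    then show ?thesis using uv puz_all_N1[of N, where ?'a = 'a] by auto
  qed
  then have "(\<Sum>w\<in>words N. puz (replicate N 0) u v w * branch X 0 w) =
     (\<Sum>w\<in>words N. if w = replicate N N1 then 1 else (0::'a))"
    by (intro sum.cong) simp_all
  then show ?case by (simp add: finite_words) (simp add: words_def)
next
  case (Suc k)
  note prems = Suc.prems
  let ?x = "X k"
  define g where "g = (\<lambda>u. case u of [] \<Rightarrow> 0 | a # u' \<Rightarrow> if a = N0 then branch X k u' else (0::'a))"
  define U where "U = u @ [N1]" define V where "V = v @ [N1]"
  have br: "branch X (Suc k) w = chain_des N ?x g (w @ [N1])" if "length w = N" for w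
    using that unfolding g_def by (simp only: branch.simps)
  let ?P = "puz (replicate N 0 @ [?x]) U V :: lab list \<Rightarrow> 'a"
  let ?Q = "puz (?x # replicate N 0) :: lab list \<Rightarrow> lab list \<Rightarrow> lab list \<Rightarrow> 'a"
  \<comment> \<open>A final 0 of \<open>w\<close> would form an inversion with each of its 1s, and
    there are more of these than \<open>u\<close> and \<open>v\<close> have inversions together. As
    \<open>?x\<close> is arbitrary, only the inequality of \<open>puz_support\<close> is
    available.\<close>
  have last: "?P w = 0" if w: "w \<in> words (Suc N)" "w \<notin> (\<lambda>w. w @ [N1]) ` words N" for w
  proof (rule ccontr)
    assume nz: "?P w \<noteq> 0"
    have lw: "length w = Suc N" using w by (simp add: words_def)
    then obtain w' a where wa: "w = w' @ [a]" by (cases w rule: rev_cases) auto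
    have a: "a \<noteq> N1" using w lw by (auto simp: wa words_def)
    have s: "bin w" "count_list w N0 = count_list U N0" "inversions w \<le> inversions U + inversions V"
      using puz_support(1-3)[of U "replicate N 0 @ [?x]" V w] prems nz lw by (auto simp: U_def V_def)
    have "a = N0" using s(1) a by (auto simp: wa)
    then have "inversions w \<ge> count_list w N1" by (simp add: wa inv_append)
    moreover have "count_list w N1 = count_list U N1"
      using count_bin[of w] count_bin[of U] s lw prems by (simp add: U_def)
    ultimately show False using s(3) prems by (simp add: U_def V_def inv_append)
  qed
  have "(\<Sum>w\<in>words N. puz (replicate N 0) u v w * branch X (Suc k) w) =
     (\<Sum>w\<in>words N. ?P (w @ [N1]) * chain_des N ?x g (w @ [N1]))"
  proof (rule sum.cong[OF refl])
    fix w assume "w \<in> words N"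
    then have lw: "length w = N" by (simp add: words_def)
    show "puz (replicate N 0) u v w * branch X (Suc k) w = ?P (w @ [N1]) * chain_des N ?x g (w @ [N1])"
      unfolding br[OF lw] U_def V_def using puz_snoc_N1[of u "replicate N 0" v w ?x N1] prems lw by simp
  qed
  also have "\<dots> = (\<Sum>w\<in>(\<lambda>w. w @ [N1]) ` words N. ?P w * chain_des N ?x g w)"
    by (simp add: sum.reindex inj_on_def)
  also have "\<dots> = (\<Sum>w\<in>words (Suc N). ?P w * chain_des N ?x g w)"
  proof (rule sum.mono_neutral_left)
    show "finite (words (Suc N))" by (rule finite_words)
    show "(\<lambda>w. w @ [N1]) ` words N \<subseteq> words (Suc N)" by (auto simp: words_def)
  qed (use last in auto)
  also have "\<dots> = (\<Sum>w\<in>words (Suc N). chain_asc N ?x ?P w * g w)"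
    by (rule chain_adjoint[symmetric])
  also have "\<dots> = (\<Sum>w\<in>words (Suc N). chain_des N ?x (\<lambda>u. chain_des N ?x (\<lambda>v. ?Q u v w) V) U * g w)"
  proof (rule sum.cong[OF refl])
    fix w assume "w \<in> words (Suc N)"
    then show "chain_asc N ?x ?P w * g w = chain_des N ?x (\<lambda>u. chain_des N ?x (\<lambda>v. ?Q u v w) V) U * g w"
      using puz_chain[of N N U V w ?x] prems by (simp add: U_def V_def words_def del: puz.simps)
  qed
  also have "\<dots> = chain_des N ?x (\<lambda>u. chain_des N ?x (\<lambda>v. \<Sum>w\<in>words (Suc N). ?Q u v w * g w) V) U"
    by (simp only: chain_des_sum[OF finite_words])
  also have "\<dots> = chain_des N ?x (\<lambda>u. chain_des N ?x (\<lambda>v. g u * g v) V) U"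
  \<comment> \<open>The identity under the operators is known only for binary words with few
    inversions, so it has to be carried through both chains on the classes of \<open>U\<close> and
    \<open>V\<close>.\<close>
  proof (rule chain_des_wclass, rule chain_des_wclass)
    show "U \<in> wclass (Suc N) (Suc k) (inversions u)" "V \<in> wclass (Suc N) (Suc k) (inversions v)"
      using prems by (auto simp: U_def V_def wclass_def inv_append)
    fix u' v' assume u': "u' \<in> wclass (Suc N) (Suc k) (inversions u)" and v': "v' \<in> wclass (Suc N) (Suc k) (inversions v)"
    obtain a u'' where ua: "u' = a # u''" "length u'' = N" using u' by (cases u') (auto simp: wclass_def)
    obtain b v'' where vb: "v' = b # v''" "length v'' = N" using v' by (cases v') (auto simp: wclass_def)
    have bin: "bin u''" "bin v''" "a = N0 \<or> a = N1" "b = N0 \<or> b = N1"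
      using u' v' by (auto simp: wclass_def ua vb)
    have "(\<Sum>w\<in>words (Suc N). ?Q u' v' w * g w) = (\<Sum>w\<in>words N. ?Q u' v' (N0 # w) * branch X k w)"
      unfolding sum_words_Suc by (simp add: sum_lab_def g_def del: puz.simps)
    also have "\<dots> = (\<Sum>w\<in>words N. of_bool (a = N0 \<and> b = N0) * (puz (replicate N 0) u'' v'' w * branch X k w))"
      using puz_Cons_N0[of u'' "replicate N 0" a ?x b v''] ua vb bin
      by (intro sum.cong) (auto simp: words_def simp del: puz.simps)
    also have "\<dots> = of_bool (a = N0 \<and> b = N0) * (\<Sum>w\<in>words N. puz (replicate N 0) u'' v'' w * branch X k w)"
      by (rule sum_distrib_left[symmetric])
    also have "\<dots> = g u' * g v'"
    proof (cases "a = N0 \<and> b = N0")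
      case True
      then have c: "count_list u'' N0 = k" "count_list v'' N0 = k" "inversions u'' \<le> inversions u" "inversions v'' \<le> inversions v"
        using u' v' by (auto simp: wclass_def ua vb)
      \<comment> \<open>Compared with \<open>u\<close>, the word \<open>u''\<close> has lost a 0 and
        gained the appended 1, and sorting has created no inversions.\<close>
      have "inversions u'' + inversions v'' \<le> count_list u'' N1"
        using c prems count_bin[OF bin(1)] count_bin[OF prems(3)] ua by linarith
      then show ?thesis using Suc.IH[OF ua(2) vb(2) bin(1,2) c(1,2)] True by (simp add: g_def ua vb)
    qed (auto simp: g_def ua vb)
    finally show "(\<Sum>w\<in>words (Suc N). ?Q u' v' w * g w) = g u' * g v'" .
  qed
  also have "\<dots> = chain_des N ?x g U * chain_des N ?x g V"
    using chain_des_mult[of N ?x "chain_des N ?x g V" g U] by (simp add: chain_des_mult mult.commute)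
  finally show ?case unfolding br[OF prems(1)] br[OF prems(2)] U_def V_def .
qed

section \<open>Branching polynomials and Schur polynomials\<close>

text \<open>For a binary word and \<open>c = 0\<close> these are the parts of its partition in
  increasing order, zero parts included, so that their number is the number of 0s.\<close>

fun zero_parts :: "nat \<Rightarrow> lab list \<Rightarrow> nat list" where
  "zero_parts c [] = []"
| "zero_parts c (a # w) = (if a = N0 then c # zero_parts c w else zero_parts (Suc c) w)"

text \<open>\<open>F\<close> is summed over the rows of a Gelfand-Tsetlin pattern that interlace
  with \<open>a # bs\<close>; the exponents of \<open>x\<close> add up to the difference of the sums
  of \<open>bs\<close> and the row.\<close>

fun interlace :: "'a::comm_ring_1 \<Rightarrow> (nat list \<Rightarrow> 'a) \<Rightarrow> nat \<Rightarrow> nat list \<Rightarrow> 'a" where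
  "interlace x F a [] = F []"
| "interlace x F a (b # bs) = (\<Sum>c\<in>{a..b}. x ^ (b - c) * interlace x (\<lambda>l. F (c # l)) b bs)"

text \<open>The recursion over Gelfand-Tsetlin patterns, rows written in increasing order. Each new
  row is shorter by one part; with its parts matched to those of \<open>bs\<close>, the smallest
  part \<open>b\<close> is left over and yields the factor \<open>X k ^ b\<close>.\<close>

primrec gt_poly :: "(nat \<Rightarrow> 'a::comm_ring_1) \<Rightarrow> nat \<Rightarrow> nat list \<Rightarrow> 'a" where
  "gt_poly X 0 = (\<lambda>l. 1)"
| "gt_poly X (Suc k) = (\<lambda>l. case l of [] \<Rightarrow> 0 | b # bs \<Rightarrow> X k ^ b * interlace (X k) (gt_poly X k) b bs)"

lemma interlace_mult: "interlace x (\<lambda>l. k * F l) a bs = k * interlace x F a bs"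
  by (induction x F a bs arbitrary: rule: interlace.induct) (simp_all add: sum_distrib_left mult.left_commute)

lemma interlace_sum: "finite A \<Longrightarrow> interlace x (\<lambda>l. \<Sum>i\<in>A. F i l) a bs = (\<Sum>i\<in>A. interlace x (F i) a bs)"
proof (induction bs arbitrary: F a)
  case (Cons b bs)
  have "interlace x (\<lambda>l. \<Sum>i\<in>A. F i l) a (b # bs) = (\<Sum>c\<in>{a..b}. \<Sum>i\<in>A. x ^ (b - c) * interlace x (\<lambda>l. F i (c # l)) b bs)"
    using Cons by (simp add: sum_distrib_left)
  also have "\<dots> = (\<Sum>i\<in>A. \<Sum>c\<in>{a..b}. x ^ (b - c) * interlace x (\<lambda>l. F i (c # l)) b bs)"
    by (rule sum.swap)
  finally show ?case by simp
qed simp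

text \<open>The front pair is treated last, so the first letter is touched only by
  \<open>des 0\<close>, as the innermost operator.\<close>

lemma chain_des_Cons:
  "chain_des (Suc n) x G (a # u) = chain_des n x (\<lambda>s. des 0 x G (a # s)) u"
proof (induction n arbitrary: u)
  case (Suc n)
  have "(\<lambda>u. chain_des (Suc n) x G (a # u)) = chain_des n x (\<lambda>s. des 0 x G (a # s))"
    by (rule ext) (rule Suc.IH)
  moreover have "chain_des (Suc (Suc n)) x G (a # u) = des n x (\<lambda>u. chain_des (Suc n) x G (a # u)) u"
    by simp
  ultimately show ?case by (simp only: chain_des.simps)
qed simp

lemma chain_des_bin:
  assumes "\<And>u. bin u \<Longrightarrow> u \<noteq> [] \<Longrightarrow> F u = G u" "bin u" "u \<noteq> []"
  shows "chain_des i z F u = chain_des i z G u"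
proof (rule chain_des_wclass)
  show "u \<in> wclass (length u) (count_list u N0) (inversions u)" using assms by (simp add: wclass_def)
  fix s assume s: "s \<in> wclass (length u) (count_list u N0) (inversions u)"
  with assms(3) have "s \<noteq> []" by (auto simp: wclass_def)
  with s assms(1) show "F s = G s" by (simp add: wclass_def)
qed

text \<open>The state of the chain after a prefix: \<open>c\<close> is the lower bound for the next
  part and \<open>m\<close> the number of 1s read since it was set. A following 0 may travel left
  past any number of these 1s, with a factor \<open>x\<close> for each, hence the sum over the
  resulting part \<open>b\<close>. Earlier choices are stored in \<open>F\<close>.\<close>

definition stage :: "'a::comm_ring_1 \<Rightarrow> (nat list \<Rightarrow> 'a) \<Rightarrow> nat \<Rightarrow> nat \<Rightarrow> lab list \<Rightarrow> 'a" where
  "stage x F c m s = (case s of [] \<Rightarrow> F [] | a # t \<Rightarrow>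
     if a = N0 then \<Sum>b\<in>{c..c + m}. x ^ (c + m - b) * F (b # zero_parts (c + m) t) else F (zero_parts (c + m) s))"

text \<open>With one more 1 in front, the next 0 either stays, giving the new term
  \<open>b = c + m + 1\<close>, or moves past it, giving \<open>x\<close> times the old sum.\<close>

lemma stage_N1:
  assumes "bin s" "s \<noteq> []"
  shows "des 0 x (stage x F c m) (N1 # s) = stage x F c (Suc m) s"
proof -
  obtain a t where s: "s = a # t" "a = N0 \<or> a = N1" using assms by (cases s) auto
  have "(\<Sum>b\<in>{c..Suc (c + m)}. x ^ (Suc (c + m) - b) * F (b # l)) =
     F (Suc (c + m) # l) + x * (\<Sum>b\<in>{c..c + m}. x ^ (c + m - b) * F (b # l))" for l
    by (simp add: sum_distrib_left Suc_diff_le mult.assoc add.commute)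
  then show ?thesis using s by (auto simp: stage_def swap2_def)
qed

lemma chain_des_stage:
  assumes "bin w"
  shows "chain_des (length w) x (stage x F c m) (w @ [N1]) = interlace x F c (zero_parts (c + m) w)"
  using assms
proof (induction w arbitrary: F c m)
  case Nil
  then show ?case by (simp add: stage_def)
next
  case (Cons a w)
  consider "a = N0" | "a = N1" using Cons.prems by auto
  then show ?case
  proof cases
    case 1
    \<comment> \<open>The sum over the part of this 0 is absorbed into the function, and the next
      part starts from the bound \<open>c + m\<close>.\<close>
    let ?F = "\<lambda>l. \<Sum>b\<in>{c..c + m}. x ^ (c + m - b) * F (b # l)"
    have "chain_des (length w) x (\<lambda>s. des 0 x (stage x F c m) (N0 # s)) (w @ [N1]) =
      chain_des (length w) x (stage x ?F (c + m) 0) (w @ [N1])"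
    proof (rule chain_des_bin)
      fix s assume "bin s" "s \<noteq> []"
      then show "des 0 x (stage x F c m) (N0 # s) = stage x ?F (c + m) 0 s"
        by (cases s) (auto simp: stage_def swap2_def)
    qed (use Cons.prems in auto)
    also have "\<dots> = interlace x ?F (c + m) (zero_parts (c + m) w)"
      using Cons.IH[of ?F "c + m" 0] Cons.prems by simp
    also have "\<dots> = interlace x F c (zero_parts (c + m) (a # w))"
      using 1 by (simp add: interlace_sum interlace_mult)
    finally show ?thesis using 1 by (simp only: append_Cons list.size chain_des_Cons add_0_right add_Suc_right)
  next
    case 2
    have "chain_des (length w) x (\<lambda>s. des 0 x (stage x F c m) (N1 # s)) (w @ [N1]) =
      chain_des (length w) x (stage x F c (Suc m)) (w @ [N1])"
      by (rule chain_des_bin[OF stage_N1]) (use Cons.prems in auto)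
    then show ?thesis using 2 Cons.IH[of F c "Suc m"] Cons.prems
      by (simp add: chain_des_Cons del: chain_des.simps)
  qed
qed

text \<open>The first 0 has to travel to the very front, as only words starting with 0 survive; this
  produces the unmatched factor \<open>x ^ b\<close> of \<open>gt_poly\<close>. Here
  \<open>c\<close> counts the 1s in front of it read so far.\<close>

lemma chain_des_start:
  assumes "bin w"
  shows "chain_des (length w) x (\<lambda>s. case s of [] \<Rightarrow> 0 | a # t \<Rightarrow> if a = N0 then x ^ c * F (zero_parts c t) else 0) (w @ [N1]) =
    (case zero_parts c w of [] \<Rightarrow> 0 | b # bs \<Rightarrow> x ^ b * interlace x F b bs)"
  using assms
proof (induction w arbitrary: c)
  case Nil
  then show ?case by simp
next
  case (Cons a w)
  let ?G = "\<lambda>c s. case s of [] \<Rightarrow> 0 | a # t \<Rightarrow> if a = N0 then x ^ c * F (zero_parts c t) else 0"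
  consider "a = N0" | "a = N1" using Cons.prems by auto
  then show ?case
  proof cases
    case 1
    have "chain_des (length w) x (\<lambda>s. des 0 x (?G c) (N0 # s)) (w @ [N1]) =
      chain_des (length w) x (stage x (\<lambda>l. x ^ c * F l) c 0) (w @ [N1])"
    proof (rule chain_des_bin)
      fix s assume "bin s" "s \<noteq> []"
      then show "des 0 x (?G c) (N0 # s) = stage x (\<lambda>l. x ^ c * F l) c 0 s"
        by (cases s) (auto simp: stage_def swap2_def)
    qed (use Cons.prems in auto)
    then show ?thesis using 1 chain_des_stage[of w x "\<lambda>l. x ^ c * F l" c 0] Cons.prems
      by (simp add: chain_des_Cons interlace_mult del: chain_des.simps)
  next
    case 2
    have "chain_des (length w) x (\<lambda>s. des 0 x (?G c) (N1 # s)) (w @ [N1]) =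
      chain_des (length w) x (?G (Suc c)) (w @ [N1])"
    proof (rule chain_des_bin)
      fix s assume "bin s" "s \<noteq> []"
      then show "des 0 x (?G c) (N1 # s) = ?G (Suc c) s"
        by (cases s) (auto simp: swap2_def mult.assoc)
    qed (use Cons.prems in auto)
    then show ?thesis using 2 Cons.IH[of "Suc c"] Cons.prems
      by (simp add: chain_des_Cons del: chain_des.simps)
  qed
qed

theorem branch_gt_poly:
  assumes "bin w"
  shows "branch X k w = gt_poly X k (zero_parts 0 w)"
  using assms
proof (induction k arbitrary: w)
  case 0
  show ?case by simp
next
  case (Suc k)
  have "branch X (Suc k) w = chain_des (length w) (X k)
      (\<lambda>s. case s of [] \<Rightarrow> 0 | a # t \<Rightarrow> if a = N0 then X k ^ 0 * gt_poly X k (zero_parts 0 t) else 0) (w @ [N1])"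
    unfolding branch.simps
  proof (rule chain_des_bin)
    fix s assume "bin s" "s \<noteq> []"
    then show "(case s of [] \<Rightarrow> 0 | a # u' \<Rightarrow> if a = N0 then branch X k u' else 0) =
       (case s of [] \<Rightarrow> 0 | a # t \<Rightarrow> if a = N0 then X k ^ 0 * gt_poly X k (zero_parts 0 t) else 0)"
      using Suc.IH by (cases s) auto
  qed (use Suc.prems in auto)
  then show ?case unfolding chain_des_start[OF Suc.prems] by simp
qed

section \<open>Interlacing lists and the branching rule for semistandard tableaux\<close>

fun interlaced :: "nat \<Rightarrow> nat list \<Rightarrow> nat list set" where
  "interlaced a [] = {[]}"
| "interlaced a (b # bs) = (\<lambda>(c, cs). c # cs) ` ({a..b} \<times> interlaced b bs)"

lemma interlaced_le: "cs \<in> interlaced a bs \<Longrightarrow> sum_list cs \<le> sum_list bs"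
proof (induction bs arbitrary: a cs)
  case (Cons b bs)
  then obtain c cs' where "cs = c # cs'" "c \<le> b" "cs' \<in> interlaced b bs" by auto
  with Cons.IH[of cs' b] show ?case by simp
qed simp

lemma interlace_eq_sum:
  "interlace x F a bs = (\<Sum>cs\<in>interlaced a bs. x ^ (sum_list bs - sum_list cs) * F cs)"
proof (induction bs arbitrary: a F)
  case (Cons b bs)
  have "(\<Sum>cs\<in>interlaced a (b # bs). x ^ (sum_list (b # bs) - sum_list cs) * F cs) =
    (\<Sum>(c, cs)\<in>{a..b} \<times> interlaced b bs. x ^ (b + sum_list bs - (c + sum_list cs)) * F (c # cs))"
    by (simp add: sum.reindex inj_on_def case_prod_unfold)
  also have "\<dots> = (\<Sum>c\<in>{a..b}. \<Sum>cs\<in>interlaced b bs. x ^ (b + sum_list bs - (c + sum_list cs)) * F (c # cs))"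
    by (rule sum.cartesian_product[symmetric])
  also have "\<dots> = (\<Sum>c\<in>{a..b}. \<Sum>cs\<in>interlaced b bs. x ^ (b - c) * (x ^ (sum_list bs - sum_list cs) * F (c # cs)))"
  proof (intro sum.cong refl)
    fix c cs assume c: "c \<in> {a..b}" and cs: "cs \<in> interlaced b bs"
    have "b + sum_list bs - (c + sum_list cs) = (b - c) + (sum_list bs - sum_list cs)"
      using c interlaced_le[OF cs] by simp
    then show "x ^ (b + sum_list bs - (c + sum_list cs)) * F (c # cs) =
      x ^ (b - c) * (x ^ (sum_list bs - sum_list cs) * F (c # cs))"
      by (simp add: power_add mult.assoc)
  qed
  finally show ?case by (simp add: Cons sum_distrib_left)
qed simp

lemma interlaced_iff:
  "cs \<in> interlaced a bs \<longleftrightarrow> length cs = length bs \<and> (\<forall>i<length bs. (a # bs) ! i \<le> cs ! i \<and> cs ! i \<le> bs ! i)"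
proof (induction bs arbitrary: a cs)
  case (Cons b bs)
  show ?case
  proof (cases cs)
    case (Cons c cs')
    then show ?thesis using Cons.IH[of cs' b] by (auto simp: All_less_Suc2 image_iff)
  qed auto
qed auto

lemma finite_cells: "finite (cells la)"
proof -
  have "cells la \<subseteq> (\<Union>i<length la. {i} \<times> {..<la ! i})" by (auto simp: cells_def)
  then show ?thesis by (rule finite_subset) auto
qed

lemma card_cells: "card (cells la) = sum_list la"
proof -
  have "cells la = (SIGMA i:{..<length la}. {..<la ! i})" by (auto simp: cells_def)
  then have "card (cells la) = (\<Sum>i<length la. la ! i)" by simp
  then show ?thesis by (simp add: sum_list_sum_nth atLeast0LessThan)
qed

lemma finite_ssyt: "finite (ssyt n la)"
proof (rule finite_subset)
  show "ssyt n la \<subseteq> {T. \<forall>c. (c \<in> cells la \<longrightarrow> T c \<in> {..<n}) \<and> (c \<notin> cells la \<longrightarrow> T c = 0)}"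
    by (auto simp: ssyt_def)
qed (rule finite_set_of_finite_funs[OF finite_cells], simp)

lemma schur_cells_cong: "cells la = cells lb \<Longrightarrow> schur n la = schur n lb"
  by (simp add: schur_def ssyt_def tab_monomial_def)

lemma ssyt_row_mono:
  assumes "T \<in> ssyt n la" "(i, j') \<in> cells la" "j \<le> j'"
  shows "T (i, j) \<le> T (i, j')"
  using assms(3,2)
proof (induction j' rule: dec_induct)
  case (step j')
  have "(i, j') \<in> cells la" using step.prems by (auto simp: cells_def)
  moreover have "T (i, j') \<le> T (i, Suc j')" using assms(1) step.prems by (simp add: ssyt_def)
  ultimately show ?case using step.IH by linarith
qed simp

definition decreasing :: "nat list \<Rightarrow> bool" where
  "decreasing l \<longleftrightarrow> (\<forall>i. Suc i < length l \<longrightarrow> l ! Suc i \<le> l ! i)"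

text \<open>For decreasing \<open>l\<close> these are the shapes that leave a horizontal strip, with
  exactly one row fewer; zero rows are kept so that lengths match the number of variables.\<close>

definition between :: "nat list \<Rightarrow> nat list set" where
  "between l = {m. Suc (length m) = length l \<and> (\<forall>i<length m. l ! Suc i \<le> m ! i \<and> m ! i \<le> l ! i)}"

lemma ssyt_entry_ge_row:
  assumes "T \<in> ssyt n l" "decreasing l" "(i, j) \<in> cells l"
  shows "i \<le> T (i, j)"
  using assms(3)
proof (induction i)
  case (Suc i)
  have "(i, j) \<in> cells l" using Suc.prems assms(2) by (auto simp: cells_def decreasing_def intro: less_le_trans)
  moreover have "T (i, j) < T (Suc i, j)" using assms(1) Suc.prems by (simp add: ssyt_def)
  ultimately show ?case using Suc.IH by simp
qed simp

text \<open>\<open>k\<close> rows suffice: entries start at 0 and increase strictly down columns, so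
  row \<open>k\<close> has no entry below \<open>k\<close>
  (\<open>ssyt_entry_ge_row\<close>).\<close>

definition small_shape :: "nat \<Rightarrow> nat list \<Rightarrow> (nat \<times> nat \<Rightarrow> nat) \<Rightarrow> nat list" where
  "small_shape k l T = map (\<lambda>i. card {j. j < l ! i \<and> T (i, j) < k}) [0..<k]"

definition fill :: "nat \<Rightarrow> nat list \<Rightarrow> nat list \<Rightarrow> (nat \<times> nat \<Rightarrow> nat) \<Rightarrow> (nat \<times> nat \<Rightarrow> nat)" where
  "fill k l m T c = (if c \<in> cells m then T c else if c \<in> cells l then k else 0)"

definition restr :: "nat list \<Rightarrow> (nat \<times> nat \<Rightarrow> nat) \<Rightarrow> (nat \<times> nat \<Rightarrow> nat)" where
  "restr m T c = (if c \<in> cells m then T c else 0)"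

lemma between_cells: "m \<in> between l \<Longrightarrow> cells m \<subseteq> cells l"
  by (auto simp: between_def cells_def intro: less_le_trans)

lemma fill_ssyt:
  assumes m: "m \<in> between l" "length l = Suc k" and T: "T \<in> ssyt k m"
  shows "fill k l m T \<in> ssyt (Suc k) l"
proof -
  note sub = between_cells[OF m(1)]
  have lt: "T c < k" if "c \<in> cells m" for c using T that by (simp add: ssyt_def)
  have row: "fill k l m T (i, j) \<le> fill k l m T (i, Suc j)" if "(i, Suc j) \<in> cells l" for i j
  proof (cases "(i, Suc j) \<in> cells m")
    case True
    then have "(i, j) \<in> cells m" by (auto simp: cells_def)
    then show ?thesis using True T by (auto simp: fill_def ssyt_def)
  next
    case False
    then show ?thesis using that lt[of "(i, j)"] by (auto simp: fill_def)
  qed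
  have col: "fill k l m T (i, j) < fill k l m T (Suc i, j)" if c: "(Suc i, j) \<in> cells l" for i j
  proof -
    have i: "i < k" "j < l ! Suc i" using c m(2) by (auto simp: cells_def)
    \<comment> \<open>Interlacing puts the upper cell into \<open>m\<close>, so no column contains
      \<open>k\<close> twice.\<close>
    then have ij: "(i, j) \<in> cells m" using m by (auto simp: between_def cells_def intro: less_le_trans)
    show ?thesis
    proof (cases "(Suc i, j) \<in> cells m")
      case True
      then show ?thesis using ij T by (auto simp: fill_def ssyt_def)
    next
      case False
      then show ?thesis using ij c lt[OF ij] by (auto simp: fill_def)
    qed
  qed
  show ?thesis
    unfolding ssyt_def using row col sub lt by (auto simp: fill_def less_Suc_eq)
qed

lemma small_cells:
  assumes T: "T \<in> ssyt (Suc k) l" and l: "decreasing l" "length l = Suc k"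
  shows "cells (small_shape k l T) = {c \<in> cells l. T c < k}"
proof -
  \<comment> \<open>Rows increase weakly, so the entries below \<open>k\<close> fill an initial
    segment and are described by their number.\<close>
  have pre: "{j. j < l ! i \<and> T (i, j) < k} = {..<card {j. j < l ! i \<and> T (i, j) < k}}" if "i < k" for i
  proof -
    let ?S = "{j. j < l ! i \<and> T (i, j) < k}"
    have fin: "finite ?S" by simp
    have down: "j' \<in> ?S" if "j \<in> ?S" "j' \<le> j" for j j'
      using that ssyt_row_mono[OF T, of i j j'] \<open>i < k\<close> l(2) by (auto simp: cells_def)
    show ?thesis
    proof (cases "?S = {}")
      case False
      define M where "M = Max ?S"
      have "?S = {..M}"
      proof
        show "?S \<subseteq> {..M}" using fin Max_ge by (auto simp: M_def)
        have "M \<in> ?S" unfolding M_def using fin False by (rule Max_in)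
        then show "{..M} \<subseteq> ?S" using down by blast
      qed
      then show ?thesis by (simp add: lessThan_Suc_atMost)
    next
      case True
      show ?thesis unfolding True by simp
    qed
  qed
  have last: "\<not> T (k, j) < k" if "(k, j) \<in> cells l" for j
    using ssyt_entry_ge_row[OF T l(1) that] by simp
  show ?thesis
  proof (rule set_eqI)
    fix c :: "nat \<times> nat"
    obtain i j where c: "c = (i, j)" by (cases c)
    consider "i < k" | "i = k" | "i > k" by linarith
    then show "c \<in> cells (small_shape k l T) \<longleftrightarrow> c \<in> {c \<in> cells l. T c < k}"
    proof cases
      case 1
      have "c \<in> cells (small_shape k l T) \<longleftrightarrow> j \<in> {..<card {j. j < l ! i \<and> T (i, j) < k}}"
        using 1 by (simp add: cells_def small_shape_def c)
      also have "\<dots> \<longleftrightarrow> j \<in> {j. j < l ! i \<and> T (i, j) < k}" using pre[OF 1] by simp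
      finally show ?thesis using 1 l(2) by (simp add: c cells_def)
    next
      case 2
      then show ?thesis using last by (auto simp: c cells_def small_shape_def)
    qed (use l(2) in \<open>auto simp: c cells_def small_shape_def\<close>)
  qed
qed

lemma small_between:
  assumes T: "T \<in> ssyt (Suc k) l" and l: "decreasing l" "length l = Suc k"
  shows "small_shape k l T \<in> between l"
proof -
  have "l ! Suc i \<le> card {j. j < l ! i \<and> T (i, j) < k}" "card {j. j < l ! i \<and> T (i, j) < k} \<le> l ! i"
    if i: "i < k" for i
  proof -
    \<comment> \<open>A cell with another one below it has an entry smaller than an entry that is at
      most \<open>k\<close>.\<close>
    have "{..<l ! Suc i} \<subseteq> {j. j < l ! i \<and> T (i, j) < k}"
    proof
      fix j assume "j \<in> {..<l ! Suc i}"
      then have c: "(Suc i, j) \<in> cells l" using i l by (auto simp: cells_def)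
      then have "T (i, j) < T (Suc i, j)" "T (Suc i, j) < Suc k" using T by (auto simp: ssyt_def)
      moreover have "l ! Suc i \<le> l ! i" using l i by (simp add: decreasing_def)
      ultimately show "j \<in> {j. j < l ! i \<and> T (i, j) < k}" using c by (auto simp: cells_def)
    qed
    from card_mono[OF _ this] show "l ! Suc i \<le> card {j. j < l ! i \<and> T (i, j) < k}" by simp
    have "card {j. j < l ! i \<and> T (i, j) < k} \<le> card {..<l ! i}" by (rule card_mono) auto
    then show "card {j. j < l ! i \<and> T (i, j) < k} \<le> l ! i" by simp
  qed
  then show ?thesis using l(2) by (simp add: between_def small_shape_def)
qed

lemma restr_ssyt:
  assumes T: "T \<in> ssyt (Suc k) l" and l: "decreasing l" "length l = Suc k"
  shows "restr (small_shape k l T) T \<in> ssyt k (small_shape k l T)"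
proof -
  let ?m = "small_shape k l T"
  note mc = small_cells[OF T l]
  have left: "(i, j) \<in> cells ?m" if "(i, Suc j) \<in> cells ?m" for i j
    using that by (auto simp: cells_def)
  have up: "(i, j) \<in> cells ?m" if "(Suc i, j) \<in> cells ?m" for i j
  proof -
    have *: "(Suc i, j) \<in> cells l" "T (Suc i, j) < k" using that unfolding mc by auto
    then have "T (i, j) < T (Suc i, j)" using T by (simp add: ssyt_def)
    moreover have "(i, j) \<in> cells l" using *(1) l by (auto simp: cells_def decreasing_def intro: less_le_trans)
    ultimately show ?thesis using *(2) unfolding mc by simp
  qed
  have in_l: "c \<in> cells l" "T c < k" if "c \<in> cells ?m" for c
    using that unfolding mc by auto
  show ?thesis
    unfolding ssyt_def
  proof (intro CollectI conjI allI impI ballI)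
    fix i j assume c: "(i, Suc j) \<in> cells ?m"
    then show "restr ?m T (i, j) \<le> restr ?m T (i, Suc j)"
      using left[OF c] in_l(1)[OF c] T by (simp add: restr_def ssyt_def)
  next
    fix i j assume c: "(Suc i, j) \<in> cells ?m"
    then show "restr ?m T (i, j) < restr ?m T (Suc i, j)"
      using up[OF c] in_l(1)[OF c] T by (simp add: restr_def ssyt_def)
  qed (use in_l(2) in \<open>auto simp: restr_def\<close>)
qed

lemma cells_inj:
  assumes "cells m = cells m'" "length m = length m'"
  shows "m = m'"
proof (rule nth_equalityI[OF assms(2)])
  fix i assume "i < length m"
  have "j < m ! i \<longleftrightarrow> j < m' ! i" for j
  proof -
    have "(i, j) \<in> cells m \<longleftrightarrow> (i, j) \<in> cells m'" using assms(1) by simp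
    then show ?thesis using \<open>i < length m\<close> assms(2) by (simp add: cells_def)
  qed
  then show "m ! i = m' ! i" by (metis less_irrefl linorder_neqE_nat)
qed

definition var :: "nat \<Rightarrow> mpoly" where
  "var i = Poly_Mapping.single (Poly_Mapping.single i 1) 1"

lemma var_power: "var i ^ n = Poly_Mapping.single (Poly_Mapping.single i n) 1"
  by (induction n) (simp_all add: var_def mult_single single_add[symmetric] single_one)

lemma tab_monomial_fill:
  assumes m: "m \<in> between l"
  shows "tab_monomial l (fill k l m T) = Poly_Mapping.single k (sum_list l - sum_list m) + tab_monomial m T"
proof -
  note sub = between_cells[OF m]
  have "tab_monomial l (fill k l m T) = (\<Sum>c\<in>cells l - cells m. Poly_Mapping.single (fill k l m T c) 1) +
     (\<Sum>c\<in>cells m. Poly_Mapping.single (fill k l m T c) 1)"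
    unfolding tab_monomial_def by (rule sum.subset_diff[OF sub finite_cells])
  also have "(\<Sum>c\<in>cells m. Poly_Mapping.single (fill k l m T c) 1) = tab_monomial m T"
    unfolding tab_monomial_def by (rule sum.cong) (auto simp: fill_def)
  also have "(\<Sum>c\<in>cells l - cells m. Poly_Mapping.single (fill k l m T c) 1) =
     (\<Sum>c\<in>cells l - cells m. Poly_Mapping.single k (1::nat))"
    by (rule sum.cong) (auto simp: fill_def)
  also have "\<dots> = Poly_Mapping.single k (card (cells l - cells m))"
  proof -
    have "(\<Sum>c\<in>A. Poly_Mapping.single k (1::nat)) = Poly_Mapping.single k (card A)" if "finite A" for A :: "(nat \<times> nat) set"
      using that by (induction A rule: finite_induct) (simp_all add: single_add[symmetric] del: sum_constant)
    then show ?thesis using finite_cells by simp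
  qed
  also have "card (cells l - cells m) = sum_list l - sum_list m"
    by (simp add: card_Diff_subset[OF finite_cells sub] card_cells)
  finally show ?thesis .
qed

lemma finite_between: "finite (between l)"
proof (rule finite_subset)
  show "between l \<subseteq> {m. set m \<subseteq> {..Max (set l)} \<and> length m = length l - 1}"
  proof
    fix m assume m: "m \<in> between l"
    have "m ! i \<le> Max (set l)" if "i < length m" for i
    proof -
      have "l ! i \<in> set l" using m that by (auto simp: between_def)
      then have "l ! i \<le> Max (set l)" by simp
      then show ?thesis using m that by (auto simp: between_def intro: order_trans)
    qed
    then show "m \<in> {m. set m \<subseteq> {..Max (set l)} \<and> length m = length l - 1}"
      using m by (auto simp: between_def in_set_conv_nth)
  qed
qed (rule finite_lists_length_eq, simp)

theorem schur_branching:
  assumes l: "decreasing l" "length l = Suc k"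
  shows "schur (Suc k) l = (\<Sum>m\<in>between l. var k ^ (sum_list l - sum_list m) * schur k m)"
proof -
  have "schur (Suc k) l =
    (\<Sum>(m, T)\<in>(SIGMA m:between l. ssyt k m). Poly_Mapping.single (tab_monomial l (fill k l m T)) 1)"
    unfolding schur_def
  proof (rule sum.reindex_bij_witness[where i = "\<lambda>(m, T). fill k l m T" and j = "\<lambda>T. (small_shape k l T, restr (small_shape k l T) T)"], goal_cases)
    case (1 T)
    then have T: "\<And>c. c \<notin> cells l \<Longrightarrow> T c = 0" "\<And>c. c \<in> cells l \<Longrightarrow> T c < Suc k"
      unfolding ssyt_def by blast+
    show ?case
    proof
      fix c
      show "(case (small_shape k l T, restr (small_shape k l T) T) of (m, T) \<Rightarrow> fill k l m T) c = T c"
        using T[of c] by (auto simp: fill_def restr_def small_cells[OF 1 l] less_Suc_eq)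
    qed
  next
    case (2 T)
    then show ?case using small_between[OF 2 l] restr_ssyt[OF 2 l] by simp
  next
    case (3 p)
    obtain m T where p: "p = (m, T)" by (cases p)
    have m: "m \<in> between l" and T: "T \<in> ssyt k m" using 3 by (auto simp: p)
    note F = fill_ssyt[OF m l(2) T]
    have "cells (small_shape k l (fill k l m T)) = cells m"
      using T between_cells[OF m] by (auto simp: small_cells[OF F l] fill_def ssyt_def)
    then have s: "small_shape k l (fill k l m T) = m"
      by (rule cells_inj) (use m l in \<open>auto simp: small_shape_def between_def\<close>)
    have "restr m (fill k l m T) = T" using T by (auto simp: restr_def fill_def ssyt_def)
    then show ?case by (simp add: p s)
  next
    case (4 p)
    then show ?case using fill_ssyt[OF _ l(2)] by auto
  next
    case (5 T)
    then have T: "\<And>c. c \<notin> cells l \<Longrightarrow> T c = 0" "\<And>c. c \<in> cells l \<Longrightarrow> T c < Suc k"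
      unfolding ssyt_def by blast+
    have "fill k l (small_shape k l T) (restr (small_shape k l T) T) = T"
    proof
      fix c
      show "fill k l (small_shape k l T) (restr (small_shape k l T) T) c = T c"
        using T[of c] by (auto simp: fill_def restr_def small_cells[OF 5 l] less_Suc_eq)
    qed
    then show ?case by simp
  qed
  also have "\<dots> = (\<Sum>m\<in>between l. \<Sum>T\<in>ssyt k m. Poly_Mapping.single (tab_monomial l (fill k l m T)) 1)"
    by (rule sum.Sigma[symmetric]) (use finite_between finite_ssyt in auto)
  also have "\<dots> = (\<Sum>m\<in>between l. var k ^ (sum_list l - sum_list m) * schur k m)"
    unfolding schur_def sum_distrib_left
    by (intro sum.cong refl) (simp add: tab_monomial_fill var_power mult_single)
  finally show ?thesis .
qed

lemma schur_0: "schur 0 [] = 1"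
proof -
  have "ssyt 0 [] = {\<lambda>_. 0}" by (auto simp: ssyt_def cells_def)
  then show ?thesis by (simp add: schur_def tab_monomial_def cells_def single_one)
qed

theorem gt_poly_schur:
  assumes "sorted l" "length l = k"
  shows "gt_poly var k l = schur k (rev l)"
  using assms
proof (induction k arbitrary: l)
  case 0
  then show ?case by (simp add: schur_0)
next
  case (Suc k)
  obtain b bs where l: "l = b # bs" "length bs = k" using Suc.prems by (cases l) auto
  have dec: "decreasing (rev l)"
    using Suc.prems by (auto simp: decreasing_def rev_nth sorted_iff_nth_mono)
  have srt: "sorted cs" if "cs \<in> interlaced b bs" for cs
  proof -
    have "cs ! i \<le> cs ! Suc i" if "Suc i < length cs" for i
    proof -
      have "cs ! i \<le> bs ! i" "(b # bs) ! Suc i \<le> cs ! Suc i"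
        using that \<open>cs \<in> interlaced b bs\<close> unfolding interlaced_iff by auto
      then show ?thesis by simp
    qed
    then show ?thesis by (simp add: sorted_iff_nth_Suc)
  qed
  have img: "between (rev l) = rev ` interlaced b bs"
  proof (rule set_eqI)
    fix m
    have "m \<in> between (rev l) \<longleftrightarrow> length m = k \<and> (\<forall>i<k. rev l ! Suc i \<le> m ! i \<and> m ! i \<le> rev l ! i)"
      by (auto simp: between_def l)
    also have "\<dots> \<longleftrightarrow> length m = k \<and> (\<forall>i<k. l ! i \<le> rev m ! i \<and> rev m ! i \<le> l ! Suc i)"
    proof (rule conj_cong[OF refl])
      assume m: "length m = k"
      \<comment> \<open>Position \<open>i\<close> corresponds to \<open>k - Suc i\<close> in the
        reversed list. The reversal occurs because shapes decrease while \<open>gt_poly\<close>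
        takes increasing lists.\<close>
      have r: "rev l ! Suc (k - Suc i) = l ! i" "rev l ! (k - Suc i) = l ! Suc i" "rev m ! i = m ! (k - Suc i)"
        "rev l ! Suc i = l ! (k - Suc i)" "rev l ! i = l ! Suc (k - Suc i)" "rev m ! (k - Suc i) = m ! i" if "i < k" for i
        using that m Suc.prems(2) by (simp_all add: rev_nth Suc_diff_Suc)
      show "(\<forall>i<k. rev l ! Suc i \<le> m ! i \<and> m ! i \<le> rev l ! i) \<longleftrightarrow> (\<forall>i<k. l ! i \<le> rev m ! i \<and> rev m ! i \<le> l ! Suc i)"
      proof (intro iffI allI impI)
        fix i assume *: "\<forall>i<k. rev l ! Suc i \<le> m ! i \<and> m ! i \<le> rev l ! i" and i: "i < k"
        have "k - Suc i < k" using i by simp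
        with * have "rev l ! Suc (k - Suc i) \<le> m ! (k - Suc i) \<and> m ! (k - Suc i) \<le> rev l ! (k - Suc i)" by blast
        then show "l ! i \<le> rev m ! i \<and> rev m ! i \<le> l ! Suc i"
          using r[OF i] by simp
      next
        fix i assume *: "\<forall>i<k. l ! i \<le> rev m ! i \<and> rev m ! i \<le> l ! Suc i" and i: "i < k"
        have "k - Suc i < k" using i by simp
        with * have "l ! (k - Suc i) \<le> rev m ! (k - Suc i) \<and> rev m ! (k - Suc i) \<le> l ! Suc (k - Suc i)" by blast
        then show "rev l ! Suc i \<le> m ! i \<and> m ! i \<le> rev l ! i"
          using r[OF i] by simp
      qed
    qed
    also have "\<dots> \<longleftrightarrow> rev m \<in> interlaced b bs"
      unfolding interlaced_iff by (simp add: l)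
    also have "\<dots> \<longleftrightarrow> m \<in> rev ` interlaced b bs"
      by (metis image_iff rev_rev_ident)
    finally show "m \<in> between (rev l) \<longleftrightarrow> m \<in> rev ` interlaced b bs" .
  qed
  have "schur (Suc k) (rev l) = (\<Sum>cs\<in>interlaced b bs. var k ^ (sum_list l - sum_list cs) * schur k (rev cs))"
    using schur_branching[OF dec, of k] Suc.prems(2) unfolding img
    by (simp add: sum.reindex)
  also have "\<dots> = (\<Sum>cs\<in>interlaced b bs. var k ^ b * (var k ^ (sum_list bs - sum_list cs) * gt_poly var k cs))"
  proof (rule sum.cong[OF refl])
    fix cs assume cs: "cs \<in> interlaced b bs"
    have "length cs = k" using cs l(2) unfolding interlaced_iff by simp
    moreover have "sum_list l - sum_list cs = b + (sum_list bs - sum_list cs)"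
      using interlaced_le[OF cs] by (simp add: l(1))
    ultimately show "var k ^ (sum_list l - sum_list cs) * schur k (rev cs) =
       var k ^ b * (var k ^ (sum_list bs - sum_list cs) * gt_poly var k cs)"
      using Suc.IH[OF srt[OF cs]] by (simp add: power_add mult.assoc)
  qed
  also have "\<dots> = gt_poly var (Suc k) l"
    by (simp add: l(1) interlace_eq_sum sum_distrib_left)
  finally show ?case by simp
qed

section \<open>Linear independence of Schur polynomials\<close>

lemma lookup_of_int_mult: "Poly_Mapping.lookup (of_int a * (p :: mpoly)) m = a * Poly_Mapping.lookup p m"
proof -
  have nat: "Poly_Mapping.lookup (of_nat n * p) m = int n * Poly_Mapping.lookup p m" for n
    by (induction n) (simp_all add: lookup_add algebra_simps)
  show ?thesis
  proof (cases a)
    case (nonneg n)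
    then show ?thesis using nat[of n] by simp
  next
    case (neg n)
    then show ?thesis using nat[of "Suc n"] by (simp only: of_int_minus of_int_of_nat_eq mult_minus_left lookup_uminus)
  qed
qed

lemma lookup_schur:
  "Poly_Mapping.lookup (schur n la) m = int (card {T \<in> ssyt n la. tab_monomial la T = m})"
proof -
  have "Poly_Mapping.lookup (schur n la) m = (\<Sum>T\<in>ssyt n la. if tab_monomial la T = m then 1 else 0)"
    unfolding schur_def by (subst lookup_sum) (rule sum.cong, simp_all add: lookup_single when_def)
  also have "\<dots> = int (card {T \<in> ssyt n la. tab_monomial la T = m})"
    using finite_ssyt[of n la] by (simp add: sum.If_cases Int_def)
  finally show ?thesis .
qed

lemma lookup_tab: "Poly_Mapping.lookup (tab_monomial la T) i = card {c \<in> cells la. T c = i}"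
proof -
  have "Poly_Mapping.lookup (tab_monomial la T) i = (\<Sum>c\<in>cells la. if T c = i then 1 else 0)"
    unfolding tab_monomial_def by (subst lookup_sum) (rule sum.cong, simp_all add: lookup_single when_def)
  also have "\<dots> = card {c \<in> cells la. T c = i}"
    using finite_cells[of la] by (simp add: sum.If_cases Int_def)
  finally show ?thesis .
qed

text \<open>The partial sums of the parts, which define the dominance order; counting cells avoids a
  case distinction for missing rows.\<close>

definition rows_upto :: "nat list \<Rightarrow> nat \<Rightarrow> nat" where
  "rows_upto la i = card {c \<in> cells la. fst c \<le> i}"

text \<open>The superstandard tableau, whose monomial has the partition itself as exponent
  vector.\<close>

definition row_tab :: "nat list \<Rightarrow> nat \<times> nat \<Rightarrow> nat" where
  "row_tab la c = (if c \<in> cells la then fst c else 0)"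

lemma is_partition_decreasing: "is_partition la \<Longrightarrow> decreasing la"
  unfolding is_partition_def decreasing_def sorted_rev_iff_nth_Suc by auto

lemma length_le_sum_list: "0 \<notin> set la \<Longrightarrow> length la \<le> sum_list (la :: nat list)"
proof (induction la)
  case (Cons a la) then show ?case by (cases a) auto
qed simp

lemma row_tab_ssyt:
  assumes "is_partition la" "sum_list la = n"
  shows "row_tab la \<in> ssyt n la"
proof -
  have len: "length la \<le> n" using assms length_le_sum_list[of la] by (auto simp: is_partition_def)
  have dec: "(i, j) \<in> cells la" if "(Suc i, j) \<in> cells la" for i j
    using that is_partition_decreasing[OF assms(1)] by (auto simp: decreasing_def cells_def intro: less_le_trans)
  show ?thesis
    unfolding ssyt_def
  proof (intro CollectI conjI allI impI ballI)
    fix c assume "c \<in> cells la"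
    then show "row_tab la c < n" using len by (auto simp: row_tab_def cells_def)
  qed (auto simp: row_tab_def cells_def dec dest: dec)
qed

lemma card_entries_upto:
  "card {c \<in> cells la. T c \<le> i} = (\<Sum>e\<le>i. Poly_Mapping.lookup (tab_monomial la T) e)"
proof -
  have "{c \<in> cells la. T c \<le> i} = (\<Union>e\<in>{..i}. {c \<in> cells la. T c = e})" by auto
  then have "card {c \<in> cells la. T c \<le> i} = (\<Sum>e\<in>{..i}. card {c \<in> cells la. T c = e})"
    using finite_cells[of la] by (subst card_UN_disjoint[symmetric]) auto
  then show ?thesis by (simp add: lookup_tab)
qed

text \<open>Entries at most \<open>i\<close> lie in the rows up to \<open>i\<close>, since columns
  increase strictly. Hence the content of \<open>T\<close> is dominated by its shape, and equality
  at \<open>i\<close> means that these rows contain no larger entries.\<close>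

lemma rows_upto_dominance:
  assumes "decreasing la" "T \<in> ssyt n la" "tab_monomial la T = tab_monomial ka (row_tab ka)"
  shows "rows_upto ka i \<le> rows_upto la i"
    "rows_upto ka i = rows_upto la i \<Longrightarrow> {c \<in> cells la. T c \<le> i} = {c \<in> cells la. fst c \<le> i}"
proof -
  have sub: "{c \<in> cells la. T c \<le> i} \<subseteq> {c \<in> cells la. fst c \<le> i}"
  proof clarify
    fix r j assume "(r, j) \<in> cells la" "T (r, j) \<le> i"
    then show "fst (r, j) \<le> i" using ssyt_entry_ge_row[OF assms(2,1), of r j] by simp
  qed
  have fin: "finite {c \<in> cells la. fst c \<le> i}" using finite_cells by simp
  have "rows_upto ka i = card {c \<in> cells ka. row_tab ka c \<le> i}"
    unfolding rows_upto_def by (rule arg_cong[where f = card]) (auto simp: row_tab_def)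
  also have "\<dots> = card {c \<in> cells la. T c \<le> i}"
    unfolding card_entries_upto assms(3) ..
  finally have e: "rows_upto ka i = card {c \<in> cells la. T c \<le> i}" .
  show "rows_upto ka i \<le> rows_upto la i"
    unfolding e unfolding rows_upto_def by (rule card_mono[OF fin sub])
  show "{c \<in> cells la. T c \<le> i} = {c \<in> cells la. fst c \<le> i}" if "rows_upto ka i = rows_upto la i"
    using card_subset_eq[OF fin sub] that unfolding e by (simp add: rows_upto_def)
qed

lemma rows_upto_row:
  "rows_upto la i = (if i = 0 then 0 else rows_upto la (i - 1)) + (if i < length la then la ! i else 0)"
proof -
  have "{c \<in> cells la. fst c \<le> i} = {c \<in> cells la. fst c < i} \<union> {c \<in> cells la. fst c = i}" by auto
  then have "rows_upto la i = card {c \<in> cells la. fst c < i} + card {c \<in> cells la. fst c = i}"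
    unfolding rows_upto_def using finite_cells[of la] by (simp add: card_Un_disjoint disjoint_iff)
  moreover have "card {c \<in> cells la. fst c < i} = (if i = 0 then 0 else rows_upto la (i - 1))"
    unfolding rows_upto_def by (cases i) (auto simp: less_Suc_eq_le)
  moreover have "card {c \<in> cells la. fst c = i} = (if i < length la then la ! i else 0)"
  proof -
    have "{c \<in> cells la. fst c = i} = {i} \<times> (if i < length la then {..<la ! i} else {})"
      by (auto simp: cells_def split: if_splits)
    then show ?thesis by (simp add: card_cartesian_product)
  qed
  ultimately show ?thesis by simp
qed

lemma rows_upto_inj:
  assumes la: "la \<in> partitions_of n" and ka: "ka \<in> partitions_of n"
    and eq: "\<And>i. i < n \<Longrightarrow> rows_upto la i = rows_upto ka i"
  shows "la = ka"
proof -
  have len: "length la \<le> n" "length ka \<le> n"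
    using la ka length_le_sum_list[of la] length_le_sum_list[of ka] by (auto simp: partitions_of_def is_partition_def)
  have row: "(if i < length la then la ! i else 0) = (if i < length ka then ka ! i else 0)" if "i < n" for i
    using rows_upto_row[of la i] rows_upto_row[of ka i] eq[OF that] eq[of "i - 1"] that by (cases i) simp_all
  have pos: "la ! i \<noteq> 0" if "i < length la" for i
    using la nth_mem[OF that] by (metis (lifting) mem_Collect_eq partitions_of_def is_partition_def)
  have pos': "ka ! i \<noteq> 0" if "i < length ka" for i
    using ka nth_mem[OF that] by (metis (lifting) mem_Collect_eq partitions_of_def is_partition_def)
  have iff: "i < length la \<longleftrightarrow> i < length ka" for i
    using row[of i] pos[of i] pos'[of i] len by (metis less_le_trans)
  then have "length la = length ka" by (metis linorder_neqE_nat less_irrefl)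
  then show ?thesis
    by (rule nth_equalityI) (use row iff len in \<open>metis less_le_trans\<close>)
qed

lemma finite_partitions_of: "finite (partitions_of n)"
proof (rule finite_subset)
  show "partitions_of n \<subseteq> {la. set la \<subseteq> {..n} \<and> length la \<le> n}"
  proof
    fix la assume la: "la \<in> partitions_of n"
    have "x \<le> n" if "x \<in> set la" for x
      using member_le_sum_list[OF that] la by (simp add: partitions_of_def)
    then show "la \<in> {la. set la \<subseteq> {..n} \<and> length la \<le> n}"
      using la length_le_sum_list[of la] by (auto simp: partitions_of_def is_partition_def)
  qed
qed (rule finite_lists_length_le, simp)

text \<open>The monomial of \<open>row_tab mu\<close> occurs once in the Schur polynomial of
  \<open>mu\<close> and otherwise only for shapes that dominate \<open>mu\<close>. If
  \<open>mu\<close> is dominance-maximal among the shapes with nonzero coefficient, nothing cancels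
  it.\<close>

theorem schur_independent:
  assumes zero: "(\<Sum>ka\<in>partitions_of n. of_int (c ka) * schur n ka) = 0" and ka: "ka \<in> partitions_of n"
  shows "c ka = 0"
proof (rule ccontr)
  assume "c ka \<noteq> 0"
  let ?S = "{la \<in> partitions_of n. c la \<noteq> 0}"
  \<comment> \<open>The sum of all partial sums increases strictly along the dominance order, so its
    maximum is attained at a dominance-maximal shape.\<close>
  let ?w = "\<lambda>la. \<Sum>i<n. rows_upto la i"
  have fin: "finite ?S" "?S \<noteq> {}" using finite_partitions_of ka \<open>c ka \<noteq> 0\<close> by auto
  have "Max (?w ` ?S) \<in> ?w ` ?S" using fin by (intro Max_in) auto
  then obtain mu where mu: "mu \<in> ?S" and mu_max: "?w mu = Max (?w ` ?S)" by auto
  have max: "?w la \<le> ?w mu" if "la \<in> ?S" for la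
    unfolding mu_max using fin that by (intro Max_ge) auto
  let ?m = "tab_monomial mu (row_tab mu)"
  have part: "is_partition mu" "sum_list mu = n" using mu by (auto simp: partitions_of_def)
  have key: "la = mu \<and> T = row_tab mu" if la: "la \<in> ?S" and T: "T \<in> ssyt n la" and m: "tab_monomial la T = ?m" for la T
  proof -
    have dec: "decreasing la" using la is_partition_decreasing by (auto simp: partitions_of_def)
    note dom = rows_upto_dominance[OF dec T m]
    have eq: "rows_upto mu i = rows_upto la i" if "i < n" for i
    proof (rule ccontr)
      assume "rows_upto mu i \<noteq> rows_upto la i"
      then have "rows_upto mu i < rows_upto la i" using dom(1)[of i] by simp
      then have "?w mu < ?w la" using dom(1) that by (intro sum_strict_mono_ex1) auto
      then show False using max[OF la] by simp
    qed
    have lm: "la = mu" by (rule rows_upto_inj) (use la mu eq in auto)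
    have "T d = row_tab mu d" for d
    proof (cases "d \<in> cells la")
      case True
      have lt: "T d < n" using T True by (simp add: ssyt_def)
      have "fst d \<le> T d" using ssyt_entry_ge_row[OF T dec, of "fst d" "snd d"] True by simp
      moreover have "T d \<le> fst d"
      proof -
        have "fst d < n" using \<open>fst d \<le> T d\<close> lt by simp
        then have "{c \<in> cells la. T c \<le> fst d} = {c \<in> cells la. fst c \<le> fst d}" using dom(2) eq by blast
        then show ?thesis using True by blast
      qed
      ultimately show ?thesis using True lm by (simp add: row_tab_def)
    next
      case False
      moreover have "T d = 0" using T False unfolding ssyt_def by blast
      ultimately show ?thesis using lm by (simp add: row_tab_def)
    qed
    then show ?thesis using lm by blast
  qed
  have "0 = Poly_Mapping.lookup (\<Sum>ka\<in>partitions_of n. of_int (c ka) * schur n ka) ?m"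
    by (simp only: zero lookup_zero)
  also have "\<dots> = (\<Sum>ka\<in>partitions_of n. c ka * int (card {T \<in> ssyt n ka. tab_monomial ka T = ?m}))"
    by (simp add: lookup_sum lookup_of_int_mult lookup_schur)
  also have "\<dots> = (\<Sum>ka\<in>partitions_of n. if ka = mu then c mu else 0)"
  proof (rule sum.cong[OF refl])
    fix la assume la: "la \<in> partitions_of n"
    show "c la * int (card {T \<in> ssyt n la. tab_monomial la T = ?m}) = (if la = mu then c mu else 0)"
    proof (cases "c la = 0")
      case True
      then show ?thesis by auto
    next
      case False
      then have laS: "la \<in> ?S" using la by simp
      show ?thesis
      proof (cases "la = mu")
        case True
        then have "{T \<in> ssyt n la. tab_monomial la T = ?m} = {row_tab mu}"
          using key[OF laS] row_tab_ssyt[OF part] by auto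
        then show ?thesis using True by simp
      next
        case False
        then have "{T \<in> ssyt n la. tab_monomial la T = ?m} = {}"
          using key[OF laS] by blast
        then show ?thesis using False by (simp only: card.empty of_nat_0 mult_zero_right if_False)
      qed
    qed
  qed
  also have "\<dots> = c mu" using finite_partitions_of mu by simp
  finally show False using mu by simp
qed

lemma lr_coeff_eqI:
  assumes k: "k = sum_list mu + sum_list nu"
    and supp: "\<And>ka. ka \<notin> partitions_of k \<Longrightarrow> c ka = 0"
    and prod: "schur k mu * schur k nu = (\<Sum>ka\<in>partitions_of k. of_int (c ka) * schur k ka)"
  shows "lr_coeff mu nu la = c la"
proof -
  have "(THE c. (\<forall>ka. ka \<notin> partitions_of k \<longrightarrow> c ka = 0) \<and>
      schur k mu * schur k nu = (\<Sum>ka\<in>partitions_of k. of_int (c ka) * schur k ka)) = c"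
  proof (rule the_equality)
    fix c' assume c': "(\<forall>ka. ka \<notin> partitions_of k \<longrightarrow> c' ka = 0) \<and>
      schur k mu * schur k nu = (\<Sum>ka\<in>partitions_of k. of_int (c' ka) * schur k ka)"
    have "(\<Sum>ka\<in>partitions_of k. of_int (c' ka - c ka) * schur k ka) = 0"
      using c' prod by (simp add: left_diff_distrib sum_subtractf)
    then have "c' ka - c ka = 0" if "ka \<in> partitions_of k" for ka
      using schur_independent[where n = k and c = "\<lambda>ka. c' ka - c ka"] that by blast
    then show "c' = c" using c' supp by (intro ext) (metis right_minus_eq)
  qed (use supp prod in auto)
  then show ?thesis unfolding lr_coeff_def Let_def k[symmetric] by simp
qed

section \<open>Puzzles and Littlewood--Richardson coefficients\<close>

definition shape :: "lab list \<Rightarrow> nat list" where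
  "shape w = rev (filter (\<lambda>k. k \<noteq> 0) (zero_parts 0 w))"

lemma of_int_cross:
  "of_int (cross z a b F) = cross (of_int z) a b (\<lambda>p q. of_int (F p q))"
  by (cases a; cases b; simp add: cross_simps)

lemma of_int_strip:
  "of_int (strip y0 ys u b F) = strip (of_int y0) (map of_int ys) u b (\<lambda>qs p. of_int (F qs p))"
  by (induction y0 ys u b F rule: strip.induct) (simp_all add: of_int_cross)

text \<open>\<open>puz_product\<close> is applied over polynomials, whereas the coefficients of the
  expansion are integers; this identifies the two weights at parameter 0.\<close>

lemma of_int_puz: "of_int (puz ys u v w) = puz (map of_int ys) u v w"
proof (induction ys arbitrary: u v w)
  case (Cons y ys)
  have "of_int (of_bool Q * k) = of_bool Q * (of_int k :: 'a)" for Q k by (cases Q) simp_all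
  then show ?case by (simp add: of_int_strip Cons split: list.split)
qed simp

lemma sorted_pw: "sorted (zero_parts c w) \<and> (\<forall>x\<in>set (zero_parts c w). c \<le> x)"
proof (induction w arbitrary: c)
  case (Cons a w)
  show ?case using Cons[of c] Cons[of "Suc c"] by (auto dest: Suc_leD)
qed simp

lemma length_pw: "length (zero_parts c w) = count_list w N0"
  by (induction w arbitrary: c) auto

lemma sum_pw: "bin w \<Longrightarrow> sum_list (zero_parts c w) = c * count_list w N0 + inversions w"
  by (induction w arbitrary: c) auto

lemma pw_snoc_N1: "zero_parts c (w @ [N1]) = zero_parts c w"
  by (induction w arbitrary: c) auto

lemma pw_inj:
  assumes "bin w" "bin w'" "length w = length w'" "zero_parts c w = zero_parts c w'"
  shows "w = w'"
  using assms
proof (induction w arbitrary: w' c)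
  case (Cons a w)
  obtain b w2 where w': "w' = b # w2" using Cons.prems by (cases w') auto
  have a: "a = N0 \<or> a = N1" and b: "b = N0 \<or> b = N1" using Cons.prems w' by auto
  have ne: "zero_parts (Suc c) x \<noteq> c # y" for x y using sorted_pw[of "Suc c" x] by auto
  consider "a = N0" "b = N0" | "a = N1" "b = N1" | "a = N0" "b = N1" | "a = N1" "b = N0" using a b by blast
  then show ?case
  proof cases
    case 1
    then show ?thesis using Cons.prems Cons.IH[of w2 c] unfolding w' by simp
  next
    case 2
    then show ?thesis using Cons.prems Cons.IH[of w2 "Suc c"] unfolding w' by simp
  next
    case 3
    then show ?thesis using Cons.prems(4) ne[of w2 "zero_parts c w"] unfolding w' by simp
  next
    case 4
    then show ?thesis using Cons.prems(4) ne[of w "zero_parts c w2"] unfolding w' by simp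
  qed
qed simp

text \<open>The inverse of \<open>zero_parts c\<close> on binary words; \<open>c\<close> counts the
  1s already written and \<open>m\<close> is the total number of 1s.\<close>

fun word_of :: "nat \<Rightarrow> nat list \<Rightarrow> nat \<Rightarrow> lab list" where
  "word_of c [] m = replicate (m - c) N1"
| "word_of c (a # as) m = replicate (a - c) N1 @ N0 # word_of a as m"

lemma pw_replicate: "zero_parts c (replicate n N1 @ w) = zero_parts (c + n) w"
  by (induction n arbitrary: c) auto

lemma word_of:
  assumes "sorted (c # as)" "\<forall>a\<in>set (c # as). a \<le> m"
  shows "zero_parts c (word_of c as m) = as" "bin (word_of c as m)"
    "count_list (word_of c as m) N0 = length as" "length (word_of c as m) + c = length as + m"
  using assms
proof (induction c as m rule: word_of.induct)
  case (1 c m)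
  {
    case 1 then show ?case using pw_replicate[of c "m - c" "[]"] by simp
  next
    case 2 then show ?case by auto
  next
    case 3 then show ?case by (auto simp: count_list_0_iff)
  next
    case 4 then show ?case by auto
  }
next
  case (2 c a as m)
  have r0: "count_list (replicate n N1) N0 = 0" for n by (auto simp: count_list_0_iff)
  {
    case 1 then show ?case using 2 by (simp add: pw_replicate)
  next
    case 2 then show ?case using "2.IH" by auto
  next
    case 3 then show ?case using "2.IH" by (simp add: r0)
  next
    case 4 then show ?case using "2.IH" by auto
  }
qed

lemma pw_shape:
  "zero_parts 0 w = replicate (count_list w N0 - length (shape w)) 0 @ rev (shape w)"
proof -
  have "xs = replicate (length xs - length (filter (\<lambda>k. k \<noteq> 0) xs)) 0 @ filter (\<lambda>k. k \<noteq> 0) xs"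
    if "sorted xs" for xs :: "nat list"
    using that
  proof (induction xs)
    case (Cons x xs)
    show ?case
    proof (cases "x = 0")
      case True
      have "length (filter (\<lambda>k. k \<noteq> 0) xs) \<le> length xs" by simp
      then show ?thesis using Cons True by (simp add: Suc_diff_le)
    next
      case False
      then have "filter (\<lambda>k. k \<noteq> 0) xs = xs" using Cons.prems by (auto simp: filter_id_conv)
      then show ?thesis using False by simp
    qed
  qed simp
  from this[of "zero_parts 0 w"] show ?thesis using sorted_pw[of 0 w] by (simp add: shape_def length_pw)
qed

lemma cells_append_zeros: "cells (la @ replicate n 0) = cells la"
  by (auto simp: cells_def nth_append split: if_splits)

lemma schur_shape: "schur n (shape w) = schur n (rev (zero_parts 0 w))"
  using cells_append_zeros[of "shape w"] pw_shape[of w] by (intro schur_cells_cong) simp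

lemma shape_partition:
  assumes "bin w"
  shows "shape w \<in> partitions_of (inversions w)"
proof -
  have f: "sum_list (filter (\<lambda>k. k \<noteq> 0) xs) = sum_list xs" for xs :: "nat list"
    by (induction xs) auto
  have "sum_list (shape w) = inversions w"
    unfolding shape_def sum_list_rev f using sum_pw[OF assms, of 0] by simp
  moreover have "is_partition (shape w)"
    unfolding shape_def is_partition_def rev_rev_ident
    using sorted_wrt_filter[of "(\<le>)" "zero_parts 0 w" "\<lambda>k. k \<noteq> 0"] sorted_pw[of 0 w] by auto
  ultimately show ?thesis by (simp add: partitions_of_def)
qed

lemma branch_schur:
  assumes "bin w" "count_list w N0 = k"
  shows "branch var k w = schur k (shape w)"
  using branch_gt_poly[OF assms(1), of var k] gt_poly_schur[of "zero_parts 0 w" k] sorted_pw[of 0 w] assms(2)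
  by (simp add: schur_shape length_pw)

text \<open>A partition of \<open>K\<close> has at most \<open>K\<close> parts, each at most
  \<open>K\<close>, so it fits into the box with \<open>K\<close> rows and \<open>N - K\<close>
  columns that these words describe.\<close>

lemma shape_bij:
  assumes "K \<le> N - K"
  shows "bij_betw shape {w. length w = N \<and> bin w \<and> count_list w N0 = K \<and> inversions w = K} (partitions_of K)"
proof (rule bij_betwI')
  fix w w' assume w: "w \<in> {w. length w = N \<and> bin w \<and> count_list w N0 = K \<and> inversions w = K}"
    and w': "w' \<in> {w. length w = N \<and> bin w \<and> count_list w N0 = K \<and> inversions w = K}"
  have "zero_parts 0 w = zero_parts 0 w'" if "shape w = shape w'"
    unfolding pw_shape[of w] pw_shape[of w'] that using w w' by simp
  moreover have "bin w" "bin w'" "length w = length w'" using w w' by simp_all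
  ultimately have "w = w'" if "shape w = shape w'" using that by (intro pw_inj[of w w' 0])
  then show "shape w = shape w' \<longleftrightarrow> w = w'" by (intro iffI) simp_all
next
  fix w assume "w \<in> {w. length w = N \<and> bin w \<and> count_list w N0 = K \<and> inversions w = K}"
  then show "shape w \<in> partitions_of K" using shape_partition[of w] by auto
next
  fix ka assume ka: "ka \<in> partitions_of K"
  then have p: "sorted (rev ka)" "0 \<notin> set ka" "sum_list ka = K" by (auto simp: partitions_of_def is_partition_def)
  have len: "length ka \<le> K" using length_le_sum_list[OF p(2)] p(3) by simp
  define as where "as = replicate (K - length ka) 0 @ rev ka"
  have "x \<le> N - K" if "x \<in> set ka" for x
    using member_le_sum_list[OF that] p(3) assms by simp
  then have le: "\<forall>a\<in>set (0 # as). a \<le> N - K" by (auto simp: as_def)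
  have srt: "sorted (0 # as)" using p(1) by (auto simp: as_def sorted_append)
  define w where "w = word_of 0 as (N - K)"
  note W = word_of[OF srt le, folded w_def]
  have la: "length as = K" using len by (simp add: as_def)
  have KN: "K \<le> N" using assms by simp
  have "filter (\<lambda>k. k \<noteq> 0) as = rev ka"
  proof -
    have "filter (\<lambda>k. k \<noteq> 0) (rev ka) = rev ka" using p(2) by (simp add: filter_id_conv) (metis not_gr0)
    then show ?thesis by (simp only: as_def filter_append filter_replicate) simp
  qed
  then have sh: "shape w = ka" unfolding shape_def W(1) by simp
  have "inversions w = K" using sum_pw[OF W(2), of 0] W(1) p(3) by (simp add: as_def sum_list_replicate)
  then have "w \<in> {w. length w = N \<and> bin w \<and> count_list w N0 = K \<and> inversions w = K}"
    using W la KN by simp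
  then show "\<exists>w\<in>{w. length w = N \<and> bin w \<and> count_list w N0 = K \<and> inversions w = K}. ka = shape w"
    using sh by blast
qed

abbreviation puz0 :: "lab list \<Rightarrow> lab list \<Rightarrow> lab list \<Rightarrow> int" where
  "puz0 u v w \<equiv> puz (replicate (length u) 0) u v w"

definition compatible :: "lab list \<Rightarrow> lab list \<Rightarrow> lab list \<Rightarrow> bool" where
  "compatible u v w \<longleftrightarrow> length v = length u \<and> length w = length u \<and> bin u \<and> bin v \<and> bin w \<and>
     count_list v N0 = count_list u N0 \<and> count_list w N0 = count_list u N0 \<and> inversions w = inversions u + inversions v"

text \<open>There are as many 0s as the degree because \<open>lr_coeff\<close> expands in exactly
  that many variables. Every partition of this degree is then the shape of one word, and
  \<open>puz_product\<close> is the expansion defining \<open>lr_coeff\<close>.\<close>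

lemma puz_lr_wide:
  assumes c: "compatible u v w" and k: "count_list u N0 = inversions w" and m: "inversions w \<le> count_list u N1"
  shows "puz0 u v w = lr_coeff (shape u) (shape v) (shape w)"
proof -
  define N K where "N = length u" and "K = inversions w"
  let ?W = "{w. length w = N \<and> bin w \<and> count_list w N0 = K \<and> inversions w = K}"
  have len: "length u = N" "length v = N" "length w = N" and bin: "bin u" "bin v" "bin w"
    and cnt: "count_list u N0 = K" "count_list v N0 = K" "count_list w N0 = K" and inversions: "inversions u + inversions v = K"
    using c k by (auto simp: compatible_def N_def K_def)
  have KN: "K \<le> N - K" using m count_bin[OF bin(1)] cnt len by (simp add: K_def)
  note bij = shape_bij[OF KN]
  \<comment> \<open>The value 0 elsewhere is the normalisation in the definition of
    \<open>lr_coeff\<close>.\<close>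
  define c where "c ka = (if ka \<in> partitions_of K then puz0 u v (inv_into ?W shape ka) else 0)" for ka
  have fW: "finite ?W" using finite_words[of N] by (rule rev_finite_subset) (auto simp: words_def)
  have "schur K (shape u) * schur K (shape v) = branch var K u * branch var K v"
    using branch_schur bin cnt by simp
  also have "\<dots> = (\<Sum>w\<in>words N. puz (replicate N 0) u v w * branch var K w)"
    using puz_product[OF len(1,2) bin(1,2) cnt(1,2), of var] inversions m by (simp add: K_def)
  also have "\<dots> = (\<Sum>w\<in>?W. puz (replicate N 0) u v w * branch var K w)"
  proof (rule sum.mono_neutral_right)
    show "?W \<subseteq> words N" by (auto simp: words_def)
    show "\<forall>w\<in>words N - ?W. puz (replicate N 0) u v w * branch var K w = 0"
    proof
      fix w' assume w': "w' \<in> words N - ?W"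
      have "puz (replicate N 0) u v w' = (0 :: mpoly)"
      proof (rule ccontr)
        assume nz: "puz (replicate N 0) u v w' \<noteq> (0 :: mpoly)"
        have lw: "length w' = N" using w' by (simp add: words_def)
        \<comment> \<open>All parameters are 0 here, so the inversion numbers agree exactly.\<close>
        have "bin w'" "count_list w' N0 = count_list u N0" "inversions w' = inversions u + inversions v"
          using puz_support(1,2)[of u "replicate N (0::mpoly)" v w'] puz_support(4)[of u "replicate N (0::mpoly)" v w' 0]
            nz len lw bin cnt by (auto simp: set_replicate_conv_if)
        then show False using w' lw cnt inversions by simp
      qed
      then show "puz (replicate N 0) u v w' * branch var K w' = 0" by simp
    qed
  qed (rule finite_words)
  also have "\<dots> = (\<Sum>w\<in>?W. of_int (c (shape w)) * schur K (shape w))"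
  proof (rule sum.cong[OF refl])
    fix w' assume w': "w' \<in> ?W"
    then have "shape w' \<in> partitions_of K" "inv_into ?W shape (shape w') = w'"
      using bij by (auto simp: bij_betw_def inv_into_f_f)
    then have "c (shape w') = puz0 u v w'" by (simp add: c_def)
    then show "puz (replicate N 0) u v w' * branch var K w' = of_int (c (shape w')) * schur K (shape w')"
      using branch_schur[of w' K] w' len by (simp add: of_int_puz)
  qed
  also have "\<dots> = (\<Sum>ka\<in>partitions_of K. of_int (c ka) * schur K ka)"
    by (rule sum.reindex_bij_betw[OF bij])
  finally have prod: "schur K (shape u) * schur K (shape v) = (\<Sum>ka\<in>partitions_of K. of_int (c ka) * schur K ka)" .
  have "K = sum_list (shape u) + sum_list (shape v)"
    using shape_partition[OF bin(1)] shape_partition[OF bin(2)] inversions by (simp add: partitions_of_def)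
  from lr_coeff_eqI[OF this _ prod, of "shape w"]
  have "lr_coeff (shape u) (shape v) (shape w) = c (shape w)" by (simp add: c_def)
  also have "\<dots> = puz0 u v w"
  proof -
    have "w \<in> ?W" using len bin cnt by (simp add: K_def)
    then have "shape w \<in> partitions_of K" "inv_into ?W shape (shape w) = w"
      using bij by (auto simp: bij_betw_def inv_into_f_f)
    then show ?thesis by (simp add: c_def)
  qed
  finally show ?thesis by simp
qed

lemma shape_snoc_N1: "shape (w @ [N1]) = shape w"
  by (simp add: shape_def pw_snoc_N1)

lemma shape_Cons_N0: "shape (N0 # w) = shape w"
  by (simp add: shape_def)

lemma puz0_snoc_N1: "compatible u v w \<Longrightarrow> puz0 (u @ [N1]) (v @ [N1]) (w @ [N1]) = puz0 u v w"
  using puz_snoc_N1[of u "replicate (length u) (0::int)" v w 0 N1]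
  by (simp add: compatible_def replicate_append_same[symmetric])

lemma puz0_Cons_N0: "compatible u v w \<Longrightarrow> puz0 (N0 # u) (N0 # v) (N0 # w) = puz0 u v w"
  using puz_Cons_N0[of u "replicate (length u) (0::int)" N0 0 N0 v w]
  by (simp add: compatible_def)

lemma compatible_snoc_N1: "compatible u v w \<Longrightarrow> compatible (u @ [N1]) (v @ [N1]) (w @ [N1])"
  by (auto simp: compatible_def inv_append)

lemma compatible_Cons_N0: "compatible (N0 # u) (N0 # v) (N0 # w) \<longleftrightarrow> compatible u v w"
  by (auto simp: compatible_def)

text \<open>Appending 1s to all three words changes neither inversions nor shapes nor the number of
  puzzles, and eventually meets the bound of \<open>puz_lr_wide\<close>.\<close>

lemma puz_lr_tall:
  assumes "compatible u v w" "count_list u N0 = inversions w"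
  shows "puz0 u v w = lr_coeff (shape u) (shape v) (shape w)"
  using assms
proof (induction "inversions w - count_list u N1" arbitrary: u v w)
  case 0
  then show ?case using puz_lr_wide by simp
next
  case (Suc n)
  have "puz0 (u @ [N1]) (v @ [N1]) (w @ [N1]) = lr_coeff (shape (u @ [N1])) (shape (v @ [N1])) (shape (w @ [N1]))"
  proof (rule Suc.hyps(1))
    show "n = inversions (w @ [N1]) - count_list (u @ [N1]) N1" using Suc.hyps(2) by (simp add: inv_append)
  qed (use Suc.prems compatible_snoc_N1 in \<open>auto simp: inv_append\<close>)
  then show ?case unfolding puz0_snoc_N1[OF Suc.prems(1)] shape_snoc_N1 .
qed

text \<open>Leading 0s add zero parts, that is variables, without changing the shapes or the number
  of puzzles.\<close>

lemma puz_lr_few_zeros: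
  assumes "compatible u v w" "count_list u N0 \<le> inversions w"
  shows "puz0 u v w = lr_coeff (shape u) (shape v) (shape w)"
  using assms
proof (induction "inversions w - count_list u N0" arbitrary: u v w)
  case 0
  then show ?case using puz_lr_tall by simp
next
  case (Suc n)
  have "puz0 (N0 # u) (N0 # v) (N0 # w) = lr_coeff (shape (N0 # u)) (shape (N0 # v)) (shape (N0 # w))"
  proof (rule Suc.hyps(1))
    show "n = inversions (N0 # w) - count_list (N0 # u) N0" using Suc.hyps(2) by simp
  qed (use Suc compatible_Cons_N0 in auto)
  then show ?case unfolding puz0_Cons_N0[OF Suc.prems(1)] shape_Cons_N0 .
qed

text \<open>A leading 1 would precede every 0 and give at least as many inversions as there are
  0s.\<close>

lemma starts_N0:
  assumes "bin u" "inversions u < count_list u N0"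
  obtains u' where "u = N0 # u'"
  using assms by (cases u) (auto split: if_splits)

text \<open>If there are more 0s than inversions, all three words start with 0; these letters are
  removed until \<open>puz_lr_few_zeros\<close> applies.\<close>

theorem puz_lr:
  assumes "compatible u v w"
  shows "puz0 u v w = lr_coeff (shape u) (shape v) (shape w)"
  using assms
proof (induction "count_list u N0 - inversions w" arbitrary: u v w)
  case 0
  then show ?case using puz_lr_few_zeros by simp
next
  case (Suc n)
  obtain u' v' w' where e: "u = N0 # u'" "v = N0 # v'" "w = N0 # w'"
  proof -
    have "inversions u < count_list u N0" "inversions v < count_list v N0" "inversions w < count_list w N0"
      using Suc.prems Suc.hyps(2) by (auto simp: compatible_def)
    then show ?thesis
      using that starts_N0[of u] starts_N0[of v] starts_N0[of w] Suc.prems unfolding compatible_def by metis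
  qed
  have c: "compatible u' v' w'" using Suc.prems unfolding e compatible_Cons_N0 .
  have "puz0 u' v' w' = lr_coeff (shape u') (shape v') (shape w')"
    by (rule Suc.hyps(1)[OF _ c]) (use Suc.hyps(2) in \<open>simp add: e\<close>)
  then show ?case unfolding e puz0_Cons_N0[OF c] shape_Cons_N0 .
qed

section \<open>Puzzles as lists of strips\<close>

definition rhomb_ok :: "lab \<Rightarrow> lab \<Rightarrow> lab \<Rightarrow> lab \<Rightarrow> bool" where
  "rhomb_ok a b p q \<longleftrightarrow> (\<exists>c. tri a b c \<and> tri q p c)"

text \<open>\<open>ps\<close> lists the labels of the strip's own line from the bottom up and ends
  with the entering label \<open>b\<close>; its head is the label that meets the next letter
  below.\<close>

fun strips :: "lab list \<Rightarrow> lab \<Rightarrow> (lab list \<times> lab list) set" where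
  "strips [] b = {([b], [])}"
| "strips (a # u) b = (\<lambda>((ps, qs), (p, q)). (p # ps, q # qs)) `
     (SIGMA x:strips u b. {(p, q). rhomb_ok a (hd (fst x)) p q})"

primrec puzzles :: "lab list \<Rightarrow> lab list \<Rightarrow> lab list \<Rightarrow> (lab list \<times> lab list) list set" where
  "puzzles u [] w = (if u = [] \<and> w = [] then {[]} else {})"
| "puzzles u (b # v) w = (case (u, w) of
      (a # u', c # w') \<Rightarrow> (\<lambda>(x, L). x # L) `
         (SIGMA x:{x \<in> strips u' b. tri a (hd (fst x)) c}. puzzles (snd x) v w')
    | _ \<Rightarrow> {})"

lemma finite_lab2: "finite (S :: (lab \<times> lab) set)"
  by (rule finite_subset[OF subset_UNIV finite_Prod_UNIV[OF finite_lab finite_lab]])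

lemma finite_strips: "finite (strips u b)"
  by (induction u) (auto intro!: finite_imageI finite_SigmaI finite_lab2)

lemma finite_puzzles: "finite (puzzles u v w)"
  by (induction v arbitrary: u w) (auto intro!: finite_imageI finite_SigmaI finite_strips split: list.splits)

lemma strips_length: "(ps, qs) \<in> strips u b \<Longrightarrow> length ps = Suc (length u) \<and> length qs = length u"
  by (induction u arbitrary: ps qs) auto

lemma cross_0: "cross (0 :: int) a m F = (\<Sum>(p, q)\<in>{(p, q). rhomb_ok a m p q}. F p q)"
proof -
  have "(\<Sum>(p, q)\<in>{(p, q). rhomb_ok a m p q}. F p q) = (\<Sum>(p, q)\<in>UNIV \<times> UNIV. if rhomb_ok a m p q then F p q else 0)"
    by (rule sum.mono_neutral_cong_left) (auto simp: finite_lab2 split: if_splits)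
  also have "\<dots> = (\<Sum>p\<in>UNIV. \<Sum>q\<in>UNIV. if rhomb_ok a m p q then F p q else 0)"
    by (rule sum.cartesian_product[symmetric])
  also have "\<dots> = cross 0 a m F"
    unfolding sum_lab_UNIV cross_def rhomb_def rhomb_ok_def
    by (rule arg_cong[where f = sum_lab], rule ext, rule arg_cong[where f = sum_lab], rule ext) auto
  finally show ?thesis by simp
qed

lemma strip_sum:
  "strip (0 :: int) (replicate (length u) 0) u b F = (\<Sum>(ps, qs)\<in>strips u b. F qs (hd ps))"
proof (induction u arbitrary: F)
  case (Cons a u)
  have "strip (0 :: int) (replicate (length (a # u)) 0) (a # u) b F =
     (\<Sum>(ps, qs)\<in>strips u b. \<Sum>(p, q)\<in>{(p, q). rhomb_ok a (hd ps) p q}. F (q # qs) p)"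
    by (simp add: Cons cross_0)
  also have "\<dots> = (\<Sum>x\<in>strips u b. \<Sum>y\<in>{(p, q). rhomb_ok a (hd (fst x)) p q}. F (snd y # snd x) (fst y))"
    by (simp add: case_prod_unfold)
  also have "\<dots> = (\<Sum>(x, y)\<in>(SIGMA x:strips u b. {(p, q). rhomb_ok a (hd (fst x)) p q}). F (snd y # snd x) (fst y))"
    by (rule sum.Sigma) (auto intro: finite_strips finite_lab2)
  also have "\<dots> = (\<Sum>(ps, qs)\<in>strips (a # u) b. F qs (hd ps))"
    unfolding strips.simps by (subst sum.reindex) (auto simp: inj_on_def case_prod_unfold intro!: sum.cong)
  finally show ?case .
qed simp

lemma card_puzzles:
  assumes "length v = length u" "length w = length u"
  shows "int (card (puzzles u v w)) = puz0 u v w"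
  using assms
proof (induction v arbitrary: u w)
  case (Cons b v)
  obtain a u' where u: "u = a # u'" "length v = length u'" using Cons.prems by (cases u) auto
  obtain c w' where w: "w = c # w'" "length w' = length u'" using Cons.prems u by (cases w) auto
  let ?S = "{x \<in> strips u' b. tri a (hd (fst x)) c}"
  have "int (card (puzzles u (b # v) w)) = int (card (SIGMA x:?S. puzzles (snd x) v w'))"
    by (simp add: u(1) w(1) card_image inj_on_def split_beta prod_eq_iff)
  also have "\<dots> = (\<Sum>x\<in>?S. int (card (puzzles (snd x) v w')))"
    using finite_strips finite_puzzles by simp
  also have "\<dots> = (\<Sum>x\<in>?S. puz (replicate (length u') 0) (snd x) v w')"
  proof (rule sum.cong[OF refl])
    fix x assume "x \<in> ?S"
    then have "length (snd x) = length u'" using strips_length[of "fst x" "snd x" u' b] by simp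
    then show "int (card (puzzles (snd x) v w')) = puz (replicate (length u') 0) (snd x) v w'"
      using Cons.IH[of "snd x" w'] u(2) w(2) by simp
  qed
  also have "\<dots> = (\<Sum>x\<in>strips u' b. of_bool (tri a (hd (fst x)) c) * puz (replicate (length u') 0) (snd x) v w')"
    by (rule sum.mono_neutral_cong_left) (auto intro: finite_strips)
  also have "\<dots> = puz0 u (b # v) w"
    using strip_sum[of u' b "\<lambda>qs p. of_bool (tri a p c) * puz (replicate (length u') 0) qs v w'"]
    by (simp add: u(1) w(1) case_prod_unfold)
  finally show ?case .
qed simp

text \<open>\<open>A j r\<close> and \<open>B j r\<close> stand for the left and right sides of the
  \<open>j\<close>-th upward triangle of row \<open>r\<close>, rows counted from the top; the
  reversals reflect that strips list labels upwards. The left side of a strip is stored with the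
  strip before it.\<close>

definition enc_strip :: "(nat \<Rightarrow> nat \<Rightarrow> lab) \<Rightarrow> (nat \<Rightarrow> nat \<Rightarrow> lab) \<Rightarrow> nat \<Rightarrow> nat \<Rightarrow> lab list \<times> lab list" where
  "enc_strip A B j k = (map (B j) (rev [j..<Suc k]), map (A (Suc j)) (rev [Suc j..<Suc k]))"

lemma strips_Cons_iff:
  "(p # ps, q # qs) \<in> strips (a # u) b \<longleftrightarrow> (ps, qs) \<in> strips u b \<and> rhomb_ok a (hd ps) p q"
proof
  assume "(p # ps, q # qs) \<in> strips (a # u) b"
  then show "(ps, qs) \<in> strips u b \<and> rhomb_ok a (hd ps) p q"
    unfolding strips.simps by (elim imageE) (auto split: prod.splits)
next
  assume "(ps, qs) \<in> strips u b \<and> rhomb_ok a (hd ps) p q"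
  then have "((ps, qs), (p, q)) \<in> (SIGMA x:strips u b. {(p, q). rhomb_ok a (hd (fst x)) p q})" by simp
  then show "(p # ps, q # qs) \<in> strips (a # u) b"
    unfolding strips.simps by (rule rev_image_eqI) simp
qed

lemma enc_strip_mem:
  assumes "j \<le> k"
  shows "enc_strip A B j k \<in> strips (map (A j) (rev [j..<k])) b \<longleftrightarrow>
    B j j = b \<and> (\<forall>r\<in>{j..<k}. rhomb_ok (A j r) (B j r) (B j (Suc r)) (A (Suc j) (Suc r)))"
  using assms
proof (induction k rule: dec_induct)
  case base
  show ?case by (auto simp: enc_strip_def)
next
  case (step k)
  have e: "enc_strip A B j (Suc k) = (B j (Suc k) # fst (enc_strip A B j k), A (Suc j) (Suc k) # snd (enc_strip A B j k))"
    using step.hyps by (simp add: enc_strip_def)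
  have h: "hd (fst (enc_strip A B j k)) = B j k"
    using step.hyps by (simp add: enc_strip_def)
  have u: "map (A j) (rev [j..<Suc k]) = A j k # map (A j) (rev [j..<k])" using step.hyps by simp
  have "enc_strip A B j (Suc k) \<in> strips (map (A j) (rev [j..<Suc k])) b \<longleftrightarrow>
     enc_strip A B j k \<in> strips (map (A j) (rev [j..<k])) b \<and> rhomb_ok (A j k) (B j k) (B j (Suc k)) (A (Suc j) (Suc k))"
    unfolding e u strips_Cons_iff prod.collapse h ..
  then show ?case using step.IH step.hyps by (auto simp: atLeastLessThanSuc)
qed

definition enc :: "(nat \<Rightarrow> nat \<Rightarrow> lab) \<Rightarrow> (nat \<Rightarrow> nat \<Rightarrow> lab) \<Rightarrow> nat \<Rightarrow> nat \<Rightarrow> (lab list \<times> lab list) list" where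
  "enc A B N j = map (\<lambda>j. enc_strip A B j N) [j..<Suc N]"

lemma enc_mem_from:
  assumes "1 \<le> j" "j \<le> Suc N" "length v = N" "length w = N"
  shows "enc A B N j \<in> puzzles (map (A j) (rev [j..<Suc N])) (drop (j - 1) v) (drop (j - 1) w) \<longleftrightarrow>
    (\<forall>i\<in>{j..N}. B i i = v ! (i - 1) \<and> tri (A i N) (B i N) (w ! (i - 1)) \<and>
       (\<forall>r\<in>{i..<N}. rhomb_ok (A i r) (B i r) (B i (Suc r)) (A (Suc i) (Suc r))))"
  using assms(2,1)
proof (induction j rule: inc_induct)
  case base
  then show ?case using assms(3,4) by (simp add: enc_def)
next
  case (step j)
  then have j: "1 \<le> j" "j \<le> N" by auto
  have v: "drop (j - 1) v = v ! (j - 1) # drop j v" using j assms(3) Cons_nth_drop_Suc[of "j - 1" v] by simp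
  have w: "drop (j - 1) w = w ! (j - 1) # drop j w" using j assms(4) Cons_nth_drop_Suc[of "j - 1" w] by simp
  have e: "enc A B N j = enc_strip A B j N # enc A B N (Suc j)"
    using j unfolding enc_def by (simp add: upt_conv_Cons del: upt_Suc)
  have u: "map (A j) (rev [j..<Suc N]) = A j N # map (A j) (rev [j..<N])"
    using j by simp
  have s: "snd (enc_strip A B j N) = map (A (Suc j)) (rev [Suc j..<Suc N])" by (simp add: enc_strip_def)
  have h: "hd (fst (enc_strip A B j N)) = B j N" using j by (simp add: enc_strip_def)
  have "enc A B N j \<in> puzzles (map (A j) (rev [j..<Suc N])) (drop (j - 1) v) (drop (j - 1) w) \<longleftrightarrow>
     enc_strip A B j N \<in> strips (map (A j) (rev [j..<N])) (v ! (j - 1)) \<and> tri (A j N) (B j N) (w ! (j - 1)) \<and>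
     enc A B N (Suc j) \<in> puzzles (map (A (Suc j)) (rev [Suc j..<Suc N])) (drop j v) (drop j w)"
    unfolding v w e u puzzles.simps by (auto simp: image_iff h s simp del: upt_Suc)
  also have "\<dots> \<longleftrightarrow> (\<forall>i\<in>{j..N}. B i i = v ! (i - 1) \<and> tri (A i N) (B i N) (w ! (i - 1)) \<and>
       (\<forall>r\<in>{i..<N}. rhomb_ok (A i r) (B i r) (B i (Suc r)) (A (Suc i) (Suc r))))"
  proof -
    have "{j..N} = insert j {Suc j..N}" using j by auto
    then show ?thesis using step.IH j unfolding enc_strip_mem[OF j(2)] by auto
  qed
  finally show ?case .
qed

text \<open>Membership becomes a family of conditions on single triangles and rhombi, which is the
  form that the vertices of the lattice provide.\<close>

lemma enc_mem:
  assumes "length u = N" "length v = N" "length w = N" "\<And>r. 1 \<le> r \<Longrightarrow> r \<le> N \<Longrightarrow> A 1 r = u ! (N - r)"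
  shows "enc A B N 1 \<in> puzzles u v w \<longleftrightarrow>
    (\<forall>i\<in>{1..N}. B i i = v ! (i - 1) \<and> tri (A i N) (B i N) (w ! (i - 1)) \<and>
       (\<forall>r\<in>{i..<N}. rhomb_ok (A i r) (B i r) (B i (Suc r)) (A (Suc i) (Suc r))))"
proof -
  have "map (A 1) (rev [1..<Suc N]) = u"
    using assms(1,4) by (intro nth_equalityI) (auto simp: rev_nth simp del: upt_Suc)
  then show ?thesis using enc_mem_from[of 1 N v w A B] assms by simp
qed

lemma puzzles_lengths:
  assumes "L \<in> puzzles u v w" "length v = length u"
  shows "length L = length v \<and> (\<forall>i<length L. length (fst (L ! i)) = length v - i \<and> length (snd (L ! i)) = length v - Suc i)"
  using assms
proof (induction v arbitrary: u w L)
  case (Cons b v)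
  obtain a u' where u: "u = a # u'" "length v = length u'" using Cons.prems by (cases u) auto
  obtain c w' where w: "w = c # w'" using Cons.prems u by (cases w) auto
  obtain x L' where L: "L = x # L'" "x \<in> strips u' b" "L' \<in> puzzles (snd x) v w'"
    using Cons.prems by (auto simp: u(1) w)
  have x: "length (fst x) = Suc (length u')" "length (snd x) = length u'"
    using strips_length[of "fst x" "snd x" u' b] L(2) by auto
  have IH: "length L' = length v \<and> (\<forall>i<length L'. length (fst (L' ! i)) = length v - i \<and> length (snd (L' ! i)) = length v - Suc i)"
    using Cons.IH[OF L(3)] x u by simp
  show ?case using IH x u(2) unfolding L(1) by (auto simp: nth_Cons split: nat.split)
qed (auto split: if_splits)

lemma decode:
  assumes L: "L \<in> puzzles u v w" and len: "length u = N" "length v = N" "length w = N"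
  obtains A B where "enc A B N 1 = L" "\<And>r. 1 \<le> r \<Longrightarrow> r \<le> N \<Longrightarrow> A 1 r = u ! (N - r)"
proof -
  \<comment> \<open>The left side of the puzzle is not part of \<open>L\<close> and comes from
    \<open>u\<close>. Column \<open>j\<close> is the right side of strip \<open>j - 1\<close>, which
    has list index \<open>j - 2\<close>.\<close>
  define A where "A j r = (if j = 1 then u ! (N - r) else snd (L ! (j - 2)) ! (N - r))" for j r
  define B where "B j r = fst (L ! (j - 1)) ! (N - r)" for j r
  have lens: "length L = N" "\<And>i. i < N \<Longrightarrow> length (fst (L ! i)) = N - i" "\<And>i. i < N \<Longrightarrow> length (snd (L ! i)) = N - Suc i"
    using puzzles_lengths[OF L] len by auto
  have rev_upt_nth: "rev [a..<Suc N] ! k = N - k" if "k < Suc N - a" for a k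
    using that by (simp add: rev_nth del: upt_Suc)
  have strip: "enc_strip A B (Suc i) N = L ! i" if i: "i < N" for i
  proof (rule prod_eqI)
    show "fst (enc_strip A B (Suc i) N) = fst (L ! i)"
      using i lens by (intro nth_equalityI) (auto simp: enc_strip_def rev_upt_nth B_def simp del: upt_Suc)
    show "snd (enc_strip A B (Suc i) N) = snd (L ! i)"
      using i lens by (intro nth_equalityI) (auto simp: enc_strip_def rev_upt_nth A_def simp del: upt_Suc)
  qed
  have "enc A B N 1 = L"
    using lens strip by (intro nth_equalityI) (auto simp: enc_def simp del: upt_Suc)
  then show ?thesis by (rule that) (simp add: A_def)
qed

section \<open>Binary words as label words\<close>

definition lab_word :: "nat list \<Rightarrow> lab list" where
  "lab_word u = map (\<lambda>x. if x = 0 then N0 else N1) u"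

lemma lab_word_simps [simp]:
  "lab_word [] = []" "lab_word (x # u) = (if x = 0 then N0 else N1) # lab_word u"
  "length (lab_word u) = length u" "bin (lab_word u)"
  by (auto simp: lab_word_def)

lemma count_lab_word_N0: "count_list (lab_word u) N0 = count_list u 0"
  by (induction u) auto

lemma count_lab_word_N1: "set u \<subseteq> {0, 1} \<Longrightarrow> count_list (lab_word u) N1 = count_list u 1"
  by (induction u) auto

lemma inv_lab_word:
  assumes "set u \<subseteq> {0, 1}"
  shows "inversions (lab_word u) = inv_d u"
  using assms
proof (induction u)
  case Nil
  then show ?case by (simp add: inv_d_def)
next
  case (Cons a u)
  let ?I = "\<lambda>u. {(i, j). i < j \<and> j < length u \<and> u ! i = 1 \<and> u ! j = (0::nat)}"
  have fin: "finite (?I u)"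
    by (rule finite_subset[of _ "{..<length u} \<times> {..<length u}"]) auto
  have "?I (a # u) = (\<lambda>(i, j). (Suc i, Suc j)) ` ?I u \<union> (\<lambda>j. (0, Suc j)) ` {j. j < length u \<and> a = 1 \<and> u ! j = 0}"
  proof (rule set_eqI)
    fix p :: "nat \<times> nat"
    obtain i j where p: "p = (i, j)" by (cases p)
    show "p \<in> ?I (a # u) \<longleftrightarrow> p \<in> (\<lambda>(i, j). (Suc i, Suc j)) ` ?I u \<union> (\<lambda>j. (0, Suc j)) ` {j. j < length u \<and> a = 1 \<and> u ! j = 0}"
      unfolding p by (cases i; cases j) (auto intro: rev_image_eqI)
  qed
  moreover have "card ((\<lambda>(i, j). (Suc i, Suc j)) ` ?I u) = card (?I u)"
    by (rule card_image) (auto simp: inj_on_def)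
  moreover have "card ((\<lambda>j. (0::nat, Suc j)) ` {j. j < length u \<and> a = 1 \<and> u ! j = 0}) = (if a = 1 then count_list u 0 else 0)"
  proof -
    have "card ((\<lambda>j. (0::nat, Suc j)) ` {j. j < length u \<and> a = 1 \<and> u ! j = 0}) = card {j. j < length u \<and> a = 1 \<and> u ! j = 0}"
      by (rule card_image) (auto simp: inj_on_def)
    moreover have "card {j. j < length u \<and> a = 1 \<and> u ! j = 0} = (if a = 1 then count_list u 0 else 0)"
    proof -
      have "count_list u 0 = length (filter (\<lambda>x. x = 0) u)" by (induction u) auto
      then show ?thesis by (auto simp: length_filter_conv_card)
    qed
    ultimately show ?thesis by (rule trans)
  qed
  moreover have "(\<lambda>(i, j). (Suc i, Suc j)) ` ?I u \<inter> (\<lambda>j. (0, Suc j)) ` {j. j < length u \<and> a = 1 \<and> u ! j = 0} = {}"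
    by auto
  ultimately have "inv_d (a # u) = inv_d u + (if a = 1 then count_list u 0 else 0)"
    unfolding inv_d_def using fin by (simp add: card_Un_disjoint)
  then show ?case using Cons by (auto simp: count_lab_word_N0)
qed

lemma pw_snoc_N0: "zero_parts c (w @ [N0]) = zero_parts c w @ [c + count_list w N1]" if "bin w"
  using that by (induction w arbitrary: c) auto

lemma pw_lab_word:
  assumes "set u \<subseteq> {0, 1}"
  shows "[count_list (take j u) 1. j \<leftarrow> [0..<length u], u ! j = 0] = zero_parts 0 (lab_word u)"
  using assms
proof (induction u rule: rev_induct)
  case (snoc x u)
  have "[count_list (take j (u @ [x])) 1. j \<leftarrow> [0..<length u], (u @ [x]) ! j = 0] =
     [count_list (take j u) 1. j \<leftarrow> [0..<length u], u ! j = 0]"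
    by (rule arg_cong[where f = concat], rule map_cong[OF refl]) (auto simp: nth_append)
  then have "[count_list (take j (u @ [x])) 1. j \<leftarrow> [0..<length (u @ [x])], (u @ [x]) ! j = 0] =
     zero_parts 0 (lab_word u) @ (if x = 0 then [count_list u 1] else [])"
    using snoc by simp
  moreover have "lab_word (u @ [x]) = lab_word u @ [if x = 0 then N0 else N1]" by (simp add: lab_word_def)
  ultimately show ?case
    using snoc.prems by (auto simp: pw_snoc_N0 pw_snoc_N1 count_lab_word_N1)
qed simp

lemma shape_lab_word:
  assumes "set u \<subseteq> {0, 1}"
  shows "shape (lab_word u) = lam u"
proof -
  have "sorted (filter (\<lambda>k. k \<noteq> 0) (zero_parts 0 (lab_word u)))"
    using sorted_pw[of 0 "lab_word u"] by (intro sorted_wrt_filter) simp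
  then show ?thesis unfolding lam_def shape_def pw_lab_word[OF assms] by (simp only: sorted_sort_id)
qed

section \<open>Local description of oriented TFPLs\<close>

definition arcs :: "nat \<Rightarrow> (vert \<times> vert) set \<Rightarrow> bool" where
  "arcs N D \<longleftrightarrow> D \<subseteq> {(p, q). p \<in> gverts N \<and> q \<in> gverts N \<and> adj p q} \<and> (\<forall>a b. (a, b) \<in> D \<longrightarrow> (b, a) \<notin> D)"

lemma arcsD:
  assumes "arcs N D" "(p, q) \<in> D"
  shows "p \<in> gverts N" "q \<in> gverts N" "adj p q" "(q, p) \<notin> D"
proof -
  have "D \<subseteq> {(p, q). p \<in> gverts N \<and> q \<in> gverts N \<and> adj p q}" and "\<forall>a b. (a, b) \<in> D \<longrightarrow> (b, a) \<notin> D"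
    using assms(1) unfolding arcs_def by blast+
  then show "p \<in> gverts N" "q \<in> gverts N" "adj p q" "(q, p) \<notin> D" using assms(2) by blast+
qed

lemma no_arc:
  assumes "arcs N D" "p \<notin> gverts N"
  shows "(p, q) \<notin> D" "(q, p) \<notin> D"
  using arcsD(1,2)[OF assms(1)] assms(2) by blast+

lemma adj_cases:
  assumes "adj a (x, r)"
  shows "a \<in> {(x - 1, r), (x + 1, r), (x, r - 1), (x, r + 1)}"
proof -
  obtain y s where a: "a = (y, s)" by (cases a)
  have "\<bar>y - x\<bar> + \<bar>s - r\<bar> = 1" using assms by (simp add: a adj_def)
  then have "(s = r \<and> (y = x - 1 \<or> y = x + 1)) \<or> (y = x \<and> (s = r - 1 \<or> s = r + 1))" by arith
  then show ?thesis unfolding a by auto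
qed

lemma adj_sym: "adj a b \<Longrightarrow> adj b a"
  by (simp add: adj_def abs_minus_commute)

lemma card_of_bool:
  assumes "finite S"
  shows "int (card {a \<in> S. Q a}) = (\<Sum>a\<in>S. of_bool (Q a))"
  using assms by (simp add: Int_def)

lemma indeg_eq:
  assumes "arcs N D"
  shows "int (indeg D (x, r)) = of_bool (((x - 1, r), (x, r)) \<in> D) + of_bool (((x + 1, r), (x, r)) \<in> D) +
    of_bool (((x, r - 1), (x, r)) \<in> D) + of_bool (((x, r + 1), (x, r)) \<in> D)"
proof -
  let ?S = "{(x - 1, r), (x + 1, r), (x, r - 1), (x, r + 1)}"
  have "{a. (a, (x, r)) \<in> D} = {a \<in> ?S. (a, (x, r)) \<in> D}"
    using arcsD(3)[OF assms] adj_cases[of _ x r] by blast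
  then show ?thesis unfolding indeg_def using card_of_bool[of ?S "\<lambda>a. (a, (x, r)) \<in> D"] by simp
qed

lemma outdeg_eq:
  assumes "arcs N D"
  shows "int (outdeg D (x, r)) = of_bool (((x, r), (x - 1, r)) \<in> D) + of_bool (((x, r), (x + 1, r)) \<in> D) +
    of_bool (((x, r), (x, r - 1)) \<in> D) + of_bool (((x, r), (x, r + 1)) \<in> D)"
proof -
  let ?S = "{(x - 1, r), (x + 1, r), (x, r - 1), (x, r + 1)}"
  have "{a. ((x, r), a) \<in> D} = {a \<in> ?S. ((x, r), a) \<in> D}"
    using adj_sym[OF arcsD(3)[OF assms]] adj_cases[of _ x r] by blast
  then show ?thesis unfolding outdeg_def using card_of_bool[of ?S "\<lambda>a. ((x, r), a) \<in> D"] by simp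
qed

lemma finite_gverts: "finite (gverts N)"
  by (rule finite_subset[of _ "{- int N..int N} \<times> {1..int N}"]) (auto simp: gverts_def)

lemma finite_nbrs:
  assumes "arcs N D"
  shows "finite {a. (a, p) \<in> D}" "finite {a. (p, a) \<in> D}"
  by (rule finite_subset[OF _ finite_gverts[of N]]; use arcsD[OF assms] in blast)+

lemma adj_irrefl: "\<not> adj p p"
  by (simp add: adj_def)

lemma deg_eq:
  assumes "arcs N D"
  shows "deg (undir D) p = indeg D p + outdeg D p"
proof -
  have ne: "a \<noteq> b" if "(a, b) \<in> D" for a b using that by (metis adj_irrefl arcsD(3)[OF assms])
  have "{e \<in> undir D. p \<in> e} = (\<lambda>a. {a, p}) ` {a. (a, p) \<in> D} \<union> (\<lambda>a. {a, p}) ` {a. (p, a) \<in> D}"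
  proof (intro equalityI subsetI)
    fix e assume "e \<in> {e \<in> undir D. p \<in> e}"
    then obtain a b where "e = {a, b}" "(a, b) \<in> D" "p = a \<or> p = b" unfolding undir_def by blast
    then show "e \<in> (\<lambda>a. {a, p}) ` {a. (a, p) \<in> D} \<union> (\<lambda>a. {a, p}) ` {a. (p, a) \<in> D}"
      by (metis (mono_tags, lifting) UnI1 UnI2 image_eqI insert_commute mem_Collect_eq)
  next
    fix e assume "e \<in> (\<lambda>a. {a, p}) ` {a. (a, p) \<in> D} \<union> (\<lambda>a. {a, p}) ` {a. (p, a) \<in> D}"
    then obtain a where "e = {a, p}" "(a, p) \<in> D \<or> (p, a) \<in> D" by blast
    then show "e \<in> {e \<in> undir D. p \<in> e}" unfolding undir_def by blast
  qed
  moreover have "inj_on (\<lambda>a. {a, p}) S" for S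
    by (auto simp: inj_on_def doubleton_eq_iff)
  moreover have "(\<lambda>a. {a, p}) ` {a. (a, p) \<in> D} \<inter> (\<lambda>a. {a, p}) ` {a. (p, a) \<in> D} = {}"
  proof (rule equals0I)
    fix e assume "e \<in> (\<lambda>a. {a, p}) ` {a. (a, p) \<in> D} \<inter> (\<lambda>a. {a, p}) ` {a. (p, a) \<in> D}"
    then obtain a b where "e = {a, p}" "(a, p) \<in> D" "e = {b, p}" "(p, b) \<in> D" by blast
    moreover from this have "a = b" by (metis doubleton_eq_iff)
    ultimately show False using arcsD(4)[OF assms] by blast
  qed
  ultimately show ?thesis
    unfolding deg_def indeg_def outdeg_def using finite_nbrs[OF assms, of p]
    by (simp add: card_Un_disjoint card_image)
qed

text \<open>The i-th vertex of row r, counted from 0. The odd vertices are those with i even.\<close>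

definition pt :: "nat \<Rightarrow> nat \<Rightarrow> vert" where
  "pt i r = (int i - int r, int r)"

lemma pt_inj: "pt i r = pt j s \<longleftrightarrow> i = j \<and> r = s"
  by (auto simp: pt_def)

lemma pt_gverts: "pt i r \<in> gverts N \<longleftrightarrow> 1 \<le> r \<and> r \<le> N \<and> i \<le> 2 * r"
  by (auto simp: pt_def gverts_def)

lemma gverts_pt: "p \<in> gverts N \<Longrightarrow> \<exists>i r. p = pt i r \<and> 1 \<le> r \<and> r \<le> N \<and> i \<le> 2 * r"
proof -
  assume p: "p \<in> gverts N"
  obtain x s where xs: "p = (x, s)" by (cases p)
  have "1 \<le> s" "s \<le> int N" "-s \<le> x" "x \<le> s" using p by (auto simp: gverts_def xs)
  then show ?thesis
    by (intro exI[of _ "nat (x + s)"] exI[of _ "nat s"]) (auto simp: xs pt_def)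
qed

text \<open>The colour (1, 0) means an edge from an odd to an even vertex, (0, 1) one in the opposite direction.\<close>

definition hcol :: "(vert \<times> vert) set \<Rightarrow> nat \<Rightarrow> nat \<Rightarrow> int \<times> int" where
  "hcol D i r = (if even i then (of_bool ((pt i r, pt (Suc i) r) \<in> D), of_bool ((pt (Suc i) r, pt i r) \<in> D))
     else (of_bool ((pt (Suc i) r, pt i r) \<in> D), of_bool ((pt i r, pt (Suc i) r) \<in> D)))"

definition vcol :: "(vert \<times> vert) set \<Rightarrow> nat \<Rightarrow> nat \<Rightarrow> int \<times> int" where
  "vcol D i r = (if even i then (of_bool ((pt i r, pt (Suc i) (Suc r)) \<in> D), of_bool ((pt (Suc i) (Suc r), pt i r) \<in> D))
     else (of_bool ((pt (Suc i) (Suc r), pt i r) \<in> D), of_bool ((pt i r, pt (Suc i) (Suc r)) \<in> D)))"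

definition hleft :: "(vert \<times> vert) set \<Rightarrow> nat \<Rightarrow> nat \<Rightarrow> int \<times> int" where
  "hleft D i r = (if i = 0 then (0, 0) else hcol D (i - 1) r)"

definition vup :: "(vert \<times> vert) set \<Rightarrow> nat \<Rightarrow> nat \<Rightarrow> int \<times> int" where
  "vup D i r = (if i = 0 then (0, 0) else vcol D (i - 1) (r - 1))"

fun add4 :: "int \<times> int \<Rightarrow> int \<times> int \<Rightarrow> int \<times> int \<Rightarrow> int \<times> int \<Rightarrow> int \<times> int" where
  "add4 (a, a') (b, b') (c, c') (d, d') = (a + b + c + d, a' + b' + c' + d')"

text \<open>The first component collects arcs leaving an odd or entering an even vertex, so an edge
  has the same colour seen from either end, and one arc in and one out always gives (1, 1).\<close>

lemma vertex_sum:
  assumes D: "arcs N D" and r: "1 \<le> r"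
  shows "add4 (hleft D i r) (hcol D i r) (vup D i r) (vcol D i r) =
    (if even i then (int (outdeg D (pt i r)), int (indeg D (pt i r))) else (int (indeg D (pt i r)), int (outdeg D (pt i r))))"
proof -
  let ?x = "int i - int r"
  have R: "pt (Suc i) r = (?x + 1, int r)" and B: "pt (Suc i) (Suc r) = (?x, int r + 1)" and p: "pt i r = (?x, int r)"
    by (simp_all add: pt_def)
  show ?thesis
  proof (cases "i = 0")
    case True
    have "(?x - 1, int r) \<notin> gverts N" "(?x, int r - 1) \<notin> gverts N" using True by (auto simp: gverts_def)
    then have "((?x - 1, int r), (?x, int r)) \<notin> D" "((?x, int r), (?x - 1, int r)) \<notin> D"
      "((?x, int r - 1), (?x, int r)) \<notin> D" "((?x, int r), (?x, int r - 1)) \<notin> D"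
      using arcsD(1,2)[OF D] by blast+
    then show ?thesis
      unfolding p indeg_eq[OF D] outdeg_eq[OF D] hcol_def vcol_def hleft_def vup_def R B using True
      by (simp add: p)
  next
    case False
    then obtain k where k: "i = Suc k" by (cases i) auto
    obtain s where s: "r = Suc s" using r by (cases r) auto
    have L: "pt k r = (?x - 1, int r)" and U: "pt k s = (?x, int r - 1)"
      by (simp_all add: pt_def k s)
    have "hleft D i r = hcol D k r" "vup D i r = vcol D k s" by (simp_all add: hleft_def vup_def k s)
    then show ?thesis
      unfolding p indeg_eq[OF D] outdeg_eq[OF D] hcol_def vcol_def R B s[symmetric] L U k[symmetric]
      by (simp add: k)
  qed
qed

text \<open>A virtual edge below each even vertex of the bottom row, which completes its degree to 2.\<close>

definition virt :: "nat list \<Rightarrow> nat \<Rightarrow> int \<times> int" where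
  "virt w i = (if even i then (0, 0) else if w ! (i div 2) = 0 then (1, 0) else (0, 1))"

definition vdown :: "nat \<Rightarrow> nat list \<Rightarrow> (vert \<times> vert) set \<Rightarrow> nat \<Rightarrow> nat \<Rightarrow> int \<times> int" where
  "vdown N w D i r = (if r = N then virt w i else vcol D i r)"

text \<open>In row 1 the edge upwards would start in row 0, outside the graph, so its colour is (0,
  0).\<close>

definition locally_ok :: "nat \<Rightarrow> (vert \<times> vert) set \<Rightarrow> nat list \<Rightarrow> nat list \<Rightarrow> nat list \<Rightarrow> bool" where
  "locally_ok N D u v w \<longleftrightarrow> arcs N D \<and>
     (\<forall>r\<in>{1..N}. \<forall>i\<in>{0<..<2 * r}. add4 (hcol D (i - 1) r) (hcol D i r) (vcol D (i - 1) (r - 1)) (vdown N w D i r) = (1, 1)) \<and>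
     (\<forall>r\<in>{1..N}. add4 (0, 0) (hcol D 0 r) (0, 0) (vdown N w D 0 r) = (int (u ! (N - r)), 0)) \<and>
     (\<forall>r\<in>{1..N}. add4 (hcol D (2 * r - 1) r) (0, 0) (0, 0) (vdown N w D (2 * r) r) = (0, 1 - int (v ! (r - 1))))"

lemma vcol_bottom: "arcs N D \<Longrightarrow> vcol D i N = (0, 0)"
  by (simp add: vcol_def no_arc pt_gverts)

lemma hcol_end: "arcs N D \<Longrightarrow> hcol D (2 * r) r = (0, 0)"
  by (simp add: hcol_def no_arc pt_gverts)

lemma vcol_end:
  assumes "arcs N D" "1 \<le> r"
  shows "vcol D (2 * r - 1) (r - 1) = (0, 0)"
proof -
  have "pt (2 * r - 1) (r - 1) \<notin> gverts N" unfolding pt_gverts using assms(2) by linarith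
  from no_arc[OF assms(1) this] show ?thesis using assms(2) by (simp add: vcol_def)
qed

lemma Lv_pt: "i \<in> {1..N} \<Longrightarrow> Lv N i = pt 0 (N + 1 - i)"
  by (auto simp: Lv_def pt_def)

lemma Rv_pt: "Rv N i = pt (2 * i) i"
  by (auto simp: Rv_def pt_def)

lemma Bv_pt: "i \<in> {1..N} \<Longrightarrow> Bv N i = pt (2 * i - 1) N"
  by (auto simp: Bv_def pt_def)

lemma boundary_pt:
  assumes "1 \<le> r" "r \<le> N" "i \<le> 2 * r"
  shows "pt i r \<in> Lv N ` {1..N} \<union> Rv N ` {1..N} \<union> Bv N ` {1..N} \<longleftrightarrow> i = 0 \<or> i = 2 * r \<or> (odd i \<and> r = N)"
proof
  assume "pt i r \<in> Lv N ` {1..N} \<union> Rv N ` {1..N} \<union> Bv N ` {1..N}"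
  then show "i = 0 \<or> i = 2 * r \<or> (odd i \<and> r = N)"
    by (auto simp: Lv_pt Rv_pt Bv_pt pt_inj)
next
  assume "i = 0 \<or> i = 2 * r \<or> (odd i \<and> r = N)"
  then consider "i = 0" | "i = 2 * r" | "odd i" "r = N" by blast
  then show "pt i r \<in> Lv N ` {1..N} \<union> Rv N ` {1..N} \<union> Bv N ` {1..N}"
  proof cases
    case 1
    have m: "N + 1 - r \<in> {1..N}" using assms by auto
    have "N + 1 - (N + 1 - r) = r" using assms by simp
    then have "pt i r = Lv N (N + 1 - r)" using 1 unfolding Lv_pt[OF m] by simp
    then show ?thesis using m by blast
  next
    case 2
    then have "pt i r = Rv N r" by (simp add: Rv_pt)
    then show ?thesis using assms by auto
  next
    case 3
    then obtain k where k: "i = 2 * k + 1" by (elim oddE)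
    then have "pt i r = Bv N (Suc k)" using assms 3 Bv_pt[of "Suc k" N] by simp
    then show ?thesis using assms k 3 by auto
  qed
qed

lemma tfpl_arcs:
  assumes "is_oriented_tfpl N D"
  shows "arcs N D"
proof -
  have sub: "undir D \<subseteq> gedges N" and anti: "\<And>a b. (a, b) \<in> D \<Longrightarrow> (b, a) \<notin> D"
    using assms unfolding is_oriented_tfpl_def is_tfpl_def by blast+
  have "p \<in> gverts N \<and> q \<in> gverts N \<and> adj p q" if "(p, q) \<in> D" for p q
  proof -
    have "{p, q} \<in> undir D" using that unfolding undir_def by blast
    then obtain a b where "{p, q} = {a, b}" "a \<in> gverts N" "b \<in> gverts N" "adj a b"
      using sub unfolding gedges_def by blast
    then show ?thesis using adj_sym[of a b] by (auto simp: doubleton_eq_iff)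
  qed
  then show ?thesis unfolding arcs_def using anti by blast
qed

lemma row_index:
  fixes r N :: nat
  assumes "r \<in> {1..N}"
  shows "N - r + 1 \<in> {1..N}" "N + 1 - (N - r + 1) = r" "N - r + 1 - 1 = N - r"
  using assms by auto

lemma virt_even: "even i \<Longrightarrow> virt w i = (0, 0)"
  by (simp add: virt_def)

lemma tfpl_locally_ok:
  assumes T: "is_oriented_tfpl N D" and H: "has_boundary N D u v w"
    and u: "set u \<subseteq> {0, 1}" "length u = N" and v: "set v \<subseteq> {0, 1}" "length v = N" and w: "length w = N"
  shows "locally_ok N D u v w"
proof -
  note A = tfpl_arcs[OF T]
  note V = vertex_sum[OF A]
  have tf: "is_tfpl N (undir D)" and two: "\<And>p. p \<in> gverts N \<Longrightarrow> deg (undir D) p = 2 \<Longrightarrow> indeg D p = 1 \<and> outdeg D p = 1"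
    and L0: "\<And>i. i \<in> {1..N} \<Longrightarrow> indeg D (Lv N i) = 0" and R0: "\<And>i. i \<in> {1..N} \<Longrightarrow> outdeg D (Rv N i) = 0"
    using T unfolding is_oriented_tfpl_def by blast+
  have L1: "\<And>i. i \<in> {1..N} \<Longrightarrow> deg (undir D) (Lv N i) \<le> 1" and R1: "\<And>i. i \<in> {1..N} \<Longrightarrow> deg (undir D) (Rv N i) \<le> 1"
    and B1: "\<And>i. i \<in> {1..N} \<Longrightarrow> deg (undir D) (Bv N i) = 1"
    and I: "\<And>p. p \<in> gverts N \<Longrightarrow> p \<notin> Lv N ` {1..N} \<union> Rv N ` {1..N} \<union> Bv N ` {1..N} \<Longrightarrow> deg (undir D) p = 2"
    using tf unfolding is_tfpl_def by blast+
  have hu: "\<And>i. i \<in> {1..N} \<Longrightarrow> u ! (i - 1) = 1 \<longleftrightarrow> deg (undir D) (Lv N i) = 1"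
    and hv: "\<And>i. i \<in> {1..N} \<Longrightarrow> v ! (i - 1) = 0 \<longleftrightarrow> deg (undir D) (Rv N i) = 1"
    and hw1: "\<And>i. i \<in> {1..N} \<Longrightarrow> indeg D (Bv N i) = 1 \<Longrightarrow> w ! (i - 1) = 1"
    and hw0: "\<And>i. i \<in> {1..N} \<Longrightarrow> outdeg D (Bv N i) = 1 \<Longrightarrow> w ! (i - 1) = 0"
    using H unfolding has_boundary_def by blast+
  have vd0: "vdown N w D i r = vcol D i r" if "even i \<or> r \<noteq> N" for i r
    using that vcol_bottom[OF A] by (auto simp: vdown_def virt_even)
  have interior: "add4 (hcol D (i - 1) r) (hcol D i r) (vcol D (i - 1) (r - 1)) (vdown N w D i r) = (1, 1)"
    if r: "r \<in> {1..N}" and i: "i \<in> {0<..<2 * r}" for r i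
  proof -
    have hl: "hleft D i r = hcol D (i - 1) r" "vup D i r = vcol D (i - 1) (r - 1)"
      using i by (auto simp: hleft_def vup_def)
    have s: "add4 (hcol D (i - 1) r) (hcol D i r) (vcol D (i - 1) (r - 1)) (vcol D i r) =
        (if even i then (int (outdeg D (pt i r)), int (indeg D (pt i r))) else (int (indeg D (pt i r)), int (outdeg D (pt i r))))"
      using V[of r i] r hl by simp
    have g: "pt i r \<in> gverts N" using r i by (simp add: pt_gverts)
    show ?thesis
    proof (cases "odd i \<and> r = N")
      case False
      then have "pt i r \<notin> Lv N ` {1..N} \<union> Rv N ` {1..N} \<union> Bv N ` {1..N}"
        using boundary_pt[of r N i] r i by auto
      then have "indeg D (pt i r) = 1 \<and> outdeg D (pt i r) = 1" using two[OF g] I[OF g] by blast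
      then show ?thesis using s vd0[of i r] False by auto
    next
      case True
      then obtain k where k: "i = 2 * k + 1" by (elim conjE oddE)
      have kN: "k < N" using i True k by auto
      then have B: "pt i r = Bv N (Suc k)" and kk: "Suc k \<in> {1..N}" using Bv_pt[of "Suc k" N] True k by auto
      have sum: "indeg D (pt i r) + outdeg D (pt i r) = 1" using B1[OF kk] deg_eq[OF A] B by simp
      have vz: "vcol D i r = (0, 0)" using True vcol_bottom[OF A] by simp
      \<comment> \<open>The virtual edge supplies the colour missing at a vertex of degree 1: it
        counts as incoming when the real arc goes out.\<close>
      have vi: "vdown N w D i r = (if w ! k = 0 then (1, 0) else (0, 1))" using True k by (simp add: vdown_def virt_def)
      obtain a a' b b' c c' where e: "hcol D (i - 1) r = (a, a')" "hcol D i r = (b, b')" "vcol D (i - 1) (r - 1) = (c, c')"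
        by (metis surj_pair)
      consider "indeg D (pt i r) = 1" "outdeg D (pt i r) = 0" | "indeg D (pt i r) = 0" "outdeg D (pt i r) = 1"
        using sum by linarith
      then show ?thesis
      proof cases
        case 1
        then have "w ! k = 1" using hw1[OF kk] B by simp
        then show ?thesis using s 1 True unfolding vi vz e by simp
      next
        case 2
        then have "w ! k = 0" using hw0[OF kk] B by simp
        then show ?thesis using s 2 True unfolding vi vz e by simp
      qed
    qed
  qed
  have left: "add4 (0, 0) (hcol D 0 r) (0, 0) (vdown N w D 0 r) = (int (u ! (N - r)), 0)" if r: "r \<in> {1..N}" for r
  proof -
    note q = row_index[OF r]
    have Lp: "Lv N (N - r + 1) = pt 0 r" using Lv_pt[OF q(1)] q(2) by simp
    have "N - r < length u" using u r by auto
    then have "u ! (N - r) \<in> {0, 1}" using u(1) nth_mem by blast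
    then have "outdeg D (pt 0 r) = u ! (N - r)"
      using hu[OF q(1)] L1[OF q(1)] L0[OF q(1)] deg_eq[OF A, of "pt 0 r"] unfolding Lp q(3) by auto
    then show ?thesis using V[of r 0] r L0[OF q(1)] vd0[of 0 r] unfolding Lp by (simp add: hleft_def vup_def)
  qed
  have right: "add4 (hcol D (2 * r - 1) r) (0, 0) (0, 0) (vdown N w D (2 * r) r) = (0, 1 - int (v ! (r - 1)))"
    if r: "r \<in> {1..N}" for r
  proof -
    have "r - 1 < length v" using v r by auto
    then have "v ! (r - 1) \<in> {0, 1}" using v(1) nth_mem by blast
    then have "int (indeg D (pt (2 * r) r)) = 1 - int (v ! (r - 1))"
      using hv[OF r] R1[OF r] R0[OF r] deg_eq[OF A, of "pt (2 * r) r"] unfolding Rv_pt by auto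
    moreover have "hleft D (2 * r) r = hcol D (2 * r - 1) r" "vup D (2 * r) r = vcol D (2 * r - 1) (r - 1)"
      using r by (auto simp: hleft_def vup_def)
    ultimately show ?thesis
      using V[of r "2 * r"] r R0[OF r] vd0[of "2 * r" r] hcol_end[OF A, of r] vcol_end[OF A, of r] unfolding Rv_pt by simp
  qed
  show ?thesis unfolding locally_ok_def using A interior left right by blast
qed

text \<open>As predecessors are unique, a step against an arc only retraces the directed path from
  \<open>s\<close>, and at \<open>s\<close> itself no such step exists.\<close>

lemma reach_from_source:
  assumes uniq: "\<And>a b p. (a, p) \<in> D \<Longrightarrow> (b, p) \<in> D \<Longrightarrow> a = b" and src: "\<And>a. (a, s) \<notin> D"
    and path: "(s, q) \<in> {(a, b). (a, b) \<in> D \<or> (b, a) \<in> D}\<^sup>*"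
  shows "(s, q) \<in> D\<^sup>*"
  using path
proof (induction rule: rtrancl_induct)
  case (step q q')
  show ?case
  proof (cases "(q, q') \<in> D")
    case True
    with step.IH show ?thesis by (rule rtrancl_into_rtrancl)
  next
    case False
    then have "(q', q) \<in> D" using step.hyps by blast
    moreover have "q \<noteq> s" using \<open>(q', q) \<in> D\<close> src by blast
    with step.IH obtain p where "(s, p) \<in> D\<^sup>*" "(p, q) \<in> D"
      by (cases rule: rtranclE) blast+
    ultimately show ?thesis using uniq by blast
  qed
qed simp

text \<open>This makes the conditions on paths in a TFPL automatic for oriented configurations.\<close>

lemma sources_not_joined:
  assumes uniq: "\<And>a b p. (a, p) \<in> D \<Longrightarrow> (b, p) \<in> D \<Longrightarrow> a = b"
    and src: "\<And>a. (a, s) \<notin> D" "\<And>a. (a, t) \<notin> D" and path: "(s, t) \<in> {(a, b). (a, b) \<in> D \<or> (b, a) \<in> D}\<^sup>*"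
  shows "s = t"
proof -
  have "(s, t) \<in> D\<^sup>*"
  proof (rule reach_from_source[OF _ src(1) path])
    fix a b p assume "(a, p) \<in> D" "(b, p) \<in> D"
    then show "a = b" by (rule uniq)
  qed
  then show ?thesis
    by (cases rule: rtranclE) (use src(2) in auto)
qed

lemma undir_iff: "{a, b} \<in> undir D \<longleftrightarrow> (a, b) \<in> D \<or> (b, a) \<in> D"
proof
  assume "{a, b} \<in> undir D"
  then obtain x y where "{a, b} = {x, y}" "(x, y) \<in> D" unfolding undir_def by blast
  then show "(a, b) \<in> D \<or> (b, a) \<in> D" by (metis doubleton_eq_iff)
next
  assume "(a, b) \<in> D \<or> (b, a) \<in> D"
  then show "{a, b} \<in> undir D" unfolding undir_def by blast
qed

lemma locally_ok_tfpl:
  assumes ok: "locally_ok N D u v w"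
    and u: "set u \<subseteq> {0, 1}" "length u = N" and v: "set v \<subseteq> {0, 1}" "length v = N"
    and w: "set w \<subseteq> {0, 1}" "length w = N"
  shows "is_oriented_tfpl N D" "has_boundary N D u v w"
proof -
  have A: "arcs N D"
    and inr: "\<And>r i. r \<in> {1..N} \<Longrightarrow> i \<in> {0<..<2 * r} \<Longrightarrow>
      add4 (hcol D (i - 1) r) (hcol D i r) (vcol D (i - 1) (r - 1)) (vdown N w D i r) = (1, 1)"
    and lft: "\<And>r. r \<in> {1..N} \<Longrightarrow> add4 (0, 0) (hcol D 0 r) (0, 0) (vdown N w D 0 r) = (int (u ! (N - r)), 0)"
    and rgt: "\<And>r. r \<in> {1..N} \<Longrightarrow>
      add4 (hcol D (2 * r - 1) r) (0, 0) (0, 0) (vdown N w D (2 * r) r) = (0, 1 - int (v ! (r - 1)))"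
    using ok unfolding locally_ok_def by blast+
  note V = vertex_sum[OF A]
  have vd0: "vdown N w D i r = vcol D i r" if "even i \<or> r \<noteq> N" for i r
    using that vcol_bottom[OF A] by (auto simp: vdown_def virt_even)
  have I: "indeg D (pt i r) = 1" "outdeg D (pt i r) = 1"
    if "r \<in> {1..N}" "i \<in> {0<..<2 * r}" "\<not> (odd i \<and> r = N)" for i r
  proof -
    have "hleft D i r = hcol D (i - 1) r" "vup D i r = vcol D (i - 1) (r - 1)"
      using that by (auto simp: hleft_def vup_def)
    then have "(if even i then (int (outdeg D (pt i r)), int (indeg D (pt i r))) else (int (indeg D (pt i r)), int (outdeg D (pt i r)))) = (1, 1)"
      using V[of r i] inr[OF that(1,2)] vd0[of i r] that by auto
    then show "indeg D (pt i r) = 1" "outdeg D (pt i r) = 1" by (auto split: if_splits)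
  qed
  have B: "indeg D (Bv N j) = w ! (j - 1)" "outdeg D (Bv N j) = 1 - w ! (j - 1)" "w ! (j - 1) \<in> {0, 1}"
    if j: "j \<in> {1..N}" for j
  proof -
    define i where "i = 2 * j - 1"
    have i: "i \<in> {0<..<2 * N}" "odd i" "i div 2 = j - 1" "N \<in> {1..N}" using j by (auto simp: i_def)
    have "j - 1 < length w" using j w by auto
    then show wj: "w ! (j - 1) \<in> {0, 1}" using w(1) nth_mem by blast
    have hl: "hleft D i N = hcol D (i - 1) N" "vup D i N = vcol D (i - 1) (N - 1)"
      using i by (auto simp: hleft_def vup_def)
    obtain a a' b b' c c' where e: "hcol D (i - 1) N = (a, a')" "hcol D i N = (b, b')" "vcol D (i - 1) (N - 1) = (c, c')"
      by (metis surj_pair)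
    have "vdown N w D i N = (if w ! (j - 1) = 0 then (1, 0) else (0, 1))" using i by (simp add: vdown_def virt_def)
    then have "(int (indeg D (pt i N)), int (outdeg D (pt i N))) = (if w ! (j - 1) = 0 then (0, 1) else (1, 0))"
      using V[of N i] inr[OF i(4,1)] vcol_bottom[OF A, of i] i unfolding hl e by auto
    then show "indeg D (Bv N j) = w ! (j - 1)" "outdeg D (Bv N j) = 1 - w ! (j - 1)"
      unfolding Bv_pt[OF j] using wj by (auto simp: i_def split: if_splits)
  qed
  have L: "indeg D (Lv N j) = 0" "outdeg D (Lv N j) = u ! (j - 1)" "u ! (j - 1) \<in> {0, 1}" if j: "j \<in> {1..N}" for j
  proof -
    have r: "N + 1 - j \<in> {1..N}" "N - (N + 1 - j) = j - 1" using j by auto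
    have "j - 1 < length u" using j u by auto
    then show "u ! (j - 1) \<in> {0, 1}" using u(1) nth_mem by blast
    show "indeg D (Lv N j) = 0" "outdeg D (Lv N j) = u ! (j - 1)"
      using V[of "N + 1 - j" 0] r(1) lft[OF r(1)] vd0[of 0 "N + 1 - j"] unfolding Lv_pt[OF j] r(2)
      by (auto simp: hleft_def vup_def)
  qed
  have R: "outdeg D (Rv N j) = 0" "indeg D (Rv N j) = 1 - v ! (j - 1)" "v ! (j - 1) \<in> {0, 1}" if j: "j \<in> {1..N}" for j
  proof -
    have "j - 1 < length v" using j v by auto
    then show vj: "v ! (j - 1) \<in> {0, 1}" using v(1) nth_mem by blast
    have "hleft D (2 * j) j = hcol D (2 * j - 1) j" "vup D (2 * j) j = vcol D (2 * j - 1) (j - 1)"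
      using j by (auto simp: hleft_def vup_def)
    then show "outdeg D (Rv N j) = 0" "indeg D (Rv N j) = 1 - v ! (j - 1)"
      using V[of j "2 * j"] rgt[OF j] vd0[of "2 * j" j] hcol_end[OF A, of j] vcol_end[OF A, of j] j vj unfolding Rv_pt by auto
  qed
  have vclass: "(\<exists>r\<in>{1..N}. \<exists>i\<in>{0<..<2 * r}. p = pt i r \<and> \<not> (odd i \<and> r = N)) \<or> p \<in> Lv N ` {1..N} \<union> Rv N ` {1..N} \<union> Bv N ` {1..N}"
    if "p \<in> gverts N" for p
  proof -
    from gverts_pt[OF \<open>p \<in> gverts N\<close>]
    obtain i r where p: "p = pt i r" "1 \<le> r" "r \<le> N" "i \<le> 2 * r" by blast
    show ?thesis
    proof (cases "i = 0 \<or> i = 2 * r \<or> (odd i \<and> r = N)")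
      case True
      then show ?thesis using boundary_pt[OF p(2-4)] p(1) by blast
    next
      case False
      then have "r \<in> {1..N}" "i \<in> {0<..<2 * r}" using p by auto
      then show ?thesis using False p(1) by blast
    qed
  qed
  have deg_le: "indeg D p \<le> 1 \<and> outdeg D p \<le> 1" for p
  proof (cases "p \<in> gverts N")
    case True
    from vclass[OF True] consider r i where "r \<in> {1..N}" "i \<in> {0<..<2 * r}" "p = pt i r" "\<not> (odd i \<and> r = N)"
      | j where "j \<in> {1..N}" "p = Lv N j" | j where "j \<in> {1..N}" "p = Rv N j" | j where "j \<in> {1..N}" "p = Bv N j"
      by blast
    then show ?thesis
    proof cases
      case 1 then show ?thesis using I[of r i] by simp
    next
      case 2 then show ?thesis using L[of j] by auto
    next
      case 3 then show ?thesis using R[of j] by auto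
    next
      case 4 then show ?thesis using B[of j] by auto
    qed
  next
    case False
    then have e: "{a. (a, p) \<in> D} = {}" "{a. (p, a) \<in> D} = {}" using no_arc[OF A False] by blast+
    show ?thesis unfolding indeg_def outdeg_def e by simp
  qed
  have uniq: "a = b" if "(a, p) \<in> D" "(b, p) \<in> D" for a b p
  proof -
    have "card {a. (a, p) \<in> D} \<le> Suc 0" using deg_le[of p] by (simp add: indeg_def)
    then show ?thesis using card_le_Suc0_iff_eq[OF finite_nbrs(1)[OF A, of p]] that by blast
  qed
  have uniq': "a = b" if "(p, a) \<in> D" "(p, b) \<in> D" for a b p
  proof -
    have "card {a. (p, a) \<in> D} \<le> Suc 0" using deg_le[of p] by (simp add: outdeg_def)
    then show ?thesis using card_le_Suc0_iff_eq[OF finite_nbrs(2)[OF A, of p]] that by blast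
  qed
  have Lsrc: "(a, Lv N j) \<notin> D" if "j \<in> {1..N}" for a j
  proof -
    have "{a. (a, Lv N j) \<in> D} = {}" using L(1)[OF that] finite_nbrs(1)[OF A, of "Lv N j"] unfolding indeg_def by simp
    then show ?thesis by blast
  qed
  have Rsnk: "(Rv N j, a) \<notin> D" if "j \<in> {1..N}" for a j
  proof -
    have "{a. (Rv N j, a) \<in> D} = {}" using R(1)[OF that] finite_nbrs(2)[OF A, of "Rv N j"] unfolding outdeg_def by simp
    then show ?thesis by blast
  qed
  have Linj: "i = j" if "Lv N i = Lv N j" "i \<in> {1..N}" "j \<in> {1..N}" for i j
    using that by (auto simp: Lv_def)
  have Rinj: "i = j" if "Rv N i = Rv N j" for i j
    using that by (auto simp: Rv_def)
  have Lpath: "\<not> joined (undir D) (Lv N i) (Lv N j)" if ij: "i \<in> {1..N}" "j \<in> {1..N}" "i \<noteq> j" for i j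
  proof
    assume "joined (undir D) (Lv N i) (Lv N j)"
    then have "(Lv N i, Lv N j) \<in> {(a, b). (a, b) \<in> D \<or> (b, a) \<in> D}\<^sup>*" unfolding joined_def undir_iff .
    then have "Lv N i = Lv N j"
    proof (rule sources_not_joined[rotated 3])
      fix a b p assume "(a, p) \<in> D" "(b, p) \<in> D"
      then show "a = b" by (rule uniq)
    qed (use Lsrc ij in blast)+
    then show False using Linj ij by blast
  qed
  have Rpath: "\<not> joined (undir D) (Rv N i) (Rv N j)" if ij: "i \<in> {1..N}" "j \<in> {1..N}" "i \<noteq> j" for i j
  proof
    assume "joined (undir D) (Rv N i) (Rv N j)"
    then have "(Rv N i, Rv N j) \<in> {(a, b). (a, b) \<in> D \<or> (b, a) \<in> D}\<^sup>*" unfolding joined_def undir_iff .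
    \<comment> \<open>Reversing all arcs turns sinks into sources.\<close>
    then have "(Rv N i, Rv N j) \<in> {(a, b). (a, b) \<in> D\<inverse> \<or> (b, a) \<in> D\<inverse>}\<^sup>*"
      by (simp add: disj_commute)
    then have "Rv N i = Rv N j"
    proof (rule sources_not_joined[rotated 3])
      fix a b p assume "(a, p) \<in> D\<inverse>" "(b, p) \<in> D\<inverse>"
      then show "a = b" using uniq'[of p a b] by blast
    qed (use Rsnk ij in blast)+
    then show False using Rinj ij by blast
  qed
  have sub: "undir D \<subseteq> gedges N"
  proof
    fix e assume "e \<in> undir D"
    then obtain a b where ab: "e = {a, b}" "(a, b) \<in> D" unfolding undir_def by blast
    show "e \<in> gedges N" unfolding gedges_def ab(1) using arcsD(1-3)[OF A ab(2)] by blast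
  qed
  have degI: "deg (undir D) p = 2" if p: "p \<in> gverts N" "p \<notin> Lv N ` {1..N} \<union> Rv N ` {1..N} \<union> Bv N ` {1..N}" for p
  proof -
    obtain r i where "r \<in> {1..N}" "i \<in> {0<..<2 * r}" "p = pt i r" "\<not> (odd i \<and> r = N)"
      using vclass[OF p(1)] p(2) by blast
    then show ?thesis using I[of r i] by (simp add: deg_eq[OF A])
  qed
  have degB: "deg (undir D) (Bv N j) = 1" if "j \<in> {1..N}" for j
    using B[OF that] by (auto simp: deg_eq[OF A])
  have degL: "deg (undir D) (Lv N j) = u ! (j - 1)" if "j \<in> {1..N}" for j
    using L[OF that] by (simp add: deg_eq[OF A])
  have degR: "deg (undir D) (Rv N j) = 1 - v ! (j - 1)" if "j \<in> {1..N}" for j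
    using R[OF that] by (simp add: deg_eq[OF A])
  have tf: "is_tfpl N (undir D)"
    unfolding is_tfpl_def
  proof (intro conjI ballI impI)
    fix i assume i: "i \<in> {1..N}"
    show "deg (undir D) (Lv N i) \<le> 1" using degL[OF i] L(3)[OF i] by auto
    show "deg (undir D) (Rv N i) \<le> 1" using degR[OF i] by simp
    show "deg (undir D) (Bv N i) = 1" using degB[OF i] .
  qed (use sub degI Lpath Rpath in blast)+
  have one: "indeg D p = 1 \<and> outdeg D p = 1" if "deg (undir D) p = 2" for p
    using deg_le[of p] that by (simp add: deg_eq[OF A])
  show "is_oriented_tfpl N D"
    unfolding is_oriented_tfpl_def using tf one L(1) R(1) arcsD(4)[OF A] by blast
  show "has_boundary N D u v w"
    unfolding has_boundary_def
  proof (intro ballI conjI impI)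
    fix i assume i: "i \<in> {1..N}"
    show "(u ! (i - 1) = 1) = (deg (undir D) (Lv N i) = 1)" using degL[OF i] by simp
    show "(v ! (i - 1) = 0) = (deg (undir D) (Rv N i) = 1)" using degR[OF i] R(3)[OF i] by auto
    show "w ! (i - 1) = 1" if "indeg D (Bv N i) = 1" using B[OF i] that by simp
    show "w ! (i - 1) = 0" if "outdeg D (Bv N i) = 1" using B[OF i] that by auto
  qed
qed

section \<open>The excess of an oriented TFPL\<close>

definition colours :: "(int \<times> int) set" where
  "colours = {(0, 0), (1, 0), (0, 1)}"

lemma hcol_colour: "arcs N D \<Longrightarrow> hcol D i r \<in> colours"
  using arcsD(4)[of N D "pt i r" "pt (Suc i) r"] arcsD(4)[of N D "pt (Suc i) r" "pt i r"] by (auto simp: hcol_def colours_def)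

lemma vcol_colour: "arcs N D \<Longrightarrow> vcol D i r \<in> colours"
  using arcsD(4)[of N D "pt i r" "pt (Suc i) (Suc r)"] arcsD(4)[of N D "pt (Suc i) (Suc r)" "pt i r"]
  by (auto simp: vcol_def colours_def)

lemma vdown_colour: "arcs N D \<Longrightarrow> vdown N w D i r \<in> colours"
  using vcol_colour[of N D i r] by (auto simp: vdown_def virt_def colours_def)

text \<open>Read through \<open>slash_col\<close> and \<open>back_col\<close>, this is
  \<open>slashQ\<close> for even \<open>i\<close> and minus \<open>backQ\<close> for odd
  \<open>i\<close>. With this sign the charge of a horizontal edge is carried along the row from
  left to right.\<close>

definition hQ :: "nat \<Rightarrow> int \<times> int \<Rightarrow> int \<times> int" where
  "hQ i c = (if even i then (fst c - 1, snd c + 1) else (- fst c - 1, 1 - snd c))"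

definition vQ :: "nat \<Rightarrow> int \<times> int \<Rightarrow> int \<times> int" where
  "vQ i c = (if even i then c else (1 - fst c, 1 - snd c))"

text \<open>The vertex between the horizontal edges \<open>i\<close> and \<open>i + 1\<close> is
  even. Excess zero excludes the upper edge and a straight passage from right to left; this leaves
  five of the six ways to place the two colours on the other three edges.\<close>

lemma vertex_area_even_site:
  assumes "{a, b, c, d} \<subseteq> colours" "add4 a b c d = (1, 1)" "even i"
  shows "tot1 [vQ (Suc i) d, hQ (Suc i) b] = tot1 [hQ i a, vQ i c] \<and>
    tot2 [vQ (Suc i) d, hQ (Suc i) b] = tot2 [hQ i a, vQ i c] \<and>
    area [vQ (Suc i) d, hQ (Suc i) b] \<ge> area [hQ i a, vQ i c] + 1 \<and>
    (area [vQ (Suc i) d, hQ (Suc i) b] = area [hQ i a, vQ i c] + 1 \<longrightarrow> c = (0, 0) \<and> \<not> (a = (0, 1) \<and> b = (1, 0)))"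
proof -
  have "a = (0, 0) \<or> a = (1, 0) \<or> a = (0, 1)" "b = (0, 0) \<or> b = (1, 0) \<or> b = (0, 1)"
    "c = (0, 0) \<or> c = (1, 0) \<or> c = (0, 1)" "d = (0, 0) \<or> d = (1, 0) \<or> d = (0, 1)"
    using assms(1) by (simp_all add: colours_def)
  then show ?thesis using assms(2,3)
    by (elim disjE; simp add: hQ_def vQ_def)
qed

text \<open>At an odd vertex the lower edge is the absent one, and the excluded sixth state is again
  the straight passage from right to left.\<close>

lemma vertex_area_odd_site:
  assumes "{a, b, c, d} \<subseteq> colours" "add4 a b c d = (1, 1)" "odd i"
  shows "tot1 [vQ (Suc i) d, hQ (Suc i) b] = tot1 [hQ i a, vQ i c] \<and>
    tot2 [vQ (Suc i) d, hQ (Suc i) b] = tot2 [hQ i a, vQ i c] \<and>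
    area [vQ (Suc i) d, hQ (Suc i) b] \<ge> area [hQ i a, vQ i c] + 1 \<and>
    (area [vQ (Suc i) d, hQ (Suc i) b] = area [hQ i a, vQ i c] + 1 \<longrightarrow> d = (0, 0) \<and> \<not> (a = (1, 0) \<and> b = (0, 1)))"
proof -
  have "a = (0, 0) \<or> a = (1, 0) \<or> a = (0, 1)" "b = (0, 0) \<or> b = (1, 0) \<or> b = (0, 1)"
    "c = (0, 0) \<or> c = (1, 0) \<or> c = (0, 1)" "d = (0, 0) \<or> d = (1, 0) \<or> d = (0, 1)"
    using assms(1) by (simp_all add: colours_def)
  then show ?thesis using assms(2,3)
    by (elim disjE; simp add: hQ_def vQ_def)
qed

text \<open>Minus the \<open>slashQ\<close> of the boundary letter, so that it cancels the first
  horizontal charge of the row. \<open>sufQ\<close> is minus \<open>backQ\<close>, which is the last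
  horizontal charge itself. Both presuppose absent vertical edges at the ends.\<close>

definition preQ :: "nat \<Rightarrow> int \<times> int" where
  "preQ x = (if x = 0 then (1, -1) else (0, -1))"

definition sufQ :: "nat \<Rightarrow> int \<times> int" where
  "sufQ x = (if x = 0 then (-1, 0) else (-1, 1))"

lemma left_area:
  assumes "{b, d} \<subseteq> colours" "add4 (0, 0) b (0, 0) d = (int x, 0)" "x \<in> {0, 1}"
  shows "tot1 [preQ x, vQ 0 d, hQ 0 b] = 0" "tot2 [preQ x, vQ 0 d, hQ 0 b] = 0"
    "area [preQ x, vQ 0 d, hQ 0 b] \<ge> 0" "area [preQ x, vQ 0 d, hQ 0 b] = 0 \<Longrightarrow> d = (0, 0)"
  using assms by (auto simp: colours_def hQ_def vQ_def preQ_def)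

lemma right_area:
  assumes "{a, d} \<subseteq> colours" "add4 a (0, 0) (0, 0) d = (0, 1 - int x)" "x \<in> {0, 1}" "odd i"
  shows "tot1 [vQ (Suc i) d, sufQ x] = tot1 [hQ i a]" "tot2 [vQ (Suc i) d, sufQ x] = tot2 [hQ i a]"
    "area [vQ (Suc i) d, sufQ x] \<ge> 0" "area [vQ (Suc i) d, sufQ x] = 0 \<Longrightarrow> d = (0, 0)"
  using assms by (auto simp: colours_def hQ_def vQ_def sufQ_def)

text \<open>The sweep of one row: the horizontal charge \<open>h i\<close> jumps over the vertical
  charge \<open>t i\<close>, which turns into \<open>d i\<close>.\<close>

lemma scan_area:
  assumes "\<And>i. i < n \<Longrightarrow> tot1 [d i, h (Suc i)] = tot1 [h i, t i]" "\<And>i. i < n \<Longrightarrow> tot2 [d i, h (Suc i)] = tot2 [h i, t i]"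
  shows "tot1 (map d [0..<n] @ [h n]) = tot1 (h 0 # map t [0..<n]) \<and>
    tot2 (map d [0..<n] @ [h n]) = tot2 (h 0 # map t [0..<n]) \<and>
    area (map d [0..<n] @ [h n]) = area (h 0 # map t [0..<n]) + (\<Sum>i<n. area [d i, h (Suc i)] - area [h i, t i])"
  using assms
proof (induction n)
  case (Suc n)
  have t: "tot1 [d n, h (Suc n)] = tot1 [h n, t n]" "tot2 [d n, h (Suc n)] = tot2 [h n, t n]" using Suc.prems by auto
  have IH: "tot1 (map d [0..<n] @ [h n]) = tot1 (h 0 # map t [0..<n])"
    "tot2 (map d [0..<n] @ [h n]) = tot2 (h 0 # map t [0..<n])"
    "area (map d [0..<n] @ [h n]) = area (h 0 # map t [0..<n]) + (\<Sum>i<n. area [d i, h (Suc i)] - area [h i, t i])"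
    using Suc.IH Suc.prems by auto
  have "area (map d [0..<Suc n] @ [h (Suc n)]) = area (map d [0..<n] @ [h n, t n]) + (area [d n, h (Suc n)] - area [h n, t n])"
    using area_replace[OF t, of "map d [0..<n]" "[]"] by simp
  moreover have "area (map d [0..<n] @ [h n, t n]) = area (h 0 # map t [0..<Suc n]) +
     (area (map d [0..<n] @ [h n]) - area (h 0 # map t [0..<n]))"
    using area_replace[OF IH(1,2), of "[]" "[t n]"] by simp
  ultimately have "area (map d [0..<Suc n] @ [h (Suc n)]) = area (h 0 # map t [0..<Suc n]) + (\<Sum>i<Suc n. area [d i, h (Suc i)] - area [h i, t i])"
    using IH(3) by simp
  moreover have "tot1 (map d [0..<Suc n] @ [h (Suc n)]) = tot1 (h 0 # map t [0..<Suc n])"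
    using IH(1) t(1) by simp
  moreover have "tot2 (map d [0..<Suc n] @ [h (Suc n)]) = tot2 (h 0 # map t [0..<Suc n])"
    using IH(2) t(2) by simp
  ultimately show ?case by blast
qed simp

text \<open>The cut below row r, preceded by the left and followed by the right boundary edges of the rows above.\<close>

definition cut :: "nat \<Rightarrow> (vert \<times> vert) set \<Rightarrow> nat list \<Rightarrow> nat list \<Rightarrow> nat list \<Rightarrow> nat \<Rightarrow> (int \<times> int) list" where
  "cut N D u v w r = map (\<lambda>s. preQ (u ! (N - s))) [1..<Suc r] @
     map (\<lambda>i. vQ i (vdown N w D i r)) [0..<2 * r + 1] @ map (\<lambda>s. sufQ (v ! (s - 1))) (rev [1..<Suc r])"

definition site_excess :: "nat \<Rightarrow> (vert \<times> vert) set \<Rightarrow> nat list \<Rightarrow> nat \<Rightarrow> nat \<Rightarrow> int" where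
  "site_excess N D w r i = area [vQ (Suc i) (vdown N w D (Suc i) r), hQ (Suc i) (hcol D (Suc i) r)] -
     area [hQ i (hcol D i r), vQ i (vcol D i (r - 1))] - 1"

definition end_excess :: "nat \<Rightarrow> (vert \<times> vert) set \<Rightarrow> nat list \<Rightarrow> nat list \<Rightarrow> nat list \<Rightarrow> nat \<Rightarrow> int" where
  "end_excess N D u v w r =
     area [preQ (u ! (N - r)), vQ 0 (vdown N w D 0 r), hQ 0 (hcol D 0 r)] +
     area [vQ (2 * r) (vdown N w D (2 * r) r), sufQ (v ! (r - 1))]"

text \<open>The next cut arises by inserting a left block of total charge zero (\<open>s1\<close>),
  sweeping the row (\<open>s2\<close>) and replacing the last horizontal charge by a right block
  (\<open>s3\<close>). The constant \<open>2 * int q + 1\<close> counts the interior vertices of the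
  row, which add 1 each.\<close>

lemma cut_step:
  assumes ok: "locally_ok N D u v w" and q: "q < N"
    and u: "u ! (N - Suc q) \<in> {0, 1}" and v: "v ! q \<in> {0, 1}"
  shows "area (cut N D u v w (Suc q)) = area (cut N D u v w q) + (2 * int q + 1) +
      (\<Sum>i<2 * q + 1. site_excess N D w (Suc q) i) + end_excess N D u v w (Suc q)"
    and "\<And>i. i < 2 * q + 1 \<Longrightarrow> site_excess N D w (Suc q) i \<ge> 0" and "end_excess N D u v w (Suc q) \<ge> 0"
    and "\<And>i. i < 2 * q + 1 \<Longrightarrow> site_excess N D w (Suc q) i = 0 \<Longrightarrow> even i \<Longrightarrow>
       vcol D i q = (0, 0) \<and> \<not> (hcol D i (Suc q) = (0, 1) \<and> hcol D (Suc i) (Suc q) = (1, 0))"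
    and "\<And>i. i < 2 * q + 1 \<Longrightarrow> site_excess N D w (Suc q) i = 0 \<Longrightarrow> odd i \<Longrightarrow>
       \<not> (hcol D i (Suc q) = (1, 0) \<and> hcol D (Suc i) (Suc q) = (0, 1))"
    and "end_excess N D u v w (Suc q) = 0 \<Longrightarrow>
       vdown N w D 0 (Suc q) = (0, 0) \<and> vdown N w D (2 * Suc q) (Suc q) = (0, 0)"
proof -
  let ?r = "Suc q"
  have rin: "?r \<in> {1..N}" using q by simp
  have A: "arcs N D"
    and inr: "\<And>i. i \<in> {0<..<2 * ?r} \<Longrightarrow>
      add4 (hcol D (i - 1) ?r) (hcol D i ?r) (vcol D (i - 1) (?r - 1)) (vdown N w D i ?r) = (1, 1)"
    and lft: "add4 (0, 0) (hcol D 0 ?r) (0, 0) (vdown N w D 0 ?r) = (int (u ! (N - ?r)), 0)"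
    and rgt: "add4 (hcol D (2 * ?r - 1) ?r) (0, 0) (0, 0) (vdown N w D (2 * ?r) ?r) = (0, 1 - int (v ! (?r - 1)))"
    using ok rin unfolding locally_ok_def by blast+
  define d h t where "d i = vQ (Suc i) (vdown N w D (Suc i) ?r)" and "h i = hQ i (hcol D i ?r)" and "t i = vQ i (vcol D i q)" for i
  have site: "add4 (hcol D i ?r) (hcol D (Suc i) ?r) (vcol D i q) (vdown N w D (Suc i) ?r) = (1, 1)" if "i < 2 * q + 1" for i
    using inr[of "Suc i"] that by simp
  have col: "{hcol D i ?r, hcol D (Suc i) ?r, vcol D i q, vdown N w D (Suc i) ?r} \<subseteq> colours" for i
    using hcol_colour[OF A] vcol_colour[OF A] vdown_colour[OF A] by simp
  have loc: "tot1 [d i, h (Suc i)] = tot1 [h i, t i] \<and> tot2 [d i, h (Suc i)] = tot2 [h i, t i] \<and> area [d i, h (Suc i)] \<ge> area [h i, t i] + 1"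
    if "i < 2 * q + 1" for i
    using vertex_area_even_site[OF col site[OF that]] vertex_area_odd_site[OF col site[OF that]]
    unfolding d_def h_def t_def by blast
  have ex: "site_excess N D w ?r i = area [d i, h (Suc i)] - area [h i, t i] - 1" for i
    by (simp add: site_excess_def d_def h_def t_def)
  show "site_excess N D w ?r i \<ge> 0" if "i < 2 * q + 1" for i using loc[OF that] ex by simp
  show "vcol D i q = (0, 0) \<and> \<not> (hcol D i ?r = (0, 1) \<and> hcol D (Suc i) ?r = (1, 0))"
    if "i < 2 * q + 1" "site_excess N D w ?r i = 0" "even i" for i
  proof -
    have "area [d i, h (Suc i)] = area [h i, t i] + 1" using that(2) unfolding ex by linarith
    then show ?thesis using vertex_area_even_site[OF col site[OF that(1)] that(3)] unfolding d_def h_def t_def by blast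
  qed
  show "\<not> (hcol D i ?r = (1, 0) \<and> hcol D (Suc i) ?r = (0, 1))"
    if "i < 2 * q + 1" "site_excess N D w ?r i = 0" "odd i" for i
  proof -
    have "area [d i, h (Suc i)] = area [h i, t i] + 1" using that(2) unfolding ex by linarith
    then show ?thesis using vertex_area_odd_site[OF col site[OF that(1)] that(3)] unfolding d_def h_def t_def by blast
  qed
  have lcol: "{hcol D 0 ?r, vdown N w D 0 ?r} \<subseteq> colours" "{hcol D (2 * q + 1) ?r, vdown N w D (2 * ?r) ?r} \<subseteq> colours"
    using hcol_colour[OF A] vdown_colour[OF A] by simp_all
  have rgt': "add4 (hcol D (2 * q + 1) ?r) (0, 0) (0, 0) (vdown N w D (2 * ?r) ?r) = (0, 1 - int (v ! q))"
    using rgt by simp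
  have odd: "odd (2 * q + 1)" by simp
  note La = left_area[OF lcol(1) lft u] and Ra = right_area[OF lcol(2) rgt' v odd]
  have S: "Suc (2 * q + 1) = 2 * ?r" by simp
  note Ra = Ra[unfolded S]
  show "end_excess N D u v w ?r \<ge> 0" using La(3) Ra(3) by (simp add: end_excess_def)
  show "vdown N w D 0 ?r = (0, 0) \<and> vdown N w D (2 * ?r) ?r = (0, 0)" if "end_excess N D u v w ?r = 0"
  proof -
    let ?x = "area [preQ (u ! (N - ?r)), vQ 0 (vdown N w D 0 ?r), hQ 0 (hcol D 0 ?r)]"
    let ?y = "area [vQ (2 * ?r) (vdown N w D (2 * ?r) ?r), sufQ (v ! q)]"
    have "?x + ?y = 0" using that unfolding end_excess_def by simp
    then have "?x = 0" "?y = 0" using La(3) Ra(3) by linarith+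
    then show ?thesis using La(4) Ra(4) by blast
  qed
  define pre where "pre = map (\<lambda>s. preQ (u ! (N - s))) [1..<Suc q]"
  define suf where "suf = map (\<lambda>s. sufQ (v ! (s - 1))) (rev [1..<Suc q])"
  define V0 H0 V1 where "V0 = vQ 0 (vdown N w D 0 ?r)" and "H0 = h 0" and "V1 = vQ (2 * ?r) (vdown N w D (2 * ?r) ?r)"
  let ?n = "2 * q + 1"
  have cq: "cut N D u v w q = pre @ map t [0..<?n] @ suf"
    using q by (simp add: cut_def pre_def suf_def t_def vdown_def)
  have "[0..<2 * ?r + 1] = [0..<Suc ?n] @ [2 * ?r]"
    using upt_Suc_append[of 0 "Suc ?n"] by (simp only: S) simp
  also have "[0..<Suc ?n] = 0 # [Suc 0..<Suc ?n]"
    by (rule upt_conv_Cons) simp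
  also have "[Suc 0..<Suc ?n] = map Suc [0..<?n]"
    by (rule map_Suc_upt[symmetric])
  finally have e: "[0..<2 * ?r + 1] = 0 # map Suc [0..<?n] @ [2 * ?r]" by (simp only: append_Cons)
  have p: "[1..<Suc ?r] = [1..<?r] @ [?r]" by simp
  have cr: "cut N D u v w ?r = (pre @ [preQ (u ! (N - ?r))]) @ (V0 # map d [0..<?n] @ [V1]) @ (sufQ (v ! q) # suf)"
    unfolding cut_def e p by (simp add: pre_def suf_def V0_def V1_def d_def del: upt_Suc)
  have scan: "tot1 (map d [0..<?n] @ [h ?n]) = tot1 (h 0 # map t [0..<?n])"
    "tot2 (map d [0..<?n] @ [h ?n]) = tot2 (h 0 # map t [0..<?n])"
    "area (map d [0..<?n] @ [h ?n]) = area (h 0 # map t [0..<?n]) + (\<Sum>i<?n. area [d i, h (Suc i)] - area [h i, t i])"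
    using scan_area[of ?n d h t] loc by blast+
  have L: "tot1 [preQ (u ! (N - ?r)), V0, H0] = tot1 []" "tot2 [preQ (u ! (N - ?r)), V0, H0] = tot2 []"
    using La(1,2) by (simp_all add: V0_def H0_def h_def)
  have R: "tot1 [V1, sufQ (v ! q)] = tot1 [h ?n]" "tot2 [V1, sufQ (v ! q)] = tot2 [h ?n]"
    using Ra(1,2) by (simp_all add: V1_def h_def)
  have s1: "area (pre @ [preQ (u ! (N - ?r)), V0, H0] @ map t [0..<?n] @ suf) = area (cut N D u v w q) + area [preQ (u ! (N - ?r)), V0, H0]"
    using area_replace[OF L, of pre "map t [0..<?n] @ suf"] by (simp add: cq)
  have s2: "area ((pre @ [preQ (u ! (N - ?r)), V0]) @ (map d [0..<?n] @ [h ?n]) @ suf) =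
     area ((pre @ [preQ (u ! (N - ?r)), V0]) @ (h 0 # map t [0..<?n]) @ suf) + (\<Sum>i<?n. area [d i, h (Suc i)] - area [h i, t i])"
    using area_replace[OF scan(1,2), of "pre @ [preQ (u ! (N - ?r)), V0]" suf] scan(3) by simp
  have s3: "area (cut N D u v w ?r) = area ((pre @ [preQ (u ! (N - ?r)), V0]) @ (map d [0..<?n] @ [h ?n]) @ suf) + area [V1, sufQ (v ! q)]"
    using area_replace[OF R, of "pre @ [preQ (u ! (N - ?r)), V0] @ map d [0..<?n]" suf] by (simp add: cr)
  have "(\<Sum>i<?n. area [d i, h (Suc i)] - area [h i, t i]) = (\<Sum>i<?n. site_excess N D w ?r i) + (2 * int q + 1)"
    unfolding ex by (simp add: sum_subtractf)
  then show "area (cut N D u v w ?r) = area (cut N D u v w q) + (2 * int q + 1) +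
      (\<Sum>i<?n. site_excess N D w ?r i) + end_excess N D u v w ?r"
    using s1 s2 s3 unfolding end_excess_def V0_def[symmetric] V1_def[symmetric]
    by (simp add: H0_def h_def)
qed

lemma tot_rev: "tot1 (rev xs) = tot1 xs" "tot2 (rev xs) = tot2 xs"
  by (simp_all add: tot1_def tot2_def rev_map[symmetric])

lemma area_rev: "area (rev xs) = - area xs"
proof (induction xs)
  case (Cons x xs)
  then show ?case by (simp add: area_append tot_rev algebra_simps)
qed simp

lemma area_odd_positions:
  assumes "\<And>i. even i \<Longrightarrow> g i = (0, 0)"
  shows "area (map g [0..<2 * n + 1]) = area (map (\<lambda>j. g (2 * j + 1)) [0..<n]) \<and>
    tot1 (map g [0..<2 * n + 1]) = tot1 (map (\<lambda>j. g (2 * j + 1)) [0..<n]) \<and>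
    tot2 (map g [0..<2 * n + 1]) = tot2 (map (\<lambda>j. g (2 * j + 1)) [0..<n])"
proof (induction n)
  case 0
  then show ?case using assms[of 0] by simp
next
  case (Suc n)
  have "[0..<2 * Suc n + 1] = [0..<2 * n + 1] @ [2 * n + 1, 2 * Suc n]" by simp
  then show ?case using Suc assms[of "2 * Suc n"] by (simp add: area_append del: upt_Suc) (simp add: area_append)
qed

fun preL :: "lab \<Rightarrow> int \<times> int" where
  "preL N0 = (1, -1)" | "preL N1 = (0, -1)" | "preL N10 = (0, 0)"

fun sufL :: "lab \<Rightarrow> int \<times> int" where
  "sufL N0 = (-1, 0)" | "sufL N1 = (-1, 1)" | "sufL N10 = (0, 0)"

text \<open>The boundary words appear reversed in the cut, which negates their areas; so d(w) enters
  with a positive sign and d(u), d(v) with a negative one, and they cancel.\<close>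

lemma area_final:
  assumes len: "length u = N" "length v = N" "length w = N"
    and k: "count_list u 0 = count_list v 0" "count_list v 0 = count_list w 0"
    and d: "inversions (lab_word w) = inversions (lab_word u) + inversions (lab_word v)"
  shows "area (cut N D u v w N) = int N ^ 2"
proof -
  let ?u = "lab_word u" and ?v = "lab_word v" and ?w = "lab_word w"
  let ?k = "int (count_list ?u N0)" and ?m = "int (count_list ?u N1)"
  have cnt: "count_list ?v N0 = count_list ?u N0" "count_list ?w N0 = count_list ?u N0"
    using k by (simp_all add: count_lab_word_N0)
  have km: "?k + ?m = int N" using count_bin[of ?u] len by simp
  have cnt1: "count_list ?v N1 = count_list ?u N1" "count_list ?w N1 = count_list ?u N1"
    using count_bin[of ?u] count_bin[of ?v] count_bin[of ?w] cnt len by simp_all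
  have pre: "map (\<lambda>s. preQ (u ! (N - s))) [1..<Suc N] = rev (map preL ?u)"
    using len by (intro nth_equalityI) (auto simp: rev_nth preQ_def lab_word_def simp del: upt_Suc)
  have suf: "map (\<lambda>s. sufQ (v ! (s - 1))) (rev [1..<Suc N]) = rev (map sufL ?v)"
    using len by (intro nth_equalityI) (auto simp: rev_nth sufQ_def lab_word_def simp del: upt_Suc)
  define g where "g i = vQ i (vdown N w D i N)" for i
  have g0: "g i = (0, 0)" if "even i" for i using that by (simp add: g_def vQ_def vdown_def virt_def)
  have row: "map (\<lambda>j. g (2 * j + 1)) [0..<N] = map horQ ?w"
    using len by (intro nth_equalityI) (auto simp: g_def vQ_def vdown_def virt_def lab_word_def)
  have row': "area (map g [0..<2 * N + 1]) = area (map horQ ?w)"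
    "tot1 (map g [0..<2 * N + 1]) = tot1 (map horQ ?w)" "tot2 (map g [0..<2 * N + 1]) = tot2 (map horQ ?w)"
    using area_odd_positions[of g N, OF g0] unfolding row by blast+
  have cut: "cut N D u v w N = rev (map preL ?u) @ map g [0..<2 * N + 1] @ rev (map sufL ?v)"
    unfolding cut_def pre suf g_def ..
  have b: "bin ?u" "bin ?v" "bin ?w" by simp_all
  have a: "area (map preL ?u) = 2 * int (inversions ?u) - ?k * ?m" "area (map sufL ?v) = 2 * int (inversions ?v) - ?k * ?m"
    "area (map horQ ?w) = 2 * int (inversions ?w) - ?k * ?m"
    using area_bin[OF b(1), of preL] area_bin[OF b(2), of sufL] area_bin[OF b(3), of horQ] cnt cnt1 by simp_all
  have t: "tot1 (map preL ?u) = ?k" "tot2 (map preL ?u) = - int N" "tot1 (map sufL ?v) = - int N" "tot2 (map sufL ?v) = ?m"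
    "tot1 (map horQ ?w) = ?m" "tot2 (map horQ ?w) = ?k"
    using tot_bin[OF b(1), of preL] tot_bin[OF b(2), of sufL] tot_bin[OF b(3), of horQ] cnt cnt1 km by simp_all
  have "area (cut N D u v w N) = ?k * ?m + ?k * ?k + int N * ?m"
    unfolding cut area_append tot_simps tot_rev area_rev row' a t d km[symmetric] by (simp add: algebra_simps)
  also have "\<dots> = int N ^ 2"
    unfolding km[symmetric] by (simp add: power2_eq_square algebra_simps)
  finally show ?thesis .
qed

theorem no_excess:
  assumes ok: "locally_ok N D u v w" and N: "1 \<le> N"
    and u: "set u \<subseteq> {0, 1}" "length u = N" and v: "set v \<subseteq> {0, 1}" "length v = N" and w: "length w = N"
    and k: "count_list u 0 = count_list v 0" "count_list v 0 = count_list w 0"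
    and d: "inversions (lab_word w) = inversions (lab_word u) + inversions (lab_word v)"
    and q: "q < N" and i: "i < 2 * q + 1"
  shows "site_excess N D w (Suc q) i = 0"
proof -
  have uq: "u ! (N - Suc q) \<in> {0, 1}" if "q < N" for q
  proof -
    have "N - Suc q < length u" using u that by simp
    then show ?thesis using u(1) nth_mem by blast
  qed
  have vq: "v ! q \<in> {0, 1}" if "q < N" for q
    using v that nth_mem by blast
  note step = cut_step[OF ok _ uq vq]
  define e where "e q = (\<Sum>i<2 * q + 1. site_excess N D w (Suc q) i) + end_excess N D u v w (Suc q)" for q
  have e0: "e q \<ge> 0" if "q < N" for q
    unfolding e_def using step(2)[OF that that that] step(3)[OF that that that] by (intro add_nonneg_nonneg sum_nonneg) auto
  have start: "area (cut N D u v w 0) = 0"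
    by (simp add: cut_def)
  \<comment> \<open>The constants are the odd numbers 1, 3, 5, ..., whose sum is the square in
    \<open>area_final\<close>; nothing is left for the nonnegative excesses.\<close>
  have "n \<le> N \<Longrightarrow> area (cut N D u v w n) = int n ^ 2 + (\<Sum>q<n. e q)" for n
  proof (induction n)
    case 0
    then show ?case using start by simp
  next
    case (Suc n)
    then have "area (cut N D u v w (Suc n)) = int n ^ 2 + (\<Sum>q<n. e q) + (2 * int n + 1) + e n"
      using step(1)[of n] unfolding e_def by simp
    then show ?case by (simp add: power2_eq_square algebra_simps)
  qed
  from this[of N] have "(\<Sum>q<N. e q) = 0" using area_final[OF u(2) v(2) w k d, of D] by simp
  then have "e q = 0" using sum_nonneg_eq_0_iff[of "{..<N}" e] e0 q by auto
  moreover have "(\<Sum>i<2 * q + 1. site_excess N D w (Suc q) i) \<ge> 0"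
    using step(2)[OF q q q] by (intro sum_nonneg) auto
  ultimately have "(\<Sum>i<2 * q + 1. site_excess N D w (Suc q) i) = 0"
    using step(3)[OF q q q] unfolding e_def by linarith
  then show ?thesis
    using sum_nonneg_eq_0_iff[of "{..<2 * q + 1}" "site_excess N D w (Suc q)"] step(2)[OF q q q] i by auto
qed

section \<open>Oriented TFPLs of excess zero and puzzles\<close>

text \<open>The dictionary is found by comparing \<open>hQ\<close> and \<open>vQ\<close> with the
  puzzle charges. An absent edge is the label 0, 1 or 10 in the slash, back or horizontal direction
  respectively.\<close>

fun slash_col :: "lab \<Rightarrow> int \<times> int" where
  "slash_col N0 = (0, 0)" | "slash_col N1 = (1, 0)" | "slash_col N10 = (0, 1)"

fun back_col :: "lab \<Rightarrow> int \<times> int" where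
  "back_col N0 = (0, 1)" | "back_col N1 = (0, 0)" | "back_col N10 = (1, 0)"

fun hor_col :: "lab \<Rightarrow> int \<times> int" where
  "hor_col N0 = (1, 0)" | "hor_col N1 = (0, 1)" | "hor_col N10 = (0, 0)"

definition slash_lab :: "int \<times> int \<Rightarrow> lab" where
  "slash_lab c = (if c = (1, 0) then N1 else if c = (0, 1) then N10 else N0)"

definition back_lab :: "int \<times> int \<Rightarrow> lab" where
  "back_lab c = (if c = (0, 1) then N0 else if c = (1, 0) then N10 else N1)"

definition hor_lab :: "int \<times> int \<Rightarrow> lab" where
  "hor_lab c = (if c = (1, 0) then N0 else if c = (0, 1) then N1 else N10)"

lemma col_lab:
  "c \<in> colours \<Longrightarrow> slash_col (slash_lab c) = c" "c \<in> colours \<Longrightarrow> back_col (back_lab c) = c"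
  "c \<in> colours \<Longrightarrow> hor_col (hor_lab c) = c"
  by (auto simp: colours_def slash_lab_def back_lab_def hor_lab_def)

lemma lab_col:
  "slash_lab (slash_col a) = a" "back_lab (back_col a) = a" "hor_lab (hor_col a) = a"
  by (cases a; simp add: slash_lab_def back_lab_def hor_lab_def)+

lemma col_colours: "slash_col a \<in> colours" "back_col a \<in> colours" "hor_col a \<in> colours"
  by (cases a; simp add: colours_def)+

text \<open>The five states left by zero excess are exactly the five triangles.\<close>

lemma tri_colours:
  assumes "{a, b, c} \<subseteq> colours" "add4 a b (0, 0) c = (1, 1)" "\<not> (a = (0, 1) \<and> b = (1, 0))"
  shows "tri (slash_lab a) (back_lab b) (hor_lab c)"
proof -
  have "a = (0, 0) \<or> a = (1, 0) \<or> a = (0, 1)" "b = (0, 0) \<or> b = (1, 0) \<or> b = (0, 1)"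
    "c = (0, 0) \<or> c = (1, 0) \<or> c = (0, 1)"
    using assms(1) by (simp_all add: colours_def)
  then show ?thesis using assms(2,3)
    by (elim disjE; simp add: slash_lab_def back_lab_def hor_lab_def)
qed

lemma tri_add:
  assumes "tri a b c"
  shows "add4 (slash_col a) (back_col b) (0, 0) (hor_col c) = (1, 1)"
  using assms by (cases a; cases b; cases c; simp)

text \<open>The horizontal edges \<open>2 * j - 2\<close> and \<open>2 * j - 1\<close> of a row meet
  at its \<open>j\<close>-th even vertex, the centre of the \<open>j\<close>-th upward
  triangle.\<close>

definition slash_of :: "(vert \<times> vert) set \<Rightarrow> nat \<Rightarrow> nat \<Rightarrow> lab" where
  "slash_of D j r = slash_lab (hcol D (2 * j - 2) r)"

definition back_of :: "(vert \<times> vert) set \<Rightarrow> nat \<Rightarrow> nat \<Rightarrow> lab" where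
  "back_of D j r = back_lab (hcol D (2 * j - 1) r)"

definition balanced :: "nat \<Rightarrow> nat list \<Rightarrow> nat list \<Rightarrow> nat list \<Rightarrow> bool" where
  "balanced N u v w \<longleftrightarrow> 1 \<le> N \<and> set u \<subseteq> {0, 1} \<and> set v \<subseteq> {0, 1} \<and> set w \<subseteq> {0, 1} \<and>
     length u = N \<and> length v = N \<and> length w = N \<and> count_list u 0 = count_list v 0 \<and> count_list v 0 = count_list w 0 \<and>
     inversions (lab_word w) = inversions (lab_word u) + inversions (lab_word v)"

lemma balancedD:
  assumes "balanced N u v w"
  shows "1 \<le> N" "set u \<subseteq> {0, 1}" "set v \<subseteq> {0, 1}" "set w \<subseteq> {0, 1}"
    "length u = N" "length v = N" "length w = N" "count_list u 0 = count_list v 0" "count_list v 0 = count_list w 0"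
    "inversions (lab_word w) = inversions (lab_word u) + inversions (lab_word v)"
  using assms unfolding balanced_def by simp_all

lemma nth_bit:
  assumes "set u \<subseteq> {0, 1 :: nat}" "i < length u"
  shows "u ! i \<in> {0, 1}"
  using assms(1) nth_mem[OF assms(2)] by (rule subsetD)

context
  fixes N D u v w
  assumes bal: "balanced N u v w" and ok: "locally_ok N D u v w"
begin

lemma ok_arcs: "arcs N D"
  using ok unfolding locally_ok_def by blast

lemma ok_site:
  "q < N \<Longrightarrow> i < 2 * q + 1 \<Longrightarrow> add4 (hcol D i (Suc q)) (hcol D (Suc i) (Suc q)) (vcol D i q) (vdown N w D (Suc i) (Suc q)) = (1, 1)"
proof -
  assume q: "q < N" and i: "i < 2 * q + 1"
  have "Suc q \<in> {1..N}" "Suc i \<in> {0<..<2 * Suc q}" using q i by auto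
  then have "add4 (hcol D (Suc i - 1) (Suc q)) (hcol D (Suc i) (Suc q)) (vcol D (Suc i - 1) (Suc q - 1)) (vdown N w D (Suc i) (Suc q)) = (1, 1)"
    using ok unfolding locally_ok_def by blast
  then show ?thesis by simp
qed

lemma ok_zero: "q < N \<Longrightarrow> i < 2 * q + 1 \<Longrightarrow> site_excess N D w (Suc q) i = 0"
  using no_excess[OF ok] balancedD[OF bal] by simp

lemma ok_facts:
  assumes "q < N" "i < 2 * q + 1"
  shows "even i \<Longrightarrow> vcol D i q = (0, 0) \<and> \<not> (hcol D i (Suc q) = (0, 1) \<and> hcol D (Suc i) (Suc q) = (1, 0))"
    "odd i \<Longrightarrow> \<not> (hcol D i (Suc q) = (1, 0) \<and> hcol D (Suc i) (Suc q) = (0, 1))"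
proof -
  have u: "u ! (N - Suc q) \<in> {0, 1}"
  proof -
    have "N - Suc q < length u" using balancedD(5)[OF bal] assms by simp
    then show ?thesis by (rule nth_bit[OF balancedD(2)[OF bal]])
  qed
  have "q < length v" using balancedD(6)[OF bal] assms by simp
  then have v: "v ! q \<in> {0, 1}" by (rule nth_bit[OF balancedD(3)[OF bal]])
  show "even i \<Longrightarrow> vcol D i q = (0, 0) \<and> \<not> (hcol D i (Suc q) = (0, 1) \<and> hcol D (Suc i) (Suc q) = (1, 0))"
    using cut_step(4)[OF ok assms(1) u v assms(2) ok_zero[OF assms]] .
  show "odd i \<Longrightarrow> \<not> (hcol D i (Suc q) = (1, 0) \<and> hcol D (Suc i) (Suc q) = (0, 1))"
    using cut_step(5)[OF ok assms(1) u v assms(2) ok_zero[OF assms]] .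
qed

lemma ok_cols: "hcol D i r \<in> colours" "vcol D i r \<in> colours" "vdown N w D i r \<in> colours"
  using hcol_colour vcol_colour vdown_colour ok_arcs by blast+

lemma vdown_even_zero:
  assumes "r \<in> {1..N}" "even i" "i \<le> 2 * r"
  shows "vdown N w D i r = (0, 0)"
proof (cases "r = N")
  case True
  then show ?thesis using assms by (simp add: vdown_def virt_def)
next
  case False
  then show ?thesis using ok_facts(1)[of r i] assms by (simp add: vdown_def)
qed

lemma up_tri:
  assumes "1 \<le> j" "j \<le> r" "r \<le> N"
  shows "tri (slash_of D j r) (back_of D j r) (hor_lab (vdown N w D (2 * j - 1) r))"
proof -
  obtain q where q: "r = Suc q" "q < N" using assms by (cases r) auto
  obtain k where k: "j = Suc k" using assms by (cases j) auto
  have i: "2 * k < 2 * q + 1" using assms q k by simp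
  have s: "add4 (hcol D (2 * k) r) (hcol D (Suc (2 * k)) r) (vcol D (2 * k) q) (vdown N w D (Suc (2 * k)) r) = (1, 1)"
    and z: "vcol D (2 * k) q = (0, 0)" "\<not> (hcol D (2 * k) r = (0, 1) \<and> hcol D (Suc (2 * k)) r = (1, 0))"
    using ok_site[OF q(2) i] ok_facts(1)[OF q(2) i] by (auto simp: q(1))
  show ?thesis
    using tri_colours[OF _ s[unfolded z(1)] z(2)] ok_cols by (simp add: slash_of_def back_of_def k)
qed

lemma down_tri:
  assumes "1 \<le> j" "j \<le> r" "r < N"
  shows "tri (slash_of D (Suc j) (Suc r)) (back_of D j (Suc r)) (hor_lab (vcol D (2 * j - 1) r))"
proof -
  obtain k where k: "j = Suc k" using assms by (cases j) auto
  let ?i = "2 * k + 1"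
  have i: "?i < 2 * r + 1" using assms k by simp
  have v0: "vdown N w D (Suc ?i) (Suc r) = (0, 0)"
    by (rule vdown_even_zero) (use assms k in auto)
  have s: "add4 (hcol D ?i (Suc r)) (hcol D (Suc ?i) (Suc r)) (vcol D ?i r) (0, 0) = (1, 1)"
    using ok_site[OF assms(3) i] unfolding v0 .
  \<comment> \<open>The slash side of a downward triangle is the edge to the right of the odd
    vertex, so the two horizontal edges change places.\<close>
  have s': "add4 (hcol D (Suc ?i) (Suc r)) (hcol D ?i (Suc r)) (0, 0) (vcol D ?i r) = (1, 1)"
  proof -
    obtain a a' b b' c c' where "hcol D ?i (Suc r) = (a, a')" "hcol D (Suc ?i) (Suc r) = (b, b')" "vcol D ?i r = (c, c')"
      by (metis surj_pair)
    then show ?thesis using s by simp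
  qed
  have n: "\<not> (hcol D (Suc ?i) (Suc r) = (0, 1) \<and> hcol D ?i (Suc r) = (1, 0))"
    using ok_facts(2)[OF assms(3) i] by auto
  show ?thesis
    using tri_colours[OF _ s' n] ok_cols by (simp add: slash_of_def back_of_def k)
qed

lemma left_label:
  assumes "1 \<le> r" "r \<le> N"
  shows "slash_of D 1 r = lab_word u ! (N - r)"
proof -
  have r: "r \<in> {1..N}" using assms by simp
  have "add4 (0, 0) (hcol D 0 r) (0, 0) (vdown N w D 0 r) = (int (u ! (N - r)), 0)"
    using ok r unfolding locally_ok_def by blast
  then have h: "hcol D 0 r = (int (u ! (N - r)), 0)"
    using vdown_even_zero[OF r, of 0] by (cases "hcol D 0 r") simp
  have l: "N - r < length u" using assms balancedD(5)[OF bal] by simp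
  have "u ! (N - r) \<in> {0, 1}" by (rule nth_bit[OF balancedD(2)[OF bal] l])
  then show ?thesis using l by (auto simp: slash_of_def h slash_lab_def lab_word_def)
qed

lemma right_label:
  assumes "1 \<le> r" "r \<le> N"
  shows "back_of D r r = lab_word v ! (r - 1)"
proof -
  have r: "r \<in> {1..N}" using assms by simp
  have "add4 (hcol D (2 * r - 1) r) (0, 0) (0, 0) (vdown N w D (2 * r) r) = (0, 1 - int (v ! (r - 1)))"
    using ok r unfolding locally_ok_def by blast
  then have h: "hcol D (2 * r - 1) r = (0, 1 - int (v ! (r - 1)))"
    using vdown_even_zero[OF r, of "2 * r"] by (cases "hcol D (2 * r - 1) r") simp
  have l: "r - 1 < length v" using assms balancedD(6)[OF bal] by simp
  have "v ! (r - 1) \<in> {0, 1}" by (rule nth_bit[OF balancedD(3)[OF bal] l])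
  then show ?thesis unfolding back_of_def h using l by (auto simp: back_lab_def lab_word_def)
qed

lemma enc_in_puzzles: "enc (slash_of D) (back_of D) N 1 \<in> puzzles (lab_word u) (lab_word v) (lab_word w)"
proof -
  have len: "length (lab_word u) = N" "length (lab_word v) = N" "length (lab_word w) = N"
    using balancedD[OF bal] by simp_all
  have b: "tri (slash_of D i N) (back_of D i N) (lab_word w ! (i - 1))" if ii: "i \<in> {1..N}" for i
  proof -
    obtain k where k: "i = Suc k" "k < N" using ii by (cases i) auto
    have "hor_lab (vdown N w D (2 * i - 1) N) = lab_word w ! (i - 1)"
      using len k by (simp add: vdown_def virt_def hor_lab_def lab_word_def)
    then show ?thesis using up_tri[of i N] ii by simp
  qed
  have rh: "rhomb_ok (slash_of D i r) (back_of D i r) (back_of D i (Suc r)) (slash_of D (Suc i) (Suc r))"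
    if "i \<in> {1..N}" "r \<in> {i..<N}" for i r
  proof -
    have "vdown N w D (2 * i - 1) r = vcol D (2 * i - 1) r" using that by (simp add: vdown_def)
    then show ?thesis using up_tri[of i r] down_tri[of i r] that unfolding rhomb_ok_def by auto
  qed
  show ?thesis
    using enc_mem[OF len, of "slash_of D" "back_of D"] left_label right_label b rh by auto
qed

end

lemma arcs_subset:
  assumes D: "arcs N D" and D': "arcs N D'"
    and h: "\<And>i r. 1 \<le> r \<Longrightarrow> r \<le> N \<Longrightarrow> i < 2 * r \<Longrightarrow> hcol D i r = hcol D' i r"
    and v: "\<And>i r. 1 \<le> r \<Longrightarrow> r < N \<Longrightarrow> i \<le> 2 * r \<Longrightarrow> vcol D i r = vcol D' i r"
  shows "D \<subseteq> D'"
proof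
  fix e assume e: "e \<in> D"
  obtain p q where pq: "e = (p, q)" by (cases e)
  note a = arcsD(1-3)[OF D e[unfolded pq]]
  from gverts_pt[OF a(1)] obtain i r where p: "p = pt i r" "1 \<le> r" "r \<le> N" "i \<le> 2 * r" by blast
  from gverts_pt[OF a(2)] obtain j s where q: "q = pt j s" "1 \<le> s" "s \<le> N" "j \<le> 2 * s" by blast
  have "\<bar>(int i - int r) - (int j - int s)\<bar> + \<bar>int r - int s\<bar> = 1"
    using a(3) by (simp add: p q adj_def pt_def)
  then consider "r = s" "j = Suc i" | "r = s" "i = Suc j" | "s = Suc r" "j = Suc i" | "r = Suc s" "i = Suc j"
    by linarith
  then show "e \<in> D'"
  proof cases
    case 1
    then have "hcol D i r = hcol D' i r" using h p q by simp
    then show ?thesis using e 1 unfolding pq p(1) q(1) by (simp add: hcol_def of_bool_eq_iff split: if_splits)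
  next
    case 2
    then have "hcol D j r = hcol D' j r" using h p q by simp
    then show ?thesis using e 2 unfolding pq p(1) q(1) by (simp add: hcol_def of_bool_eq_iff split: if_splits)
  next
    case 3
    then have "vcol D i r = vcol D' i r" using v p q by simp
    then show ?thesis using e 3 unfolding pq p(1) q(1) by (simp add: vcol_def of_bool_eq_iff split: if_splits)
  next
    case 4
    then have "vcol D j s = vcol D' j s" using v p q by simp
    then show ?thesis using e 4 unfolding pq p(1) q(1) by (simp add: vcol_def of_bool_eq_iff split: if_splits)
  qed
qed

lemma enc_eqD:
  assumes "enc A B N 1 = enc A' B' N 1"
  shows "\<And>j r. 1 \<le> j \<Longrightarrow> j \<le> r \<Longrightarrow> r \<le> N \<Longrightarrow> B j r = B' j r"
    "\<And>j r. 2 \<le> j \<Longrightarrow> j \<le> r \<Longrightarrow> r \<le> N \<Longrightarrow> A j r = A' j r"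
proof -
  have s: "enc_strip A B j N = enc_strip A' B' j N" if "1 \<le> j" "j \<le> N" for j
  proof -
    have "\<forall>j\<in>set [1..<Suc N]. enc_strip A B j N = enc_strip A' B' j N"
      using assms unfolding enc_def map_eq_conv .
    then show ?thesis using that by (auto simp del: upt_Suc)
  qed
  show "B j r = B' j r" if "1 \<le> j" "j \<le> r" "r \<le> N" for j r
    using s[of j] that unfolding enc_strip_def prod.inject map_eq_conv by (simp del: upt_Suc)
  show "A j r = A' j r" if "2 \<le> j" "j \<le> r" "r \<le> N" for j r
  proof -
    obtain k where k: "j = Suc k" using \<open>2 \<le> j\<close> by (cases j) auto
    show ?thesis using s[of k] that unfolding k enc_strip_def prod.inject map_eq_conv by (simp del: upt_Suc)
  qed
qed

text \<open>The labels determine the horizontal colours, and the sum condition at the even vertex at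
  its upper end determines each remaining vertical one. The reverse inclusion follows by exchanging
  \<open>D\<close> and \<open>D'\<close>.\<close>

lemma enc_inj:
  assumes bal: "balanced N u v w" and ok: "locally_ok N D u v w" and ok': "locally_ok N D' u v w"
    and eq: "enc (slash_of D) (back_of D) N 1 = enc (slash_of D') (back_of D') N 1"
  shows "D \<subseteq> D'"
proof (rule arcs_subset)
  show A: "arcs N D" and A': "arcs N D'" using ok ok' unfolding locally_ok_def by blast+
  show h: "hcol D i r = hcol D' i r" if r: "1 \<le> r" "r \<le> N" "i < 2 * r" for i r
  proof (cases "even i")
    case True
    then obtain k where k: "i = 2 * k" by (elim evenE)
    have "slash_of D (Suc k) r = slash_of D' (Suc k) r"
    proof (cases k)
      case 0
      then show ?thesis using left_label[OF bal ok r(1,2)] left_label[OF bal ok' r(1,2)] by simp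
    next
      case (Suc m)
      then show ?thesis using enc_eqD(2)[OF eq, of "Suc k" r] r k by simp
    qed
    then have "slash_lab (hcol D i r) = slash_lab (hcol D' i r)" by (simp add: slash_of_def k)
    then show ?thesis using col_lab(1)[OF hcol_colour[OF A]] col_lab(1)[OF hcol_colour[OF A']] by metis
  next
    case False
    then obtain k where k: "i = 2 * k + 1" by (elim oddE)
    have "back_of D (Suc k) r = back_of D' (Suc k) r"
      using enc_eqD(1)[OF eq, of "Suc k" r] r k by simp
    then have "back_lab (hcol D i r) = back_lab (hcol D' i r)" by (simp add: back_of_def k)
    then show ?thesis using col_lab(2)[OF hcol_colour[OF A]] col_lab(2)[OF hcol_colour[OF A']] by metis
  qed
  show "vcol D i r = vcol D' i r" if r: "1 \<le> r" "r < N" "i \<le> 2 * r" for i r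
  proof (cases "even i")
    case True
    then show ?thesis using ok_facts(1)[OF bal ok, of r i] ok_facts(1)[OF bal ok', of r i] r by simp
  next
    case False
    then obtain k where k: "i = 2 * k + 1" by (elim oddE)
    obtain q where q: "r = Suc q" using r by (cases r) auto
    have "2 * k < 2 * q + 1" using r(3) unfolding k q by presburger
    moreover have "q < N" using r(2) q by simp
    ultimately have i: "2 * k < 2 * q + 1" "q < N" .
    have "add4 (hcol D (2 * k) r) (hcol D i r) (0, 0) (vcol D i r) = (1, 1)"
      "add4 (hcol D' (2 * k) r) (hcol D' i r) (0, 0) (vcol D' i r) = (1, 1)"
      using ok_site[OF bal ok i(2,1)] ok_facts(1)[OF bal ok i(2,1)] ok_site[OF bal ok' i(2,1)] ok_facts(1)[OF bal ok' i(2,1)] r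
      by (simp_all add: q k vdown_def)
    moreover have il: "i < 2 * r" using r(3) unfolding k by presburger
    moreover have "hcol D i r = hcol D' i r" "hcol D (2 * k) r = hcol D' (2 * k) r"
      using h[of r i] h[of r "2 * k"] r il k by simp_all
    ultimately show ?thesis
      by (cases "hcol D' (2 * k) r"; cases "hcol D' i r"; cases "vcol D i r"; cases "vcol D' i r") simp
  qed
qed

section \<open>Reconstruction of an oriented TFPL from a puzzle\<close>

definition arcs_of :: "nat \<Rightarrow> (nat \<Rightarrow> nat \<Rightarrow> int \<times> int) \<Rightarrow> (nat \<Rightarrow> nat \<Rightarrow> int \<times> int) \<Rightarrow> (vert \<times> vert) set" where
  "arcs_of N hc vc =
    {(p, q). \<exists>i r. 1 \<le> r \<and> r \<le> N \<and> i < 2 * r \<and>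
       (p = pt i r \<and> q = pt (Suc i) r \<and> hc i r = (if even i then (1, 0) else (0, 1)) \<or>
        p = pt (Suc i) r \<and> q = pt i r \<and> hc i r = (if even i then (0, 1) else (1, 0)))} \<union>
    {(p, q). \<exists>i r. 1 \<le> r \<and> r < N \<and> i \<le> 2 * r \<and>
       (p = pt i r \<and> q = pt (Suc i) (Suc r) \<and> vc i r = (if even i then (1, 0) else (0, 1)) \<or>
        p = pt (Suc i) (Suc r) \<and> q = pt i r \<and> vc i r = (if even i then (0, 1) else (1, 0)))}"

lemma arcs_of_hor:
  "(pt i r, pt (Suc i) r) \<in> arcs_of N hc vc \<longleftrightarrow> 1 \<le> r \<and> r \<le> N \<and> i < 2 * r \<and> hc i r = (if even i then (1, 0) else (0, 1))"
  "(pt (Suc i) r, pt i r) \<in> arcs_of N hc vc \<longleftrightarrow> 1 \<le> r \<and> r \<le> N \<and> i < 2 * r \<and> hc i r = (if even i then (0, 1) else (1, 0))"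
  unfolding arcs_of_def by (auto simp: pt_inj)

lemma arcs_of_ver:
  "(pt i r, pt (Suc i) (Suc r)) \<in> arcs_of N hc vc \<longleftrightarrow> 1 \<le> r \<and> r < N \<and> i \<le> 2 * r \<and> vc i r = (if even i then (1, 0) else (0, 1))"
  "(pt (Suc i) (Suc r), pt i r) \<in> arcs_of N hc vc \<longleftrightarrow> 1 \<le> r \<and> r < N \<and> i \<le> 2 * r \<and> vc i r = (if even i then (0, 1) else (1, 0))"
  unfolding arcs_of_def by (auto simp: pt_inj)

lemma adj_pt: "adj (pt i r) (pt (Suc i) r)" "adj (pt i r) (pt (Suc i) (Suc r))"
  by (simp_all add: adj_def pt_def)

lemma arcs_of_cases:
  assumes "(p, q) \<in> arcs_of N hc vc"
  obtains i r where "1 \<le> r" "r \<le> N" "i < 2 * r" "p = pt i r" "q = pt (Suc i) r"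
  | i r where "1 \<le> r" "r \<le> N" "i < 2 * r" "p = pt (Suc i) r" "q = pt i r"
  | i r where "1 \<le> r" "r < N" "i \<le> 2 * r" "p = pt i r" "q = pt (Suc i) (Suc r)"
  | i r where "1 \<le> r" "r < N" "i \<le> 2 * r" "p = pt (Suc i) (Suc r)" "q = pt i r"
  using assms unfolding arcs_of_def by blast

lemma arcs_arcs_of: "arcs N (arcs_of N hc vc)"
proof -
  have 1: "p \<in> gverts N \<and> q \<in> gverts N \<and> adj p q" if "(p, q) \<in> arcs_of N hc vc" for p q
    using that by (cases rule: arcs_of_cases) (auto simp: pt_gverts adj_pt adj_sym)
  have 2: "(q, p) \<notin> arcs_of N hc vc" if pq: "(p, q) \<in> arcs_of N hc vc" for p q
  proof
    assume qp: "(q, p) \<in> arcs_of N hc vc"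
    show False using pq
    proof (cases rule: arcs_of_cases)
      case (1 i r)
      then show ?thesis using pq qp unfolding 1(4,5) arcs_of_hor by (auto split: if_splits)
    next
      case (2 i r)
      then show ?thesis using pq qp unfolding 2(4,5) arcs_of_hor by (auto split: if_splits)
    next
      case (3 i r)
      then show ?thesis using pq qp unfolding 3(4,5) arcs_of_ver by (auto split: if_splits)
    next
      case (4 i r)
      then show ?thesis using pq qp unfolding 4(4,5) arcs_of_ver by (auto split: if_splits)
    qed
  qed
  show ?thesis unfolding arcs_def using 1 2 by blast
qed

lemma hcol_arcs_of:
  assumes "1 \<le> r" "r \<le> N" "i < 2 * r" "hc i r \<in> colours"
  shows "hcol (arcs_of N hc vc) i r = hc i r"
  using assms unfolding hcol_def arcs_of_hor by (auto simp: colours_def)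

lemma vcol_arcs_of:
  assumes "1 \<le> r" "r < N" "i \<le> 2 * r" "vc i r \<in> colours"
  shows "vcol (arcs_of N hc vc) i r = vc i r"
  using assms unfolding vcol_def arcs_of_ver by (auto simp: colours_def)

lemma tri_third_unique: "tri a b c \<Longrightarrow> tri a b c' \<Longrightarrow> c = c'"
  by (cases a; cases b; cases c; cases c'; simp)

lemma puzzle_decodes:
  assumes bal: "balanced N u v w" and L: "L \<in> puzzles (lab_word u) (lab_word v) (lab_word w)"
  shows "\<exists>D. locally_ok N D u v w \<and> enc (slash_of D) (back_of D) N 1 = L"
proof -
  note B = balancedD[OF bal]
  have len: "length (lab_word u) = N" "length (lab_word v) = N" "length (lab_word w) = N" using B by simp_all
  obtain S K where enc: "enc S K N 1 = L" and S1: "\<And>r. 1 \<le> r \<Longrightarrow> r \<le> N \<Longrightarrow> S 1 r = lab_word u ! (N - r)"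
    using decode[OF L len] by metis
  have "\<forall>i\<in>{1..N}. K i i = lab_word v ! (i - 1) \<and> tri (S i N) (K i N) (lab_word w ! (i - 1)) \<and>
       (\<forall>r\<in>{i..<N}. rhomb_ok (S i r) (K i r) (K i (Suc r)) (S (Suc i) (Suc r)))"
  proof -
    have "enc S K N 1 \<in> puzzles (lab_word u) (lab_word v) (lab_word w)" using L enc by simp
    then show ?thesis using enc_mem[where A = S and B = K, OF len S1] by blast
  qed
  then have K: "\<And>i. 1 \<le> i \<Longrightarrow> i \<le> N \<Longrightarrow> K i i = lab_word v ! (i - 1)"
    and bot: "\<And>i. 1 \<le> i \<Longrightarrow> i \<le> N \<Longrightarrow> tri (S i N) (K i N) (lab_word w ! (i - 1))"
    and rh: "\<And>i r. 1 \<le> i \<Longrightarrow> i \<le> r \<Longrightarrow> r < N \<Longrightarrow> rhomb_ok (S i r) (K i r) (K i (Suc r)) (S (Suc i) (Suc r))"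
    by auto
  \<comment> \<open>Lists of strips do not record horizontal labels; they are determined by the
    other two sides of the upward triangle.\<close>
  define H where "H j r = (THE c. tri (S j r) (K j r) c)" for j r
  have H: "tri (S i r) (K i r) (H i r)" "tri (S (Suc i) (Suc r)) (K i (Suc r)) (H i r)"
    if ir: "1 \<le> i" "i \<le> r" "r < N" for i r
  proof -
    obtain c where c: "tri (S i r) (K i r) c" "tri (S (Suc i) (Suc r)) (K i (Suc r)) c"
      using rh[OF ir] unfolding rhomb_ok_def by blast
    have "H i r = c" unfolding H_def using c(1) tri_third_unique by blast
    then show "tri (S i r) (K i r) (H i r)" "tri (S (Suc i) (Suc r)) (K i (Suc r)) (H i r)" using c by simp_all
  qed
  define hc where "hc i r = (if even i then slash_col (S (i div 2 + 1) r) else back_col (K (i div 2 + 1) r))" for i r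
  \<comment> \<open>Even indices belong to the edges from an odd vertex down to an even one, which
    are absent without excess.\<close>
  define vc where "vc i r = (if even i then (0, 0) else hor_col (H (i div 2 + 1) r))" for i r :: nat
  define D where "D = arcs_of N hc vc"
  have hcc: "hc i r \<in> colours" for i r using col_colours by (simp add: hc_def)
  have vcc: "vc i r \<in> colours" for i r using col_colours by (simp add: vc_def colours_def)
  have A: "arcs N D" unfolding D_def by (rule arcs_arcs_of)
  have h: "hcol D i r = hc i r" if "1 \<le> r" "r \<le> N" "i < 2 * r" for i r
    unfolding D_def using that by (rule hcol_arcs_of) (rule hcc)
  have v: "vcol D i r = vc i r" if "1 \<le> r" "r < N" "i \<le> 2 * r" for i r
    unfolding D_def using that by (rule vcol_arcs_of) (rule vcc)
  have v00: "vcol D 0 0 = (0, 0)" by (simp add: vcol_def no_arc[OF A] pt_gverts)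
  have vup0: "vcol D i q = (0, 0)" if "even i" "q < N" "i \<le> 2 * q" for i q
  proof (cases "q = 0")
    case True
    then show ?thesis using v00 that by simp
  next
    case False
    then show ?thesis using v[of q i] that by (simp add: vc_def)
  qed
  have vd0: "vdown N w D i r = (0, 0)" if "even i" "1 \<le> r" "r \<le> N" "i \<le> 2 * r" for i r
    using vup0[of i r] that by (simp add: vdown_def virt_def)
  have vd1: "vdown N w D (2 * k + 1) r = hor_col (if r = N then lab_word w ! k else H (Suc k) r)" if "k < r" "r \<le> N" for k r
  proof (cases "r = N")
    case True
    then show ?thesis using that B(7) by (simp add: vdown_def virt_def lab_word_def)
  next
    case False
    then show ?thesis using v[of r "2 * k + 1"] that by (simp add: vdown_def vc_def)
  qed
  have int: "add4 (hcol D (i - 1) r) (hcol D i r) (vcol D (i - 1) (r - 1)) (vdown N w D i r) = (1, 1)"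
    if r: "r \<in> {1..N}" and i: "i \<in> {0<..<2 * r}" for r i
  proof (cases "even i")
    case False
    then obtain k where k: "i = 2 * k + 1" by (elim oddE)
    have kr: "k < r" using i k by simp
    have "tri (S (Suc k) r) (K (Suc k) r) (if r = N then lab_word w ! k else H (Suc k) r)"
      using bot[of "Suc k"] H(1)[of "Suc k" r] kr r by simp
    from tri_add[OF this] show ?thesis
      using vd1[OF kr] h[of r "2 * k"] h[of r "2 * k + 1"] vup0[of "2 * k" "r - 1"] kr r
      by (simp add: k hc_def)
  next
    case True
    then obtain m where m: "i = 2 * m" by (elim evenE)
    then obtain k where k: "i = 2 * k + 2" using i by (cases m) auto
    obtain q where q: "r = Suc q" using r by (cases r) auto
    have kq: "k < q" using i k q by simp
    have "tri (S (Suc (Suc k)) r) (K (Suc k) r) (H (Suc k) q)"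
      using H(2)[of "Suc k" q] kq r q by simp
    from tri_add[OF this]
    have t: "add4 (slash_col (S (Suc (Suc k)) r)) (back_col (K (Suc k) r)) (0, 0) (hor_col (H (Suc k) q)) = (1, 1)" .
    have e: "hcol D (i - 1) r = back_col (K (Suc k) r)" "hcol D i r = slash_col (S (Suc (Suc k)) r)"
      "vcol D (i - 1) (r - 1) = hor_col (H (Suc k) q)" "vdown N w D i r = (0, 0)"
      using h[of r "2 * k + 1"] h[of r "2 * k + 2"] v[of q "2 * k + 1"] vd0[of i r] kq r q
      by (simp_all add: k hc_def vc_def)
    show ?thesis unfolding e using t
      by (cases "slash_col (S (Suc (Suc k)) r)"; cases "back_col (K (Suc k) r)"; cases "hor_col (H (Suc k) q)") simp
  qed
  have lft: "add4 (0, 0) (hcol D 0 r) (0, 0) (vdown N w D 0 r) = (int (u ! (N - r)), 0)" if r: "r \<in> {1..N}" for r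
  proof -
    have l: "N - r < length u" using r B(5) by auto
    have "u ! (N - r) \<in> {0, 1}" by (rule nth_bit[OF B(2) l])
    then have "hcol D 0 r = (int (u ! (N - r)), 0)"
      using h[of r 0] S1[of r] r l by (auto simp: hc_def lab_word_def)
    then show ?thesis using vd0[of 0 r] r by simp
  qed
  have rgt: "add4 (hcol D (2 * r - 1) r) (0, 0) (0, 0) (vdown N w D (2 * r) r) = (0, 1 - int (v ! (r - 1)))"
    if r: "r \<in> {1..N}" for r
  proof -
    obtain q where q: "r = Suc q" using r by (cases r) auto
    have l: "q < length v" using r q B(6) by auto
    have "v ! q \<in> {0, 1}" by (rule nth_bit[OF B(3) l])
    then have "hcol D (2 * q + 1) r = (0, 1 - int (v ! q))"
      using h[of r "2 * q + 1"] K[of r] r l by (auto simp: hc_def lab_word_def q)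
    then show ?thesis using vd0[of "2 * r" r] r by (simp add: q)
  qed
  have ok: "locally_ok N D u v w" unfolding locally_ok_def using A int lft rgt by blast
  have S: "slash_of D j r = S j r" if "1 \<le> j" "j \<le> r" "r \<le> N" for j r
  proof -
    have "2 * j - 2 < 2 * r" "(2 * j - 2) div 2 + 1 = j" using that by auto
    then show ?thesis using h[of r "2 * j - 2"] that by (simp add: slash_of_def hc_def lab_col)
  qed
  have K': "back_of D j r = K j r" if "1 \<le> j" "j \<le> r" "r \<le> N" for j r
  proof -
    obtain k where k: "j = Suc k" using \<open>1 \<le> j\<close> by (cases j) auto
    show ?thesis using h[of r "2 * k + 1"] that by (simp add: back_of_def hc_def lab_col k)
  qed
  have "enc (slash_of D) (back_of D) N 1 = enc S K N 1"
    unfolding enc_def enc_strip_def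
    by (auto simp: S K' simp del: upt_Suc)
  then show ?thesis using ok enc by auto
qed

theorem card_locally_ok:
  assumes bal: "balanced N u v w"
  shows "int (card {D. locally_ok N D u v w}) = puz0 (lab_word u) (lab_word v) (lab_word w)"
proof -
  let ?f = "\<lambda>D. enc (slash_of D) (back_of D) N 1"
  have "bij_betw ?f {D. locally_ok N D u v w} (puzzles (lab_word u) (lab_word v) (lab_word w))"
  proof (rule bij_betwI')
    fix D D' assume ok: "D \<in> {D. locally_ok N D u v w}" "D' \<in> {D. locally_ok N D u v w}"
    show "?f D = ?f D' \<longleftrightarrow> D = D'"
    proof
      assume eq: "?f D = ?f D'"
      show "D = D'"
        using enc_inj[OF bal _ _ eq] enc_inj[OF bal _ _ eq[symmetric]] ok by blast
    qed simp
  next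
    fix D assume "D \<in> {D. locally_ok N D u v w}"
    then show "?f D \<in> puzzles (lab_word u) (lab_word v) (lab_word w)"
      using enc_in_puzzles[OF bal] by blast
  next
    fix L assume "L \<in> puzzles (lab_word u) (lab_word v) (lab_word w)"
    then show "\<exists>D\<in>{D. locally_ok N D u v w}. L = ?f D"
      using puzzle_decodes[OF bal] by blast
  qed
  then have "card {D. locally_ok N D u v w} = card (puzzles (lab_word u) (lab_word v) (lab_word w))"
    by (rule bij_betw_same_card)
  then show ?thesis
    using card_puzzles[of "lab_word v" "lab_word u" "lab_word w"] balancedD[OF bal] by simp
qed

theorem theorem5p6:
  fixes N :: nat and u v w :: "nat list"
  assumes "N \<ge> 1"
    and "length u = N" and "length v = N" and "length w = N"
    and "set u \<subseteq> {0, 1}" and "set v \<subseteq> {0, 1}" and "set w \<subseteq> {0, 1}"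
    and "zeros u = zeros v" and "zeros v = zeros w"
    and "inv_d w = inv_d u + inv_d v"
  shows "int (card {D. is_oriented_tfpl N D \<and> has_boundary N D u v w})
           = lr_coeff (lam u) (lam v) (lam w)"
proof -
  have bal: "balanced N u v w"
    using assms by (simp add: balanced_def zeros_def inv_lab_word)
  have "{D. is_oriented_tfpl N D \<and> has_boundary N D u v w} = {D. locally_ok N D u v w}"
    using tfpl_locally_ok[of N _ u v w] locally_ok_tfpl[of N _ u v w] assms by blast
  moreover have "compatible (lab_word u) (lab_word v) (lab_word w)"
    using balancedD[OF bal] by (simp add: compatible_def count_lab_word_N0)
  ultimately show ?thesis
    using card_locally_ok[OF bal] puz_lr[of "lab_word u" "lab_word v" "lab_word w"] assms
    by (simp add: shape_lab_word)
qed

end
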